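(* Let $\Lambda=\mathbb{R}^k$, let $\sigma$ be a positive diffuse Radon measure on $\Lambda$, let $\widehat\Lambda=[0,\infty)\times\Lambda$, let $\lambda$ be Lebesgue measure on $[0,\infty)$, and let $\widehat\mu$ be the Poisson measure of intensity $\lambda\otimes\sigma$ on the configuration space $\Gamma_{\widehat\Lambda}$. Let $L$ be the (positive) density of an absolutely continuous probability measure $\widehat\nu$ with respect to $\widehat\mu$. Let $u$ be the predictable process $$u(t,z)=\frac{\mathbb{E}_{\widehat\mu}[\nabla^\sharp_{t,z}L\,|\,\mathfrak{F}_{t^-}]}{\mathbb{E}_{\widehat\mu}[L\,|\,\mathfrak{F}_{t^-}]}\;>-1,\qquad v(t,z)=t+\int_0^tu(s,z)\,ds,\qquad t\ge 0,\ z\in\Lambda,$$ and let $v^{-1}(\cdot,z)$ be the inverse of the increasing mapping $t\mapsto v(t,z)$. Then, provided the inequality makes sense (i.e. the quantities involved are well defined), $$\mathcal{T}_{\widehat{\rho_2}}(\widehat\mu,\widehat\nu)^2\le \mathbb{E}_{\widehat\mu}\left[L\int_\Lambda\int_0^{+\infty}\left|\int_0^tu(s,z)\,ds\right|^2(1+u(t,z))\,dt\,d\sigma(z)\right]=\mathbb{E}_{\widehat\mu}\left[L\int_\Lambda\int_0^{+\infty}\left|r-v^{-1}(r,z)\right|^2dr\,d\sigma(z)\right].$$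
   Context: $\Gamma_{\widehat\Lambda}$ is the set of subsets $\widehat\omega$ of $\widehat\Lambda$ having finite intersection with every compact set, each identified with the Radon measure $\sum_{(t,x)\in\widehat\omega}\varepsilon_{t,x}$ (sum of Dirac masses), endowed with the vague topology and its Borel $\sigma$-algebra. The Poisson measure $\widehat\mu$ is characterized by $\mathbb{E}_{\widehat\mu}[\exp(\int f\,d\widehat\omega)]=\exp\{\int(e^f-1)\,d(\lambda\otimes\sigma)\}$ for all continuous compactly supported $f$ on $\widehat\Lambda$. Filtration: $\mathfrak{F}_t=\sigma\{\widehat\omega([0,s]\times B): 0\le s\le t,\ B\in\mathcal{B}(\Lambda)\}$, and $\mathfrak F_{t^-}$ is its left limit; predictability is with respect to this filtration. Discrete gradient: $\nabla^\sharp_{t,z}G(\widehat\omega)=G(\widehat\omega+\varepsilon_{t,z})-G(\widehat\omega)$. Wasserstein distance on $\Gamma_{\widehat\Lambda}$ (possibly infinite): with $\kappa$ the Euclidean distance on $\mathbb{R}^k$, $$\widehat{\rho_2}(\widehat\omega,\widehat\eta)^2=\inf_{\beta\in\Sigma(\widehat\omega,\widehat\eta)}\int_{\widehat\Lambda}\int_{\widehat\Lambda}\big(\kappa(x,y)^2+|t-s|^2\big)\,d\beta((s,x),(t,y)),$$ where $\Sigma(\widehat\omega,\widehat\eta)$ is the set of configurations $\beta\in\Gamma_{\widehat\Lambda\times\widehat\Lambda}$ with marginals $\widehat\omega$ and $\widehat\eta$ (and $\inf\emptyset=+\infty$). The Rubinstein distance is $\mathcal{T}_{\widehat{\rho_2}}(\widehat\mu,\widehat\nu)=\inf_\gamma\int\int\widehat{\rho_2}(\widehat\omega,\widehat\eta)\,d\gamma(\widehat\omega,\widehat\eta)$,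 the infimum running over probability measures $\gamma$ on $\Gamma_{\widehat\Lambda}\times\Gamma_{\widehat\Lambda}$ with marginals $\widehat\mu$ and $\widehat\nu$. *)

theory Defs
  imports "HOL-Probability.Probability"
begin

section \<open>Configuration spaces\<close>

definition configurations :: "'a::topological_space set \<Rightarrow> 'a set set" where
  "configurations X = {\<omega>. \<omega> \<subseteq> X \<and> (\<forall>K. compact K \<and> K \<subseteq> X \<longrightarrow> finite (\<omega> \<inter> K))}"

text \<open>The sum of the Dirac masses at the points of \<open>\<omega>\<close>, as a Borel measure.\<close>

definition config_measure :: "'a::topological_space set \<Rightarrow> 'a measure" where
  "config_measure \<omega> = distr (count_space \<omega>) borel (\<lambda>p. p)"

text \<open>Continuous functions with compact support on \<open>X\<close>, extended by zero outside \<open>X\<close>.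
  Continuity is only required relative to \<open>X\<close>, so for \<open>X = [0,\<infinity>) \<times> \<Lambda>\<close> the function need
  not vanish at time zero.\<close>

definition Cc :: "'a::topological_space set \<Rightarrow> ('a \<Rightarrow> real) set" where
  "Cc X = {f. continuous_on X f \<and> (\<exists>K. compact K \<and> K \<subseteq> X \<and> (\<forall>p. p \<notin> K \<longrightarrow> f p = 0))}"

definition vague_topology :: "'a::topological_space set \<Rightarrow> 'a set topology" where
  "vague_topology X = topology_generated_by
     {{\<omega> \<in> configurations X. (\<integral>p. f p \<partial>config_measure \<omega>) \<in> U} | f U. f \<in> Cc X \<and> open U}"

definition config_borel :: "'a::topological_space set \<Rightarrow> 'a set measure" where
  "config_borel X = sigma (configurations X) {U. openin (vague_topology X) U}"

definition poisson_measure ::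
    "'a::topological_space set \<Rightarrow> 'a measure \<Rightarrow> 'a set measure \<Rightarrow> bool" where
  "poisson_measure X \<pi> \<mu> \<longleftrightarrow>
     prob_space \<mu> \<and> sets \<mu> = sets (config_borel X) \<and>
     (\<forall>f \<in> Cc X. (\<integral>\<omega>. exp (\<integral>p. f p \<partial>config_measure \<omega>) \<partial>\<mu>) = exp (\<integral>p. (exp (f p) - 1) \<partial>\<pi>))"

text \<open>On a Euclidean space a Borel measure that is finite on compact sets is automatically
  inner and outer regular, so no separate regularity condition is needed.\<close>

definition diffuse_radon_measure :: "'a::euclidean_space measure \<Rightarrow> bool" where
  "diffuse_radon_measure \<sigma> \<longleftrightarrow>
     sets \<sigma> = sets borel \<and> (\<forall>K. compact K \<longrightarrow> emeasure \<sigma> K < \<infinity>) \<and> (\<forall>x. emeasure \<sigma> {x} = 0)"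

section \<open>Time-space configurations, filtration and predictability\<close>

definition time_space :: "(real \<times> 'z::topological_space) set" where
  "time_space = {0..} \<times> UNIV"

definition halfline :: "real measure" where
  "halfline = restrict_space lborel {0..}"

definition filt :: "real \<Rightarrow> (real \<times> 'z::topological_space) set measure" where
  "filt t = sigma (configurations time_space)
     {{\<omega> \<in> configurations time_space. emeasure (config_measure \<omega>) ({0..s} \<times> B) \<in> C} | s B C.
        0 \<le> s \<and> s \<le> t \<and> B \<in> sets borel \<and> C \<in> sets borel}"

text \<open>The left limit of the filtration at \<open>t > 0\<close> is generated by the sigma-algebras at times
  \<open>0 \<le> s < t\<close>; at \<open>t = 0\<close> the usual convention applies and it is \<open>filt 0\<close>.\<close>

definition filt_left :: "real \<Rightarrow> (real \<times> 'z::topological_space) set measure" where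
  "filt_left t = sigma (configurations time_space) (\<Union>s \<in> {0} \<union> {0..<t}. sets (filt s))"

definition predictable_sigma ::
    "((real \<times> 'z::topological_space) set \<times> (real \<times> 'z)) measure" where
  "predictable_sigma = sigma (configurations time_space \<times> time_space)
     ({A \<times> ({s<..t} \<times> B) | A s t B. 0 \<le> s \<and> s < t \<and> A \<in> sets (filt s) \<and> B \<in> sets borel} \<union>
      {A \<times> ({0} \<times> B) | A B. A \<in> sets (filt 0) \<and> B \<in> sets borel})"

definition predictable ::
    "(real \<Rightarrow> 'z::topological_space \<Rightarrow> (real \<times> 'z) set \<Rightarrow> real) \<Rightarrow> bool" where
  "predictable u \<longleftrightarrow> (\<lambda>(\<omega>, (t, z)). u t z \<omega>) \<in> borel_measurable predictable_sigma"

text \<open>Adding a Dirac mass is inserting a point.  The two differ only when \<open>(t, z)\<close> already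
  belongs to \<open>\<omega>\<close>, which for a diffuse intensity has probability zero for each \<open>(t, z)\<close>.\<close>

definition grad :: "real \<Rightarrow> 'z \<Rightarrow> ((real \<times> 'z) set \<Rightarrow> real) \<Rightarrow> (real \<times> 'z) set \<Rightarrow> real" where
  "grad t z G \<omega> = G (insert (t, z) \<omega>) - G \<omega>"

definition time_integral ::
    "(real \<Rightarrow> 'z \<Rightarrow> (real \<times> 'z) set \<Rightarrow> real) \<Rightarrow> real \<Rightarrow> 'z \<Rightarrow> (real \<times> 'z) set \<Rightarrow> real" where
  "time_integral u t z \<omega> = (LINT s:{0..t}|lborel. u s z \<omega>)"

definition time_change ::
    "(real \<Rightarrow> 'z \<Rightarrow> (real \<times> 'z) set \<Rightarrow> real) \<Rightarrow> real \<Rightarrow> 'z \<Rightarrow> (real \<times> 'z) set \<Rightarrow> real" where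
  "time_change u t z \<omega> = t + time_integral u t z \<omega>"

definition time_change_inv ::
    "(real \<Rightarrow> 'z \<Rightarrow> (real \<times> 'z) set \<Rightarrow> real) \<Rightarrow> real \<Rightarrow> 'z \<Rightarrow> (real \<times> 'z) set \<Rightarrow> real" where
  "time_change_inv u r z \<omega> = the_inv_into {0..} (\<lambda>t. time_change u t z \<omega>) r"

section \<open>Wasserstein and Rubinstein distances\<close>

definition config_couplings ::
    "'a::topological_space set \<Rightarrow> 'a set \<Rightarrow> 'a set \<Rightarrow> ('a \<times> 'a) set set" where
  "config_couplings X \<omega> \<eta> = {\<beta> \<in> configurations (X \<times> X).
     distr (config_measure \<beta>) borel fst = config_measure \<omega> \<and>
     distr (config_measure \<beta>) borel snd = config_measure \<eta>}"

definition ennreal_sqrt :: "ennreal \<Rightarrow> ennreal" where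
  "ennreal_sqrt x = (if x = \<infinity> then \<infinity> else ennreal (sqrt (enn2real x)))"

text \<open>In \<open>ennreal\<close> the infimum of the empty set is \<open>\<infinity>\<close>.\<close>

definition wasserstein ::
    "(real \<times> 'z::euclidean_space) set \<Rightarrow> (real \<times> 'z) set \<Rightarrow> ennreal" where
  "wasserstein \<omega> \<eta> = ennreal_sqrt
     (INF \<beta> \<in> config_couplings time_space \<omega> \<eta>.
        \<integral>\<^sup>+((s, x), (t, y)). ennreal ((dist x y)\<^sup>2 + \<bar>t - s\<bar>\<^sup>2) \<partial>config_measure \<beta>)"

definition prob_couplings :: "'a measure \<Rightarrow> 'b measure \<Rightarrow> ('a \<times> 'b) measure set" where
  "prob_couplings M N = {\<gamma>. prob_space \<gamma> \<and> sets \<gamma> = sets (M \<Otimes>\<^sub>M N) \<and>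
     distr \<gamma> M fst = M \<and> distr \<gamma> N snd = N}"

definition rubinstein :: "('a \<Rightarrow> 'a \<Rightarrow> ennreal) \<Rightarrow> 'a measure \<Rightarrow> 'a measure \<Rightarrow> ennreal" where
  "rubinstein \<rho> M N = (INF \<gamma> \<in> prob_couplings M N. \<integral>\<^sup>+(\<omega>, \<eta>). \<rho> \<omega> \<eta> \<partial>\<gamma>)"

end

theory Submission
  imports Defs
begin

text \<open>Mecke's formula \<open>E \<Sum>\<^bsub>x \<in> \<omega>\<^esub> F(x, \<omega>) = \<integral> E F(x, \<omega> + \<epsilon>\<^sub>x) d\<pi>(x)\<close> is obtained by differentiating the Laplace
  functional of the Poisson measure.  Conditioning \<open>L(\<omega> + \<epsilon>\<^sub>x)\<close> on the strict past of \<open>x = (t, z)\<close> turns it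
  into Girsanov's formula: under \<open>\<nu>\<close> the points have compensator \<open>(1 + u) dt d\<sigma>\<close>.  Hence moving every
  point \<open>(t, z)\<close> to \<open>(v(t, z), z)\<close> transforms \<open>\<nu>\<close> into \<open>\<mu>\<close>, as is seen from the Laplace functional and an
  exponential martingale.  Pairing each configuration with its transform couples \<open>\<mu>\<close> and \<open>\<nu>\<close>, and
  Girsanov's formula evaluates the mean squared cost of that coupling.

  The inverse of \<open>v\<close> only makes sense for \<open>\<sigma>\<close>-almost every \<open>z\<close>, and the locations of the points of \<open>\<omega>\<close>
  form a \<open>\<sigma>\<close>-null set.  The transform therefore only uses the values \<open>v(t, z)\<close> at the points
  themselves, which are predictable; it is injective because almost surely no two points share their
  location, \<open>\<sigma>\<close> being diffuse.\<close>

section \<open>Integration lemmas\<close>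

text \<open>Mecke's formula yields Girsanov's only for integrands that at a point \<open>x\<close>
  depend on \<open>\<omega>\<close> through \<open>before (fst x) \<omega>\<close>: inserting
  \<open>x\<close> then leaves the integrand alone, and only \<open>L\<close> feels the new point.
  Hence every process built below (\<open>V\<close>, \<open>A\<close>, \<open>n\<close>,
  \<open>H\<close>) comes with a proof of nonanticipation, and the predictability of
  \<open>u\<close> is first converted into that pathwise property. No martingale theory is invoked.
  The compensated jump equation is a finite identity on each path; its expectation takes one
  application of Girsanov's formula and the finiteness of one integral, since \<open>ennreal\<close>
  cancels finite terms only. That integral is finite, and the Laplace functional comes out right,
  because the time change turns the total compensator into a constant. The intensity usually has
  infinite mass, so finiteness and complements are handled inside bounded boxes. Measurability of
  \<open>good\<close> and of \<open>wasserstein\<close> is never established: the transform is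
  modified on a measurable null set, and for the cost a one-sided change of variables
  suffices.\<close>

lemma nn_integral_distr_le:
  fixes f :: "'b \<Rightarrow> ennreal"
  assumes T: "T \<in> measurable M N"
  shows "(\<integral>\<^sup>+x. f x \<partial>distr M N T) \<le> (\<integral>\<^sup>+x. f (T x) \<partial>M)"
  \<comment> \<open>For arbitrary \<open>f\<close> the integral is the supremum over the simple
    functions below it, and each of those can be pulled back along \<open>T\<close>. This half of
    the change of variables is what the cost \<open>wasserstein\<close> requires.\<close>
  unfolding nn_integral_def[of "distr M N T"]
proof (rule SUP_least, clarsimp)
  fix g assume g: "simple_function (distr M N T) g" "g \<le> f"
  have "integral\<^sup>S (distr M N T) g = (\<integral>\<^sup>+x. g x \<partial>distr M N T)"
    using g(1) by (rule nn_integral_eq_simple_integral[symmetric])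
  also have "\<dots> = (\<integral>\<^sup>+x. g (T x) \<partial>M)"
    using T borel_measurable_simple_function[OF g(1)] by (intro nn_integral_distr) auto
  also have "\<dots> \<le> (\<integral>\<^sup>+x. f (T x) \<partial>M)"
    using g(2) by (intro nn_integral_mono) (auto simp: le_fun_def)
  finally show "integral\<^sup>S (distr M N T) g \<le> (\<integral>\<^sup>+x. f (T x) \<partial>M)" .
qed

lemma ennreal_two_mult_le_sum_squares: "2 * a * b \<le> a\<^sup>2 + b\<^sup>2" for a b :: ennreal
proof (cases "a = \<infinity> \<or> b = \<infinity>")
  case True
  then show ?thesis by (auto simp: power2_eq_square ennreal_mult_top ennreal_top_mult)
next
  case False
  then obtain x y where xy: "a = ennreal x" "b = ennreal y" "0 \<le> x" "0 \<le> y"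
    by (metis ennreal_cases infinity_ennreal_def)
  have "2 * x * y \<le> x\<^sup>2 + y\<^sup>2" by (rule sum_squares_bound)
  then have "ennreal (2 * x * y) \<le> ennreal (x\<^sup>2 + y\<^sup>2)" by (rule ennreal_leI)
  then show ?thesis using xy by (simp add: ennreal_mult ennreal_power)
qed

text \<open>Nonnegativity of the variance, in a form that allows infinite values: integrate
  \<open>2 * a * D x \<le> a\<^sup>2 + (D x)\<^sup>2\<close> with \<open>a\<close> the mean, then
  cancel one \<open>a\<^sup>2\<close>.\<close>

lemma (in prob_space) nn_integral_power2_le:
  assumes [measurable]: "D \<in> borel_measurable M"
  shows "(\<integral>\<^sup>+x. D x \<partial>M)\<^sup>2 \<le> (\<integral>\<^sup>+x. (D x)\<^sup>2 \<partial>M)"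
proof (cases "(\<integral>\<^sup>+x. (D x)\<^sup>2 \<partial>M) = \<infinity>")
  case False
  define a where "a = (\<integral>\<^sup>+x. D x \<partial>M)"
  \<comment> \<open>Cancellation in \<open>ennreal\<close> requires \<open>a\<close> to be finite,
    which this crude bound provides.\<close>
  have "a \<le> (\<integral>\<^sup>+x. 1 + (D x)\<^sup>2 \<partial>M)"
    unfolding a_def
  proof (rule nn_integral_mono)
    fix x
    have "D x \<le> 2 * 1 * D x" by (metis mult.commute mult.right_neutral mult_2 le_iff_add)
    also have "\<dots> \<le> 1\<^sup>2 + (D x)\<^sup>2" by (rule ennreal_two_mult_le_sum_squares)
    finally show "D x \<le> 1 + (D x)\<^sup>2" by simp
  qed
  also have "\<dots> = 1 + (\<integral>\<^sup>+x. (D x)\<^sup>2 \<partial>M)"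
    by (subst nn_integral_add) (auto simp: emeasure_space_1)
  finally have "a \<le> 1 + (\<integral>\<^sup>+x. (D x)\<^sup>2 \<partial>M)" .
  moreover have "1 + (\<integral>\<^sup>+x. (D x)\<^sup>2 \<partial>M) < \<infinity>" using False by (simp add: less_top[symmetric])
  ultimately have fin: "a < \<infinity>" by (rule le_less_trans)
  have "2 * a\<^sup>2 = (\<integral>\<^sup>+x. 2 * a * D x \<partial>M)"
    by (subst nn_integral_cmult) (auto simp: a_def power2_eq_square mult.assoc)
  also have "\<dots> \<le> (\<integral>\<^sup>+x. a\<^sup>2 + (D x)\<^sup>2 \<partial>M)"
    by (intro nn_integral_mono ennreal_two_mult_le_sum_squares)
  also have "\<dots> = a\<^sup>2 + (\<integral>\<^sup>+x. (D x)\<^sup>2 \<partial>M)"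
    by (subst nn_integral_add) (auto simp: emeasure_space_1)
  finally have *: "a\<^sup>2 + a\<^sup>2 \<le> a\<^sup>2 + (\<integral>\<^sup>+x. (D x)\<^sup>2 \<partial>M)" by (simp add: mult_2)
  have "a\<^sup>2 \<noteq> top" using fin by (cases a) (auto simp: ennreal_power)
  with * have "a\<^sup>2 \<le> (\<integral>\<^sup>+x. (D x)\<^sup>2 \<partial>M)" by (auto simp: ennreal_add_left_cancel_le)
  then show ?thesis by (simp add: a_def)
qed simp

text \<open>Continuity comes from the gauge integral \<open>integral {0..t} g\<close> over the
  window \<open>{0..x+1}\<close>, which agrees with \<open>{0..}\<close> near
  \<open>x\<close>.\<close>

lemma continuous_on_set_lebesgue_integral:
  fixes g :: "real \<Rightarrow> real"
  assumes int: "\<And>t. 0 \<le> t \<Longrightarrow> set_integrable lborel {0..t} g"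
  shows "continuous_on {0..} (\<lambda>t. LINT s:{0..t}|lborel. g s)"
proof (clarsimp simp: continuous_on_eq_continuous_within)
  fix x :: real assume x: "0 \<le> x"
  have "continuous_on {0..x+1} (\<lambda>t. integral {0..t} g)"
    using set_borel_integral_eq_integral(1)[OF int[of "x+1"]] x
    by (intro indefinite_integral_continuous_1) auto
  then have "continuous_on {0..x+1} (\<lambda>t. LINT s:{0..t}|lborel. g s)"
    by (rule continuous_on_eq) (use set_borel_integral_eq_integral(2)[OF int] in auto)
  then have "continuous (at x within {0..x+1}) (\<lambda>t. LINT s:{0..t}|lborel. g s)"
    using x by (auto simp: continuous_on_eq_continuous_within)
  moreover have "at x within {0..} = at x within {0..x+1}"
    by (rule at_within_nhd[of _ "{..<x+1}"]) auto
  ultimately show "continuous (at x within {0..}) (\<lambda>t. LINT s:{0..t}|lborel. g s)"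
    by simp
qed

text \<open>Change of variables for a merely integrable derivative: the image under \<open>F\<close> of the measure
  with density \<open>F' = g\<close> is Lebesgue measure on the range of \<open>F\<close>, since both give mass \<open>y\<close> to
  \<open>F \<le> y\<close>.\<close>

lemma nn_integral_indefinite_integral_substitution:
  fixes g F :: "real \<Rightarrow> real" and h :: "real \<Rightarrow> ennreal"
  assumes int: "\<And>t. 0 \<le> t \<Longrightarrow> set_integrable lborel {0..t} g"
    and [measurable]: "g \<in> borel_measurable borel"
    and nonneg: "AE s in lborel. 0 \<le> s \<longrightarrow> 0 \<le> g s"
    and F: "\<And>t. 0 \<le> t \<Longrightarrow> F t = (LINT s:{0..t}|lborel. g s)"
    and [measurable]: "h \<in> borel_measurable borel"
    and C: "C = (\<integral>\<^sup>+s. ennreal (g s) * indicator {0..} s \<partial>lborel)"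
  shows "(\<integral>\<^sup>+t. h (F t) * ennreal (g t) * indicator {0..} t \<partial>lborel) =
         (\<integral>\<^sup>+r. h r * indicator {r. 0 \<le> r \<and> ennreal r < C} r \<partial>lborel)"
proof -
  \<comment> \<open>\<open>F\<close> is specified only on the half-line; \<open>G\<close> freezes it
    at \<open>F 0\<close> for negative times and so is continuous, hence Borel, on the whole
    line.\<close>
  define G where "G t = F (max 0 t)" for t
  have contF: "continuous_on {0..} F"
    by (rule continuous_on_eq[OF continuous_on_set_lebesgue_integral[OF int]]) (auto simp: F)
  have contG: "continuous_on UNIV G"
    unfolding G_def by (rule continuous_on_compose2[OF contF]) (auto intro: continuous_intros)
  then have [measurable]: "G \<in> borel_measurable borel" by (rule borel_measurable_continuous_onI)
  have eF: "ennreal (F t) = (\<integral>\<^sup>+s. ennreal (g s) * indicator {0..t} s \<partial>lborel)" if t: "0 \<le> t" for t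
  proof -
    have "(\<integral>\<^sup>+s. ennreal (g s) * indicator {0..t} s \<partial>lborel) = (\<integral>\<^sup>+s. ennreal (indicator {0..t} s *\<^sub>R g s) \<partial>lborel)"
      by (intro nn_integral_cong) (auto split: split_indicator)
    also have "\<dots> = ennreal (F t)"
      unfolding F[OF t] set_lebesgue_integral_def
      using int[OF t] nonneg
      by (intro nn_integral_eq_integral) (auto simp: set_integrable_def split: split_indicator elim: AE_mp)
    finally show ?thesis by simp
  qed
  have F0: "F t \<ge> 0" if t: "0 \<le> t" for t
    unfolding F[OF t] set_lebesgue_integral_def
    using nonneg by (intro integral_nonneg_AE) (auto split: split_indicator elim: AE_mp)
  have monoF: "F s \<le> F t" if "0 \<le> s" "s \<le> t" for s t
  proof -
    have "ennreal (F s) \<le> ennreal (F t)"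
      using that by (simp add: eF) (intro nn_integral_mono, auto split: split_indicator)
    then show ?thesis using F0[of t] that by (simp add: ennreal_le_iff)
  qed
  have CF: "C = (SUP n. ennreal (F (real n)))"
  proof -
    have "C = (\<integral>\<^sup>+s. (SUP n. ennreal (g s) * indicator {0..real n} s) \<partial>lborel)"
      unfolding C
    proof (intro nn_integral_cong)
      fix s :: real
      show "ennreal (g s) * indicator {0..} s = (SUP n. ennreal (g s) * indicator {0..real n} s)"
      proof (rule antisym)
        obtain n where "s \<le> real n" using real_arch_simple by blast
        then have "ennreal (g s) * indicator {0..} s \<le> ennreal (g s) * indicator {0..real n} s"
          by (auto split: split_indicator)
        then show "ennreal (g s) * indicator {0..} s \<le> (SUP n. ennreal (g s) * indicator {0..real n} s)"
          by (rule order_trans) (rule SUP_upper, simp)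
        show "(SUP n. ennreal (g s) * indicator {0..real n} s) \<le> ennreal (g s) * indicator {0..} s"
          by (rule SUP_least) (auto split: split_indicator)
      qed
    qed
    also have "\<dots> = (SUP n. \<integral>\<^sup>+s. ennreal (g s) * indicator {0..real n} s \<partial>lborel)"
      by (rule nn_integral_monotone_convergence_SUP) (auto simp: incseq_def le_fun_def split: split_indicator)
    also have "\<dots> = (SUP n. ennreal (F (real n)))" by (simp add: eF)
    finally show ?thesis .
  qed
  have FC: "ennreal (F t) \<le> C" if "0 \<le> t" for t
    unfolding C eF[OF that] by (intro nn_integral_mono) (auto split: split_indicator)
  define M1 where "M1 = distr (density lborel (\<lambda>s. ennreal (g s) * indicator {0..} s)) borel G"
  \<comment> \<open>The range of \<open>F\<close> up to a null set, \<open>C\<close> being the limit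
    of \<open>F\<close> at infinity: an interval ending at \<open>C\<close>, or the half-line if
    \<open>C\<close> is infinite.\<close>
  define R where "R = {r. 0 \<le> r \<and> ennreal r < C}"
  have [measurable]: "R \<in> sets borel" unfolding R_def by measurable
  define M2 where "M2 = density lborel (indicator R :: real \<Rightarrow> ennreal)"
  have [measurable]: "G -` {..y} \<in> sets borel" for y
    using measurable_sets_borel[of G borel "{..y}"] by simp
  have m1: "emeasure M1 {..y} = (\<integral>\<^sup>+s. ennreal (g s) * indicator ({0..} \<inter> {s. F s \<le> y}) s \<partial>lborel)" for y
  proof -
    have "emeasure M1 {..y} = emeasure (density lborel (\<lambda>s. ennreal (g s) * indicator {0..} s)) (G -` {..y} \<inter> UNIV)"
      unfolding M1_def by (subst emeasure_distr) auto
    also have "\<dots> = (\<integral>\<^sup>+s. ennreal (g s) * indicator {0..} s * indicator (G -` {..y} \<inter> UNIV) s \<partial>lborel)"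
      by (rule emeasure_density) auto
    also have "\<dots> = (\<integral>\<^sup>+s. ennreal (g s) * indicator ({0..} \<inter> {s. F s \<le> y}) s \<partial>lborel)"
      by (intro nn_integral_cong) (auto simp: G_def max_def split: split_indicator)
    finally show ?thesis .
  qed
  have m2: "emeasure M2 {..y} = emeasure lborel (R \<inter> {..y})" for y
    unfolding M2_def by (subst emeasure_density) (auto simp: indicator_inter_arith[symmetric])
  \<comment> \<open>The second conjunct makes the half-lines \<open>{..real i}\<close> have finite
    mass, as uniqueness of measures on a generator requires.\<close>
  have main: "emeasure M1 {..y} = emeasure M2 {..y} \<and> emeasure M1 {..y} \<le> ennreal y" for y
  proof -
    consider "y < 0" | "0 \<le> y" "ennreal y < C" | "0 \<le> y" "C \<le> ennreal y" by fastforce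
    then show ?thesis
    proof cases
      case 1
      then have "{0..} \<inter> {s. F s \<le> y} = {}" using F0 by force
      moreover have "R \<inter> {..y} = {}" using 1 by (auto simp: R_def)
      ultimately show ?thesis unfolding m1 m2 by simp
    next
      case 2
      then obtain n where n: "ennreal y < ennreal (F (real n))" unfolding CF less_SUP_iff by auto
      then have n': "y < F (real n)" using 2 by (simp add: ennreal_less_iff)
      have "F 0 = 0" by (subst F) (auto simp: set_lebesgue_integral_def intro!: integral_eq_zero_AE AE_I[of _ _ "{0}"] split: split_indicator_asm)
      \<comment> \<open>The last time \<open>s\<close> with \<open>F s \<le> y\<close> satisfies
        \<open>F s = y\<close>, since otherwise the intermediate value theorem would give a later
        one. So the sublevel set is \<open>{0..s}\<close> and carries mass \<open>F s = y\<close>,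
        even where \<open>F\<close> has flat pieces.\<close>
      define S where "S = {0..real n} \<inter> {s. F s \<le> y}"
      have S: "S = {0..} \<inter> {s. F s \<le> y}" unfolding S_def using n' monoF[of "real n"]
        by (auto simp: not_le[symmetric]) (meson le_less_trans linear not_le of_nat_0_le_iff)
      have "S = {0..real n} \<inter> F -` {..y}" by (auto simp: S_def)
      then have "compact S"
        using continuous_closed_preimage[OF continuous_on_subset[OF contF, of "{0..real n}"], of "{..y}"]
        by (auto simp: compact_eq_bounded_closed intro: bounded_subset[of "{0..real n}"])
      moreover have "0 \<in> S" using \<open>F 0 = 0\<close> 2 by (auto simp: S_def)
      ultimately obtain s where s: "s \<in> S" "\<And>x. x \<in> S \<Longrightarrow> x \<le> s"
        using compact_attains_sup[of S] by auto
      have s0: "0 \<le> s" "s \<le> real n" using s by (auto simp: S_def)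
      obtain x where x: "s \<le> x" "x \<le> real n" "F x = y"
        using IVT'[of F s y "real n"] s n' s0 continuous_on_subset[OF contF, of "{s..real n}"]
        by (auto simp: S_def)
      then have "x \<in> S" using s0 by (auto simp: S_def)
      then have Fs: "F s = y" using s(2)[of x] x by auto
      have "{0..} \<inter> {s. F s \<le> y} = {0..s}"
        unfolding S[symmetric]
      proof (intro set_eqI iffI)
        fix x assume "x \<in> {0..s}"
        then show "x \<in> S" using monoF[of x s] Fs s0 by (auto simp: S_def)
      qed (use s(2) in \<open>auto simp: S_def\<close>)
      then have "emeasure M1 {..y} = ennreal y" unfolding m1 using eF[OF s0(1)] Fs by simp
      moreover have "R \<inter> {..y} = {0..y}" using 2 by (auto simp: R_def intro: le_less_trans[OF ennreal_leI])
      ultimately show ?thesis unfolding m2 using 2 by simp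
    next
      case 3
      then obtain c where c: "C = ennreal c" "0 \<le> c" "c \<le> y"
        by (cases C) (auto simp: top_unique)
      have "{0..} \<inter> {s. F s \<le> y} = {0..}" using FC c by (fastforce simp: ennreal_le_iff)
      then have "emeasure M1 {..y} = C" unfolding m1 C by simp
      moreover have "R \<inter> {..y} = {0..<c}" using c by (auto simp: R_def ennreal_less_iff)
      ultimately show ?thesis unfolding m2 using c by (simp add: ennreal_leI)
    qed
  qed
  have borel_atMost: "sets (borel :: real measure) = sigma_sets UNIV (range atMost)"
    by (subst borel_eq_atMost) (simp add: sets_measure_of)
  have "M1 = M2"
  proof (rule measure_eqI_generator_eq[where E="range atMost" and \<Omega>=UNIV and A="\<lambda>i. {..real i}"])
    show "Int_stable (range atMost :: real set set)" by (auto simp: Int_stable_def)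
    show "sets M1 = sigma_sets UNIV (range atMost)" "sets M2 = sigma_sets UNIV (range atMost)"
      unfolding M1_def M2_def by (simp_all add: borel_atMost)
    show "(\<Union>i. {..real i}) = UNIV" using real_arch_simple by auto
    show "emeasure M1 {..real i} \<noteq> \<infinity>" for i
      using main[of "real i"] by (auto simp: top_unique)
  qed (use main in auto)
  then have "(\<integral>\<^sup>+x. h x \<partial>M1) = (\<integral>\<^sup>+x. h x \<partial>M2)" by simp
  moreover have "(\<integral>\<^sup>+x. h x \<partial>M1) = (\<integral>\<^sup>+t. h (F t) * ennreal (g t) * indicator {0..} t \<partial>lborel)"
    unfolding M1_def
    apply (subst nn_integral_distr, simp, simp)
    apply (subst nn_integral_density, simp, simp)
    by (intro nn_integral_cong) (auto simp: G_def max_def ac_simps split: split_indicator)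
  moreover have "(\<integral>\<^sup>+x. h x \<partial>M2) = (\<integral>\<^sup>+r. h r * indicator R r \<partial>lborel)"
    unfolding M2_def by (subst nn_integral_density) (auto simp: ac_simps)
  ultimately show ?thesis by (simp add: R_def)
qed

text \<open>The substitution \<open>r = F t\<close> turns the integral into that of
  \<open>exp\<close> over \<open>{0..c}\<close>. It is the substitution for integrable derivatives,
  because \<open>F\<close> is in general differentiable only almost everywhere.\<close>

lemma exp_indefinite_integral:
  fixes g F :: "real \<Rightarrow> real"
  assumes int: "set_integrable lborel {0..} g"
    and [measurable]: "g \<in> borel_measurable borel"
    and nonneg: "AE s in lborel. 0 \<le> s \<longrightarrow> 0 \<le> g s"
    and F: "\<And>t. 0 \<le> t \<Longrightarrow> F t = (LINT s:{0..t}|lborel. g s)"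
    and c: "c = (LINT s:{0..}|lborel. g s)"
  shows "set_integrable lborel {0..} (\<lambda>t. exp (F t) * g t)"
    and "(LINT t:{0..}|lborel. exp (F t) * g t) = exp c - 1"
proof -
  have int': "set_integrable lborel {0..t} g" for t
    by (rule set_integrable_subset[OF int]) auto
  have contF: "continuous_on {0..} F"
    by (rule continuous_on_eq[OF continuous_on_set_lebesgue_integral[OF int']]) (auto simp: F)
  define G where "G t = F (max 0 t)" for t
  have "continuous_on UNIV G"
    unfolding G_def by (rule continuous_on_compose2[OF contF]) (auto intro: continuous_intros)
  then have [measurable]: "G \<in> borel_measurable borel" by (rule borel_measurable_continuous_onI)
  have C: "ennreal c = (\<integral>\<^sup>+s. ennreal (g s) * indicator {0..} s \<partial>lborel)"
  proof -
    have "(\<integral>\<^sup>+s. ennreal (g s) * indicator {0..} s \<partial>lborel) = (\<integral>\<^sup>+s. ennreal (indicator {0..} s *\<^sub>R g s) \<partial>lborel)"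
      by (intro nn_integral_cong) (auto split: split_indicator)
    also have "\<dots> = ennreal c"
      unfolding c set_lebesgue_integral_def
      using int nonneg
      by (intro nn_integral_eq_integral) (auto simp: set_integrable_def split: split_indicator elim: AE_mp)
    finally show ?thesis by simp
  qed
  have c0: "0 \<le> c" unfolding c set_lebesgue_integral_def
    using nonneg by (intro integral_nonneg_AE) (auto split: split_indicator elim: AE_mp)
  have "(\<integral>\<^sup>+t. ennreal (indicator {0..} t *\<^sub>R (exp (F t) * g t)) \<partial>lborel) =
        (\<integral>\<^sup>+t. ennreal (exp (F t)) * ennreal (g t) * indicator {0..} t \<partial>lborel)"
    by (intro nn_integral_cong) (auto simp: ennreal_mult' split: split_indicator)
  also have "\<dots> = (\<integral>\<^sup>+r. ennreal (exp r) * indicator {r. 0 \<le> r \<and> ennreal r < ennreal c} r \<partial>lborel)"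
    by (rule nn_integral_indefinite_integral_substitution[OF int' _ nonneg F _ C]) auto
  \<comment> \<open>The two domains differ by the single point \<open>c\<close>.\<close>
  also have "\<dots> = (\<integral>\<^sup>+r. ennreal (exp r) * indicator {0..c} r \<partial>lborel)"
    using c0 AE_lborel_singleton[of c]
    by (intro nn_integral_cong_AE) (auto simp: ennreal_less_iff split: split_indicator)
  also have "\<dots> = ennreal (exp c - exp 0)"
    by (rule nn_integral_FTC_Icc) (auto intro!: derivative_eq_intros c0)
  finally have nn: "(\<integral>\<^sup>+t. ennreal (indicator {0..} t *\<^sub>R (exp (F t) * g t)) \<partial>lborel) = ennreal (exp c - 1)"
    by simp
  have eqG: "(\<lambda>t. indicator {0..} t *\<^sub>R (exp (F t) * g t)) = (\<lambda>t. indicator {0..} t *\<^sub>R (exp (G t) * g t))"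
    by (auto simp: G_def split: split_indicator)
  have meas: "(\<lambda>t. indicator {0..} t *\<^sub>R (exp (F t) * g t)) \<in> borel_measurable lborel"
    unfolding eqG by measurable
  have nn0: "AE t in lborel. 0 \<le> indicator {0..} t *\<^sub>R (exp (F t) * g t)"
    using nonneg by (auto split: split_indicator elim: AE_mp)
  show "set_integrable lborel {0..} (\<lambda>t. exp (F t) * g t)"
    unfolding set_integrable_def by (rule integrableI_nn_integral_finite[OF meas nn0 nn])
  show "(LINT t:{0..}|lborel. exp (F t) * g t) = exp c - 1"
    unfolding set_lebesgue_integral_def using nn c0
    by (subst integral_eq_nn_integral[OF meas nn0]) auto
qed

text \<open>Integration by parts for the product of \<open>1 + K\<close>, where \<open>K s\<close>
  is the integral of \<open>k\<close> up to \<open>s\<close>, with the step function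
  \<open>Y\<close> that is multiplied by \<open>w i\<close> just after time \<open>T i\<close>. Each
  summand on the left is the drop of the product at a jump, and \<open>Y * k\<close> is its growth
  between jumps. The induction adds the jumps in chronological order.\<close>

lemma jump_identity:
  fixes k :: "real \<Rightarrow> real" and T w :: "'i \<Rightarrow> real"
  assumes k: "integrable lborel k" and S: "finite S" "inj_on T S"
  shows "(1 + (\<integral>t. k t \<partial>lborel)) * (\<Prod>i\<in>S. w i) +
      (\<Sum>i\<in>S. (1 + (\<integral>t. indicator {..T i} t * k t \<partial>lborel)) * (\<Prod>j\<in>S. if T j < T i then w j else 1) * (1 - w i)) =
      1 + (\<integral>t. (\<Prod>j\<in>S. if T j < t then w j else 1) * k t \<partial>lborel)"
  using S
proof (induction S rule: finite_ranking_induct[where f=T])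
  case empty
  then show ?case by simp
next
  case (insert i S)
  show ?case
  proof (cases "i \<in> S")
    case True
    then show ?thesis using insert by (simp add: insert_absorb)
  next
    case False
    define K where "K s = (\<integral>t. indicator {..s} t * k t \<partial>lborel)" for s
    define Y where "Y t = (\<Prod>j\<in>S. if T j < t then w j else 1)" for t
    define P where "P = (\<Prod>i\<in>S. w i)"
    have lt: "T j < T i" if "j \<in> S" for j
      using insert(2)[OF that] inj_onD[OF insert.prems, of j i] False that by force
    \<comment> \<open>From the last jump time \<open>T i\<close> on, all factors of \<open>S\<close>
      are present, so the new jump only subtracts the constant multiple \<open>(1 - w i) * P\<close>
      of \<open>k\<close> after \<open>T i\<close>.\<close>
    have YP: "Y t = P" if "T i \<le> t" for t
      unfolding Y_def P_def using lt that by (intro prod.cong) force+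
    have [measurable]: "Y \<in> borel_measurable lborel" "k \<in> borel_measurable lborel" "k \<in> borel_measurable borel"
      using k unfolding Y_def by (auto intro!: borel_measurable_prod measurable_If)
    have bdd: "\<bar>Y t\<bar> \<le> (\<Prod>j\<in>S. max 1 \<bar>w j\<bar>)" for t
      unfolding Y_def abs_prod by (rule prod_mono) auto
    have intY: "integrable lborel (\<lambda>t. Y t * k t)"
    proof (rule Bochner_Integration.integrable_bound)
      show "integrable lborel (\<lambda>t. (\<Prod>j\<in>S. max 1 \<bar>w j\<bar>) * k t)" using k by simp
      show "AE t in lborel. norm (Y t * k t) \<le> norm ((\<Prod>j\<in>S. max 1 \<bar>w j\<bar>) * k t)"
        by (auto simp: abs_mult intro!: mult_right_mono order_trans[OF bdd abs_ge_self])
    qed simp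
    have intk: "integrable lborel (\<lambda>t. indicator {..s} t * k t)" for s
      using integrable_mult_indicator[OF _ k, of "{..s}"] by simp
    have "(\<integral>t. (\<Prod>j\<in>insert i S. if T j < t then w j else 1) * k t \<partial>lborel) =
      (\<integral>t. Y t * k t - (1 - w i) * P * (k t - indicator {..T i} t * k t) \<partial>lborel)"
    proof (intro Bochner_Integration.integral_cong refl)
      fix t
      show "(\<Prod>j\<in>insert i S. if T j < t then w j else 1) * k t =
        Y t * k t - (1 - w i) * P * (k t - indicator {..T i} t * k t)"
        using insert(1) False YP[of t] by (simp add: Y_def[symmetric] algebra_simps split: split_indicator)
    qed
    also have "\<dots> = (\<integral>t. Y t * k t \<partial>lborel) - (1 - w i) * P * ((\<integral>t. k t \<partial>lborel) - K (T i))"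
      using intY intk k by (simp add: K_def)
    finally have R: "(\<integral>t. (\<Prod>j\<in>insert i S. if T j < t then w j else 1) * k t \<partial>lborel) =
      (\<integral>t. Y t * k t \<partial>lborel) - (1 - w i) * P * ((\<integral>t. k t \<partial>lborel) - K (T i))" .
    have IH: "(1 + (\<integral>t. k t \<partial>lborel)) * P + (\<Sum>i\<in>S. (1 + K (T i)) * Y (T i) * (1 - w i)) =
        1 + (\<integral>t. Y t * k t \<partial>lborel)"
      using insert.IH insert.prems by (simp add: K_def Y_def P_def)
    have L: "(\<Sum>j\<in>insert i S. (1 + K (T j)) * (\<Prod>l\<in>insert i S. if T l < T j then w l else 1) * (1 - w j)) =
        (1 + K (T i)) * P * (1 - w i) + (\<Sum>i\<in>S. (1 + K (T i)) * Y (T i) * (1 - w i))"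
    proof -
      have "(\<Prod>l\<in>insert i S. if T l < T i then w l else 1) = P"
        using insert(1) False YP[of "T i"] by (simp add: Y_def)
      moreover have "(\<Prod>l\<in>insert i S. if T l < T j then w l else 1) = Y (T j)" if "j \<in> S" for j
        using insert(1) False lt[OF that] by (simp add: Y_def)
      ultimately show ?thesis using insert(1) False by simp
    qed
    show ?thesis
      unfolding R K_def[symmetric] L using IH insert(1) False
      by (simp add: P_def[symmetric] algebra_simps)
  qed
qed

section \<open>Measures determined by a multiplicative class of functions\<close>

text \<open>One threshold at a time: integrals of \<open>h \<cdot> p(Z)\<close> agree for polynomials \<open>p\<close>, hence by
  Weierstrass for continuous functions of \<open>Z\<close>, hence for the indicator of \<open>Z \<le> a\<close>.\<close>

lemma multiplicative_class_measure_eq: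
  fixes M N :: "'a measure" and \<Y> :: "('a \<Rightarrow> real) set"
  assumes M: "finite_measure M" and N: "finite_measure N" and sets: "sets M = sets N"
    and meas: "\<And>Y. Y \<in> \<Y> \<Longrightarrow> Y \<in> borel_measurable M"
    and bnd: "\<And>Y x. Y \<in> \<Y> \<Longrightarrow> x \<in> space M \<Longrightarrow> 0 \<le> Y x \<and> Y x \<le> 1"
    and one: "(\<lambda>_. 1) \<in> \<Y>"
    and mult: "\<And>Y Z. Y \<in> \<Y> \<Longrightarrow> Z \<in> \<Y> \<Longrightarrow> (\<lambda>x. Y x * Z x) \<in> \<Y>"
    and eq: "\<And>Y. Y \<in> \<Y> \<Longrightarrow> integral\<^sup>L M Y = integral\<^sup>L N Y"
    and gen: "sets M = sigma_sets (space M) {{x \<in> space M. Y x \<le> a} |Y a. Y \<in> \<Y>}"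
  shows "M = N"
proof -
  interpret M: finite_measure M by fact
  interpret N: finite_measure N by fact
  have sp: "space N = space M" using sets by (metis sets_eq_imp_space_eq)
  have measN: "Y \<in> borel_measurable N" if "Y \<in> borel_measurable M" for Y :: "'a \<Rightarrow> real"
    using that sets by (simp cong: measurable_cong_sets)
  \<comment> \<open>Products of indicators of events \<open>Z x \<le> a\<close>, indexed by lists so
    that the thresholds can be introduced by induction.\<close>
  define I :: "(('a \<Rightarrow> real) \<times> real) list \<Rightarrow> 'a \<Rightarrow> real"
    where "I ps x = prod_list (map (\<lambda>(Z, a). indicator {..a} (Z x)) ps)" for ps x
  have I01: "0 \<le> I ps x \<and> I ps x \<le> 1" for ps x
    by (induction ps) (auto simp: I_def mult_le_one split: split_indicator)
  have Im: "I ps \<in> borel_measurable M" if "fst ` set ps \<subseteq> \<Y>" for ps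
    using that
  proof (induction ps)
    case (Cons p ps)
    then have [measurable]: "fst p \<in> borel_measurable M" "I ps \<in> borel_measurable M" using meas by auto
    have "I (p # ps) = (\<lambda>x. indicator {..snd p} (fst p x) * I ps x)" by (auto simp: I_def split_beta)
    then show ?case by simp
  next
    case Nil
    have "I [] = (\<lambda>_. 1)" by (auto simp: I_def)
    then show ?case by simp
  qed
  have pw: "(\<lambda>x. Y x * Z x ^ n) \<in> \<Y>" if "Y \<in> \<Y>" "Z \<in> \<Y>" for Y Z n
  proof (induction n)
    case (Suc n)
    show ?case using mult[OF Suc that(2)] by (simp add: ac_simps)
  qed (use that in simp)
  \<comment> \<open>The arbitrary factor \<open>Y\<close> makes the induction work: the hypothesis
    is applied with \<open>Y x * Z x ^ n\<close> in its place, which again belongs to the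
    class.\<close>
  have main: "(\<integral>x. Y x * I ps x \<partial>M) = (\<integral>x. Y x * I ps x \<partial>N)" if "fst ` set ps \<subseteq> \<Y>" "Y \<in> \<Y>" for ps Y
    using that
  proof (induction ps arbitrary: Y)
    case Nil
    then show ?case using eq by (simp add: I_def)
  next
    case (Cons p ps)
    obtain Z a where p: "p = (Z, a)" by force
    have Z: "Z \<in> \<Y>" using Cons.prems p by auto
    have ps: "fst ` set ps \<subseteq> \<Y>" using Cons.prems by auto
    define h where "h x = Y x * I ps x" for x
    have hm[measurable]: "h \<in> borel_measurable M" "Z \<in> borel_measurable M"
      using meas Z Cons.prems Im[OF ps] unfolding h_def by auto
    have hmN[measurable]: "h \<in> borel_measurable N" "Z \<in> borel_measurable N"
      using measN[OF hm(1)] measN[OF hm(2)] by blast+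
    have h1: "\<bar>h x\<bar> \<le> 1" if "x \<in> space M" for x
      using bnd[OF Cons.prems(2) that] I01[of ps x] by (auto simp: h_def abs_mult intro!: mult_le_one)
    have Z1: "0 \<le> Z x \<and> Z x \<le> 1" if "x \<in> space M" for x using bnd[OF Z that] .
    have bint: "integrable M (\<lambda>x. h x * f x)" "integrable N (\<lambda>x. h x * f x)"
      if f: "f \<in> borel_measurable M" "\<And>x. x \<in> space M \<Longrightarrow> \<bar>f x\<bar> \<le> B" for f B
    proof -
      have *: "\<bar>h x * f x\<bar> \<le> B" if "x \<in> space M" for x
      proof -
        have "\<bar>h x\<bar> * \<bar>f x\<bar> \<le> 1 * B" using h1[OF that] f(2)[OF that] by (intro mult_mono) auto
        then show ?thesis by (simp add: abs_mult)
      qed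
      show "integrable M (\<lambda>x. h x * f x)"
        using * f(1) by (intro M.integrable_const_bound[where B=B]) auto
      show "integrable N (\<lambda>x. h x * f x)"
        using * measN[OF f(1)] sp by (intro N.integrable_const_bound[where B=B]) auto
    qed
    have pow: "(\<integral>x. h x * Z x ^ n \<partial>M) = (\<integral>x. h x * Z x ^ n \<partial>N)" for n
      using Cons.IH[OF ps pw[OF Cons.prems(2) Z, of n]] by (simp add: h_def ac_simps)
    have poly: "(\<integral>x. h x * q (Z x) \<partial>M) = (\<integral>x. h x * q (Z x) \<partial>N)" if q: "real_polynomial_function q" for q
    proof -
      obtain b n where q: "q = (\<lambda>x. \<Sum>i\<le>n. b i * x ^ i)" using q real_polynomial_function_iff_sum by blast
      have zb: "\<bar>Z x ^ i\<bar> \<le> 1" if "x \<in> space M" for x i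
        using Z1[OF that] by (simp add: power_le_one)
      have "integrable M (\<lambda>x. h x * Z x ^ i)" "integrable N (\<lambda>x. h x * Z x ^ i)" for i
        using bint[of "\<lambda>x. Z x ^ i" 1] zb by auto
      then show ?thesis unfolding q using pow by (simp add: sum_distrib_left mult.left_commute[of "h _" "b _"])
    qed
    have cont: "(\<integral>x. h x * f (Z x) \<partial>M) = (\<integral>x. h x * f (Z x) \<partial>N)"
      if f: "continuous_on UNIV f" for f :: "real \<Rightarrow> real"
    proof (rule ccontr)
      define D where "D = \<bar>(\<integral>x. h x * f (Z x) \<partial>M) - (\<integral>x. h x * f (Z x) \<partial>N)\<bar>"
      \<comment> \<open>\<open>m\<close> exceeds the two total masses together by one: an
        approximation within \<open>D / m\<close> changes the difference of the integrals by at most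
        \<open>D * ((m - 1) / m) < D\<close>, although that difference was \<open>D\<close>.\<close>
      define m where "m = 1 + measure M (space M) + measure N (space N)"
      assume "\<not> ?thesis"
      then have D: "D > 0" unfolding D_def by simp
      have m: "m > 0" by (simp add: m_def add_pos_nonneg)
      obtain q where q: "real_polynomial_function q" "\<And>x. x \<in> {0..1} \<Longrightarrow> \<bar>f x - q x\<bar> < D / m"
        using Stone_Weierstrass_real_polynomial_function[of "{0..1}" f "D / m"] f D m
        by (auto intro: continuous_on_subset)
      have [measurable]: "f \<in> borel_measurable borel" using f by (rule borel_measurable_continuous_onI)
      have [measurable]: "q \<in> borel_measurable borel"
        using q(1) by (intro borel_measurable_continuous_onI continuous_on_polymonial_function)
          (auto simp: real_polynomial_function_eq)
      have "compact (f ` {0..1})" "compact (q ` {0..1})"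
        by (intro compact_continuous_image continuous_on_subset[OF f] continuous_on_polymonial_function,
            use q(1) in \<open>auto simp: real_polynomial_function_eq\<close>)+
      then obtain Bf Bq where B: "\<And>y. y \<in> f ` {0..1} \<Longrightarrow> norm y \<le> Bf" "\<And>y. y \<in> q ` {0..1} \<Longrightarrow> norm y \<le> Bq"
        by (meson compact_imp_bounded bounded_iff)
      have i1: "integrable M (\<lambda>x. h x * f (Z x))" "integrable N (\<lambda>x. h x * f (Z x))"
        using bint[of "\<lambda>x. f (Z x)" Bf] Z1 B(1) by auto
      have i2: "integrable M (\<lambda>x. h x * q (Z x))" "integrable N (\<lambda>x. h x * q (Z x))"
        using bint[of "\<lambda>x. q (Z x)" Bq] Z1 B(2) by auto
      have dl: "norm (h x * f (Z x) - h x * q (Z x)) \<le> D / m" if "x \<in> space M" for x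
      proof -
        have "\<bar>h x\<bar> * \<bar>f (Z x) - q (Z x)\<bar> \<le> 1 * (D / m)"
          using h1[OF that] q(2)[of "Z x"] Z1[OF that] by (intro mult_mono) auto
        then show ?thesis by (simp add: abs_mult[symmetric] right_diff_distrib)
      qed
      have "norm (\<integral>x. h x * f (Z x) - h x * q (Z x) \<partial>M) \<le> (\<integral>x. D / m \<partial>M)"
        using i1 i2 dl by (intro order_trans[OF integral_norm_bound integral_mono]) auto
      then have a1: "\<bar>(\<integral>x. h x * f (Z x) \<partial>M) - (\<integral>x. h x * q (Z x) \<partial>M)\<bar> \<le> D / m * measure M (space M)"
        using i1 i2 by (simp add: mult.commute)
      have "norm (\<integral>x. h x * f (Z x) - h x * q (Z x) \<partial>N) \<le> (\<integral>x. D / m \<partial>N)"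
        using i1 i2 dl sp by (intro order_trans[OF integral_norm_bound integral_mono]) auto
      then have a2: "\<bar>(\<integral>x. h x * f (Z x) \<partial>N) - (\<integral>x. h x * q (Z x) \<partial>N)\<bar> \<le> D / m * measure N (space N)"
        using i1 i2 by (simp add: mult.commute)
      have "D \<le> D / m * (measure M (space M) + measure N (space N))"
        using a1 a2 poly[OF q(1)] D_def unfolding distrib_left by linarith
      also have "\<dots> = D * ((m - 1) / m)" by (simp add: m_def)
      also have "\<dots> < D * 1" using m D by (intro mult_strict_left_mono) auto
      finally show False by simp
    qed
    \<comment> \<open>Continuous, equal to 1 up to \<open>a\<close> and then falling to 0 with slope
      \<open>j\<close>, so that the limit is the indicator of the closed half-line.\<close>
    define f where "f j x = max 0 (1 - real j * max 0 (x - a))" for j x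
    have fc: "continuous_on UNIV (f j)" for j unfolding f_def by (intro continuous_intros)
    have [measurable]: "f j \<in> borel_measurable borel" for j using fc by (rule borel_measurable_continuous_onI)
    have f01: "0 \<le> f j x \<and> f j x \<le> 1" for j x by (auto simp: f_def)
    have lim: "(\<lambda>j. f j x) \<longlonglongrightarrow> indicator {..a} x" for x
    proof (cases "x \<le> a")
      case True
      then show ?thesis by (simp add: f_def max_def)
    next
      case False
      then obtain n where n: "1 / (x - a) < real n" using reals_Archimedean2 by blast
      have "f j x = 0" if "n \<le> j" for j
      proof -
        have "1 / (x - a) < real j" using n that by simp
        then have "1 < real j * (x - a)" using False by (simp add: field_simps)
        then show ?thesis using False by (simp add: f_def max_def)
      qed
      then show ?thesis using False by (intro tendsto_eventually) (auto simp: eventually_sequentially)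
    qed
    have fb: "norm (h x * f j (Z x)) \<le> 1" if "x \<in> space M" for x j
      using h1[OF that] f01[of j "Z x"] by (auto simp: abs_mult intro!: mult_le_one)
    have "(\<lambda>j. \<integral>x. h x * f j (Z x) \<partial>M) \<longlonglongrightarrow> (\<integral>x. h x * indicator {..a} (Z x) \<partial>M)"
      using lim fb by (intro integral_dominated_convergence[where w="\<lambda>_. 1"]) (auto intro!: tendsto_intros)
    moreover have "(\<lambda>j. \<integral>x. h x * f j (Z x) \<partial>N) \<longlonglongrightarrow> (\<integral>x. h x * indicator {..a} (Z x) \<partial>N)"
      using lim fb sp by (intro integral_dominated_convergence[where w="\<lambda>_. 1"]) (auto intro!: tendsto_intros)
    ultimately have "(\<integral>x. h x * indicator {..a} (Z x) \<partial>M) = (\<integral>x. h x * indicator {..a} (Z x) \<partial>N)"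
      using cont[OF fc] by (simp add: LIMSEQ_unique)
    then show ?case by (simp add: h_def I_def p ac_simps)
  qed
  \<comment> \<open>Finite intersections of the generating events: an intersection-stable generator,
    on which equal integrals of \<open>I ps\<close> mean equal measures.\<close>
  define E where "E = {{x \<in> space M. \<forall>p\<in>set ps. fst p x \<le> snd p} |ps. fst ` set ps \<subseteq> \<Y>}"
  have Iind: "I ps x = indicator {x \<in> space M. \<forall>p\<in>set ps. fst p x \<le> snd p} x" if "x \<in> space M" for ps x
    using that by (induction ps) (auto simp: I_def split: split_indicator)
  have Esets: "A \<in> sets M" if A: "A \<in> E" for A
  proof -
    obtain ps where "fst ` set ps \<subseteq> \<Y>" "A = {x \<in> space M. \<forall>p\<in>set ps. fst p x \<le> snd p}"
      using A unfolding E_def by blast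
    then show ?thesis using meas by (auto intro!: sets.sets_Collect_finite_All borel_measurable_le)
  qed
  have Esub: "E \<subseteq> Pow (space M)" unfolding E_def by auto
  have gen': "sets M = sigma_sets (space M) E"
  proof
    show "sigma_sets (space M) E \<subseteq> sets M"
      using Esets by (intro sets.sigma_sets_subset) auto
    show "sets M \<subseteq> sigma_sets (space M) E"
      unfolding gen
    proof (rule sigma_sets_mono', clarsimp)
      fix Y a assume "Y \<in> \<Y>"
      then show "{x \<in> space M. Y x \<le> a} \<in> E" unfolding E_def
        by (intro CollectI exI[of _ "[(Y, a)]"]) auto
    qed
  qed
  show ?thesis
  proof (rule measure_eqI_generator_eq[where E=E and \<Omega>="space M" and A="\<lambda>_. space M"])
    show "Int_stable E"
    proof (rule Int_stableI)
      fix A B assume "A \<in> E" "B \<in> E"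
      then obtain ps qs where "fst ` set ps \<subseteq> \<Y>" "A = {x \<in> space M. \<forall>p\<in>set ps. fst p x \<le> snd p}"
        "fst ` set qs \<subseteq> \<Y>" "B = {x \<in> space M. \<forall>p\<in>set qs. fst p x \<le> snd p}"
        unfolding E_def by blast
      then show "A \<inter> B \<in> E" unfolding E_def by (intro CollectI exI[of _ "ps @ qs"]) auto
    qed
    fix A assume A: "A \<in> E"
    then obtain ps where ps: "fst ` set ps \<subseteq> \<Y>" "A = {x \<in> space M. \<forall>p\<in>set ps. fst p x \<le> snd p}"
      unfolding E_def by blast
    have "measure M A = (\<integral>x. 1 * I ps x \<partial>M)"
      using Esets[OF A] Iind[of _ ps] by (simp add: ps(2)[symmetric] cong: Bochner_Integration.integral_cong)
    also have "\<dots> = (\<integral>x. 1 * I ps x \<partial>N)" by (rule main[OF ps(1) one])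
    also have "\<dots> = (\<integral>x. indicator A x \<partial>N)"
      using Iind[of _ ps] sp by (intro Bochner_Integration.integral_cong) (auto simp: ps(2)[symmetric])
    also have "\<dots> = measure N A" using Esets[OF A] sets by simp
    finally show "emeasure M A = emeasure N A" by (simp add: M.emeasure_eq_measure N.emeasure_eq_measure)
  next
    show "range (\<lambda>_. space M) \<subseteq> E" unfolding E_def by (auto intro!: exI[of _ "[]"])
  qed (use gen' sets Esub in auto)
qed

section \<open>Configurations\<close>

lemma UN_ball_real: "(\<Union>n. ball (0 :: 'a::real_normed_vector) (real n)) = UNIV"
proof (intro equalityI subsetI)
  fix x :: 'a
  obtain n where "norm x < real n" using reals_Archimedean2 by blast
  then show "x \<in> (\<Union>n. ball 0 (real n))" by auto
qed simp

lemma UN_ball_Int: "(\<Union>n. ball 0 (real n) \<inter> X) = (X :: 'a::real_normed_vector set)"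
  using UN_ball_real[where 'a='a] by blast

text \<open>Closedness of \<open>X\<close> makes the closure of a bounded set, cut down to
  \<open>X\<close>, one of the compact sets in the definition.\<close>

lemma configurations_finite_bounded:
  fixes X :: "'a::euclidean_space set"
  assumes X: "closed X" and \<omega>: "\<omega> \<in> configurations X" and B: "bounded B"
  shows "finite (\<omega> \<inter> B)"
proof -
  have "compact (closure B \<inter> X)" using B X by (simp add: compact_Int_closed compact_closure)
  then have "finite (\<omega> \<inter> (closure B \<inter> X))" using \<omega> by (simp add: configurations_def)
  moreover have "\<omega> \<inter> B \<subseteq> \<omega> \<inter> (closure B \<inter> X)"
    using \<omega> closure_subset[of B] by (auto simp: configurations_def)
  ultimately show ?thesis by (rule rev_finite_subset)
qed

lemma configurationsI:
  fixes X :: "'a::euclidean_space set"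
  assumes "\<omega> \<subseteq> X" "\<And>n. finite (\<omega> \<inter> cball 0 (real n))"
  shows "\<omega> \<in> configurations X"
  unfolding configurations_def
proof (intro CollectI conjI assms(1) allI impI)
  fix K :: "'a set" assume "compact K \<and> K \<subseteq> X"
  then obtain b where b: "\<And>x. x \<in> K \<Longrightarrow> norm x \<le> b" by (meson compact_imp_bounded bounded_iff)
  obtain n where "b \<le> real n" using real_arch_simple by blast
  then have "\<omega> \<inter> K \<subseteq> \<omega> \<inter> cball 0 (real n)" using b by force
  then show "finite (\<omega> \<inter> K)" using assms(2) by (rule finite_subset)
qed

lemma configurations_countable:
  fixes X :: "'a::euclidean_space set"
  assumes "closed X" "\<omega> \<in> configurations X"
  shows "countable \<omega>"
proof -
  have eq: "\<omega> = (\<Union>n. \<omega> \<inter> ball 0 (real n))"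
    unfolding Int_UN_distrib[symmetric] UN_ball_real by simp
  have "countable (\<omega> \<inter> ball 0 (real n))" for n
    by (rule countable_finite[OF configurations_finite_bounded[OF assms bounded_ball]])
  then have "countable (\<Union>n. \<omega> \<inter> ball 0 (real n))" by (rule countable_UN[OF countableI_type])
  then show ?thesis unfolding eq[symmetric] .
qed

lemma configurations_subset: "\<omega> \<in> configurations X \<Longrightarrow> \<eta> \<subseteq> \<omega> \<Longrightarrow> \<eta> \<in> configurations X"
  unfolding configurations_def by (auto intro: rev_finite_subset[OF _ Int_mono[OF _ order_refl]])

lemma configurations_insert: "\<omega> \<in> configurations X \<Longrightarrow> x \<in> X \<Longrightarrow> insert x \<omega> \<in> configurations X"
  unfolding configurations_def by (auto simp: Int_insert_left)

lemma nn_integral_config_measure: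
  "f \<in> borel_measurable borel \<Longrightarrow> (\<integral>\<^sup>+x. f x \<partial>config_measure \<omega>) = (\<integral>\<^sup>+x. f x \<partial>count_space \<omega>)"
  unfolding config_measure_def by (subst nn_integral_distr) auto

lemma emeasure_config_measure:
  "B \<in> sets borel \<Longrightarrow> emeasure (config_measure \<omega>) B = (\<integral>\<^sup>+x. indicator B x \<partial>count_space \<omega>)"
  by (subst nn_integral_config_measure[symmetric]) (auto simp: config_measure_def)

lemma nn_integral_indicator_count_space:
  assumes "finite (\<omega> \<inter> B)"
  shows "(\<integral>\<^sup>+x. indicator B x \<partial>count_space \<omega>) = of_nat (card (\<omega> \<inter> B))"
proof -
  have "(\<integral>\<^sup>+x. indicator B x \<partial>count_space \<omega>) = (\<Sum>x | x \<in> \<omega> \<and> (0::ennreal) < indicator B x. indicator B x)"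
    by (rule nn_integral_count_space, rule finite_subset[OF _ assms]) (auto split: split_indicator_asm)
  also have "{x \<in> \<omega>. (0::ennreal) < indicator B x} = \<omega> \<inter> B" by (auto split: split_indicator)
  also have "(\<Sum>x\<in>\<omega> \<inter> B. indicator B x :: ennreal) = (\<Sum>x\<in>\<omega> \<inter> B. 1)"
    by (intro sum.cong) auto
  finally show ?thesis by simp
qed

lemma Cc_borel_measurable:
  fixes X :: "'a::euclidean_space set"
  assumes "closed X" "f \<in> Cc X"
  shows "f \<in> borel_measurable borel"
proof -
  have "(\<lambda>x. indicator X x *\<^sub>R f x) \<in> borel_measurable borel"
    using assms by (intro borel_measurable_continuous_on_indicator) (auto simp: Cc_def)
  moreover have "(\<lambda>x. indicator X x *\<^sub>R f x) = f"
    using assms by (auto simp: Cc_def indicator_def fun_eq_iff)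
  ultimately show ?thesis by simp
qed

lemma Cc_bounded_support:
  fixes X :: "'a::euclidean_space set"
  assumes "f \<in> Cc X"
  obtains r where "0 < r" "\<And>x. x \<notin> ball 0 r \<Longrightarrow> f x = 0" "\<And>x. x \<notin> X \<Longrightarrow> f x = 0"
proof -
  obtain K where K: "compact K" "K \<subseteq> X" "\<And>p. p \<notin> K \<Longrightarrow> f p = 0" using assms by (auto simp: Cc_def)
  then obtain r where "0 < r" "K \<subseteq> ball 0 r" by (meson compact_imp_bounded bounded_subset_ballD)
  then show ?thesis using K that by blast
qed

lemma Cc_bounded:
  fixes X :: "'a::euclidean_space set"
  assumes "f \<in> Cc X"
  obtains b where "0 \<le> b" "\<And>x. \<bar>f x\<bar> \<le> b"
proof -
  obtain K where K: "compact K" "K \<subseteq> X" "\<And>p. p \<notin> K \<Longrightarrow> f p = 0" "continuous_on X f" using assms by (auto simp: Cc_def)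
  then have "compact (f ` K)" by (intro compact_continuous_image) (auto intro: continuous_on_subset)
  then obtain b where b: "\<And>y. y \<in> f ` K \<Longrightarrow> norm y \<le> b" by (meson compact_imp_bounded bounded_iff)
  then have "\<bar>f x\<bar> \<le> max b 0" for x using K(3)[of x] by (cases "x \<in> K") force+
  then show ?thesis using that[of "max b 0"] by auto
qed

lemma integral_config_measure_finite:
  fixes f :: "'a::euclidean_space \<Rightarrow> real"
  assumes "f \<in> borel_measurable borel" "finite (\<omega> \<inter> B)" "\<And>x. x \<in> \<omega> \<Longrightarrow> x \<notin> B \<Longrightarrow> f x = 0"
  shows "(\<integral>x. f x \<partial>config_measure \<omega>) = (\<Sum>x\<in>\<omega> \<inter> B. f x)"
proof -
  have fin: "finite {a \<in> \<omega>. f a \<noteq> 0}" by (rule finite_subset[OF _ assms(2)]) (use assms(3) in auto)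
  have "(\<integral>x. f x \<partial>config_measure \<omega>) = (\<integral>x. f x \<partial>count_space \<omega>)"
    unfolding config_measure_def using assms(1) by (subst integral_distr) auto
  also have "\<dots> = (\<Sum>a | a \<in> \<omega> \<and> f a \<noteq> 0. f a)"
    by (rule lebesgue_integral_count_space_finite_support[OF fin])
  also have "\<dots> = (\<Sum>x\<in>\<omega> \<inter> B. f x)"
    by (rule sum.mono_neutral_left) (use assms in auto)
  finally show ?thesis .
qed

lemma ennreal_integral_config_measure:
  fixes X :: "'a::euclidean_space set"
  assumes X: "closed X" and f: "f \<in> Cc X" and pos: "\<And>x. 0 \<le> f x" and \<omega>: "\<omega> \<in> configurations X"
  shows "ennreal (\<integral>x. f x \<partial>config_measure \<omega>) = (\<integral>\<^sup>+x. ennreal (f x) \<partial>count_space \<omega>)"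
    and "0 \<le> (\<integral>x. f x \<partial>config_measure \<omega>)"
proof -
  obtain r where r: "\<And>x. x \<notin> ball 0 r \<Longrightarrow> f x = 0" using Cc_bounded_support[OF f] by metis
  have r': "x \<in> ball 0 r" if "f x \<noteq> 0" for x using r that by blast
  have fin: "finite (\<omega> \<inter> ball 0 r)" by (rule configurations_finite_bounded[OF X \<omega>]) simp
  have fm: "f \<in> borel_measurable borel" by (rule Cc_borel_measurable[OF X f])
  have eq: "(\<integral>x. f x \<partial>config_measure \<omega>) = (\<Sum>x\<in>\<omega> \<inter> ball 0 r. f x)"
    by (rule integral_config_measure_finite[OF fm fin]) (use r in auto)
  have "(\<integral>\<^sup>+x. ennreal (f x) \<partial>count_space \<omega>) = (\<Sum>a | a \<in> \<omega> \<and> 0 < ennreal (f a). ennreal (f a))"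
    by (rule nn_integral_count_space, rule finite_subset[OF _ fin]) (use r' in auto)
  also have "\<dots> = (\<Sum>x\<in>\<omega> \<inter> ball 0 r. ennreal (f x))"
    by (rule sum.mono_neutral_left) (use fin r' pos in \<open>auto simp: less_le\<close>)
  finally show "ennreal (\<integral>x. f x \<partial>config_measure \<omega>) = (\<integral>\<^sup>+x. ennreal (f x) \<partial>count_space \<omega>)"
    unfolding eq using pos by simp
  show "0 \<le> (\<integral>x. f x \<partial>config_measure \<omega>)" unfolding eq using pos by (simp add: sum_nonneg)
qed

lemma Cc_add:
  fixes X :: "'a::euclidean_space set"
  assumes "f \<in> Cc X" "g \<in> Cc X" shows "(\<lambda>x. f x + g x) \<in> Cc X"
proof -
  obtain K K' where K: "compact K" "K \<subseteq> X" "\<And>p. p \<notin> K \<Longrightarrow> f p = 0"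
    "compact K'" "K' \<subseteq> X" "\<And>p. p \<notin> K' \<Longrightarrow> g p = 0"
    and c: "continuous_on X f" "continuous_on X g"
    using assms by (auto simp: Cc_def)
  have "compact (K \<union> K')" "K \<union> K' \<subseteq> X" "\<forall>p. p \<notin> K \<union> K' \<longrightarrow> f p + g p = 0"
    using K by auto
  then show ?thesis unfolding Cc_def using continuous_on_add[OF c] by blast
qed

lemma Cc_scale: "f \<in> Cc X \<Longrightarrow> (\<lambda>x. c * f x) \<in> Cc X"
  unfolding Cc_def by (auto intro!: continuous_intros)

lemma Cc_zero: "(\<lambda>_. 0) \<in> Cc X"
  unfolding Cc_def by (auto intro!: exI[of _ "{}"])

lemma integral_config_measure_add:
  fixes X :: "'a::euclidean_space set"
  assumes X: "closed X" and f: "f \<in> Cc X" and g: "g \<in> Cc X" and \<omega>: "\<omega> \<in> configurations X"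
  shows "(\<integral>x. f x + g x \<partial>config_measure \<omega>) = (\<integral>x. f x \<partial>config_measure \<omega>) + (\<integral>x. g x \<partial>config_measure \<omega>)"
proof -
  obtain r s where r: "\<And>x. x \<notin> ball 0 r \<Longrightarrow> f x = 0" "\<And>x. x \<notin> ball 0 s \<Longrightarrow> g x = 0"
    using Cc_bounded_support[OF f] Cc_bounded_support[OF g] by metis
  define B :: "'a set" where "B = ball 0 r \<union> ball 0 s"
  have fin: "finite (\<omega> \<inter> B)" unfolding B_def by (rule configurations_finite_bounded[OF X \<omega>]) simp
  have m: "f \<in> borel_measurable borel" "g \<in> borel_measurable borel" using f g X Cc_borel_measurable by auto
  have "(\<integral>x. f x + g x \<partial>config_measure \<omega>) = (\<Sum>x\<in>\<omega> \<inter> B. f x + g x)"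
    using m r by (intro integral_config_measure_finite[OF _ fin]) (auto simp: B_def)
  moreover have "(\<integral>x. f x \<partial>config_measure \<omega>) = (\<Sum>x\<in>\<omega> \<inter> B. f x)" "(\<integral>x. g x \<partial>config_measure \<omega>) = (\<Sum>x\<in>\<omega> \<inter> B. g x)"
    using m r by (intro integral_config_measure_finite[OF _ fin]; auto simp: B_def)+
  ultimately show ?thesis by (simp add: sum.distrib)
qed

text \<open>Multiples of the distance to the complement of \<open>U\<close>, truncated at 1,
  increase to the indicator because \<open>U\<close> is open; boundedness of \<open>U\<close> gives
  them compact support inside \<open>closure U \<inter> X\<close>.\<close>

lemma Cc_approx_open:
  fixes X U :: "'a::euclidean_space set"
  assumes X: "closed X" and U: "open U" "bounded U"
  obtains f :: "nat \<Rightarrow> 'a \<Rightarrow> real" where "\<And>j. f j \<in> Cc X" "\<And>j x. 0 \<le> f j x" "\<And>j x. f j x \<le> 1"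
    "\<And>x. incseq (\<lambda>j. f j x)" "\<And>x. x \<in> X \<Longrightarrow> (\<lambda>j. f j x) \<longlonglongrightarrow> indicator U x"
    "\<And>j x. x \<notin> U \<Longrightarrow> f j x = 0"
proof -
  define f where "f j x = (if x \<in> X then min 1 (real j * infdist x (- U)) else 0)" for j x
  \<comment> \<open>Boundedness keeps the complement nonempty; \<open>infdist\<close> to the empty
    set would be 0 everywhere.\<close>
  have ne: "- U \<noteq> {}" using U(2) not_bounded_UNIV by (metis Compl_UNIV_eq double_complement)
  have z: "infdist x (- U) = 0 \<longleftrightarrow> x \<notin> U" for x
    using U(1) ne by (subst in_closed_iff_infdist_zero[symmetric]) auto
  show ?thesis
  proof (rule that)
    fix j
    have "continuous_on X (\<lambda>x. min 1 (real j * infdist x (- U)))"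
      by (intro continuous_intros)
    then have "continuous_on X (f j)" by (rule continuous_on_eq) (auto simp: f_def)
    moreover have "compact (closure U \<inter> X)" using U X by (simp add: compact_Int_closed compact_closure)
    moreover have "f j p = 0" if "p \<notin> closure U \<inter> X" for p
      using that z[of p] closure_subset[of U] by (auto simp: f_def)
    ultimately show "f j \<in> Cc X" unfolding Cc_def by blast
  next
    fix x show "incseq (\<lambda>j. f j x)"
      unfolding incseq_def
    proof (intro allI impI)
      fix m n :: nat assume "m \<le> n"
      then have "real m * infdist x (- U) \<le> real n * infdist x (- U)"
        by (intro mult_right_mono infdist_nonneg) simp
      then show "f m x \<le> f n x" by (auto simp: f_def min_def)
    qed
  next
    fix x assume x: "x \<in> X"
    show "(\<lambda>j. f j x) \<longlonglongrightarrow> indicator U x"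
    proof (cases "x \<in> U")
      case True
      then have p: "infdist x (- U) > 0" using z[of x] infdist_nonneg[of x "- U"] by simp
      obtain n where n: "1 / infdist x (- U) < real n" using reals_Archimedean2 by blast
      have "f j x = 1" if "n \<le> j" for j
      proof -
        have "1 / infdist x (- U) < real j" using n that by simp
        then have "1 < real j * infdist x (- U)" using p by (simp add: field_simps)
        then show ?thesis using x by (simp add: f_def)
      qed
      then show ?thesis using True by (intro tendsto_eventually) (auto simp: eventually_sequentially)
    next
      case False
      then have eq: "infdist x (- U) = 0" using z by blast
      have "(\<lambda>j. f j x) = (\<lambda>_. 0)" unfolding f_def eq by (auto simp: fun_eq_iff)
      then show ?thesis using False by simp
    qed
  qed (use z in \<open>auto simp: f_def infdist_nonneg\<close>)
qed

section \<open>The Borel sigma-algebra of the vague topology\<close>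

lemma openin_vague_subset: "openin (vague_topology X) U \<Longrightarrow> U \<subseteq> configurations X"
  unfolding vague_topology_def openin_topology_generated_by_iff
  by (induction rule: generate_topology_on.induct) auto

lemma space_config_borel[simp]: "space (config_borel X) = configurations X"
  unfolding config_borel_def by (rule space_measure_of) (use openin_vague_subset in auto)

lemma sets_config_borel: "sets (config_borel X) = sigma_sets (configurations X) {U. openin (vague_topology X) U}"
  unfolding config_borel_def by (rule sets_measure_of) (use openin_vague_subset in auto)

lemma integral_config_measurable:
  assumes "f \<in> Cc X"
  shows "(\<lambda>\<omega>. \<integral>x. f x \<partial>config_measure \<omega>) \<in> borel_measurable (config_borel X)"
proof (rule borel_measurableI)
  fix S :: "real set" assume "open S"
  then have "openin (vague_topology X) {\<omega> \<in> configurations X. (\<integral>p. f p \<partial>config_measure \<omega>) \<in> S}"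
    unfolding vague_topology_def using assms by (intro topology_generated_by_Basis) auto
  then have "{\<omega> \<in> configurations X. (\<integral>p. f p \<partial>config_measure \<omega>) \<in> S} \<in> sets (config_borel X)"
    unfolding sets_config_borel by auto
  then show "(\<lambda>\<omega>. \<integral>x. f x \<partial>config_measure \<omega>) -` S \<inter> space (config_borel X) \<in> sets (config_borel X)"
    by (simp add: vimage_def Int_def conj_commute)
qed

lemma tendsto_integral_card:
  fixes X U :: "'a::euclidean_space set"
  assumes X: "closed X" and \<omega>: "\<omega> \<in> configurations X" and U: "bounded U"
    and f: "\<And>j. f j \<in> Cc X" "\<And>x. x \<in> X \<Longrightarrow> (\<lambda>j. f j x) \<longlonglongrightarrow> indicator U x" "\<And>j x. x \<notin> U \<Longrightarrow> f j x = 0"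
  shows "(\<lambda>j. \<integral>x. f j x \<partial>config_measure \<omega>) \<longlonglongrightarrow> real (card (\<omega> \<inter> U))"
proof -
  have fin: "finite (\<omega> \<inter> U)" by (rule configurations_finite_bounded[OF X \<omega> U])
  have eq: "(\<integral>x. f j x \<partial>config_measure \<omega>) = (\<Sum>x\<in>\<omega> \<inter> U. f j x)" for j
    by (rule integral_config_measure_finite[OF Cc_borel_measurable[OF X f(1)] fin]) (use f(3) in auto)
  have "(\<lambda>j. \<Sum>x\<in>\<omega> \<inter> U. f j x) \<longlonglongrightarrow> (\<Sum>x\<in>\<omega> \<inter> U. indicator U x)"
    using \<omega> by (intro tendsto_sum f(2)) (auto simp: configurations_def)
  also have "(\<Sum>x\<in>\<omega> \<inter> U. indicator U x) = real (card (\<omega> \<inter> U))"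
    by (simp add: sum.cong[of "\<omega> \<inter> U" "\<omega> \<inter> U" "indicator U" "\<lambda>_. 1::real"])
  finally show ?thesis unfolding eq .
qed

text \<open>Stated for an arbitrary sigma-algebra and nonnegative test functions, because it is
  applied both to \<open>config_borel\<close> and to the sigma-algebra generated by Laplace
  exponentials. The count is a limit of integrals of functions approximating the indicator of
  \<open>U\<close>.\<close>

lemma card_measurable_if_integrals_measurable:
  fixes X U :: "'a::euclidean_space set"
  assumes X: "closed X" and U: "open U" "bounded U" and sp: "space M = configurations X"
    and int: "\<And>f. f \<in> Cc X \<Longrightarrow> (\<And>x. 0 \<le> f x) \<Longrightarrow> (\<lambda>\<omega>. \<integral>x. f x \<partial>config_measure \<omega>) \<in> borel_measurable M"
  shows "{\<omega> \<in> configurations X. card (\<omega> \<inter> U) = n} \<in> sets M"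
proof -
  obtain f :: "nat \<Rightarrow> 'a \<Rightarrow> real" where f: "\<And>j. f j \<in> Cc X" "\<And>j x. 0 \<le> f j x" 
    "\<And>x. x \<in> X \<Longrightarrow> (\<lambda>j. f j x) \<longlonglongrightarrow> indicator U x" "\<And>j x. x \<notin> U \<Longrightarrow> f j x = 0"
    using Cc_approx_open[OF X U] by metis
  have [measurable]: "(\<lambda>\<omega>. real (card (\<omega> \<inter> U))) \<in> borel_measurable M"
  proof (rule borel_measurable_LIMSEQ_real)
    show "(\<lambda>\<omega>. \<integral>x. f j x \<partial>config_measure \<omega>) \<in> borel_measurable M" for j by (intro int f)
    show "(\<lambda>j. \<integral>x. f j x \<partial>config_measure \<omega>) \<longlonglongrightarrow> real (card (\<omega> \<inter> U))" if "\<omega> \<in> space M" for \<omega>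
      using that sp by (intro tendsto_integral_card[OF X _ U(2)] f) auto
  qed
  have "{\<omega> \<in> space M. real (card (\<omega> \<inter> U)) = real n} \<in> sets M" by measurable
  then show ?thesis by (simp add: sp)
qed

text \<open>With exact point numbers as generators, measurability of a map into the configuration
  space reduces to that of integer-valued counts.\<close>

definition count_generator :: "'a::euclidean_space set \<Rightarrow> 'a set set set" where
  "count_generator X = {{\<omega> \<in> configurations X. card (\<omega> \<inter> U) = n} |U n. open U \<and> bounded U}"

text \<open>The sets of this countable family are in general not vaguely open.  A configuration near
  \<open>\<omega>\<close> is described by its number of points in a large ball and in small disjoint neighbourhoods of
  the points of \<open>\<omega>\<close> in that ball.\<close>

lemma vague_neighbourhood_counts:
  fixes X :: "'a::euclidean_space set"
  assumes X: "closed X" and Bs: "topological_basis Bs"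
    and f: "f \<in> Cc X" and V: "open V" and \<omega>: "\<omega> \<in> configurations X" "(\<integral>p. f p \<partial>config_measure \<omega>) \<in> V"
  obtains F where "finite F" "\<And>U n. (U, n) \<in> F \<Longrightarrow> (U \<in> Bs \<and> bounded U) \<or> U \<in> range (\<lambda>n. ball 0 (real n))"
    "\<And>U n. (U, n) \<in> F \<Longrightarrow> card (\<omega> \<inter> U) = n"
    "\<And>\<eta>. \<eta> \<in> configurations X \<Longrightarrow> \<forall>(U, n)\<in>F. card (\<eta> \<inter> U) = n \<Longrightarrow> (\<integral>p. f p \<partial>config_measure \<eta>) \<in> V"
proof -
  obtain e where e: "0 < e" "ball (\<integral>p. f p \<partial>config_measure \<omega>) e \<subseteq> V" using V \<omega>(2) open_contains_ball by blast
  obtain r where r: "\<And>x. x \<notin> ball 0 r \<Longrightarrow> f x = 0" using Cc_bounded_support[OF f] by metis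
  obtain N where N: "r \<le> real N" using real_arch_simple by blast
  define B :: "'a set" where "B = ball 0 (real N)"
  have fB: "f x = 0" if "x \<notin> B" for x using that N r[of x] by (auto simp: B_def)
  have S: "(\<integral>p. f p \<partial>config_measure \<eta>) = (\<Sum>x\<in>\<eta> \<inter> B. f x)" and fin: "finite (\<eta> \<inter> B)"
    if "\<eta> \<in> configurations X" for \<eta>
  proof -
    show fin: "finite (\<eta> \<inter> B)" unfolding B_def by (rule configurations_finite_bounded[OF X that]) simp
    show "(\<integral>p. f p \<partial>config_measure \<eta>) = (\<Sum>x\<in>\<eta> \<inter> B. f x)"
      by (rule integral_config_measure_finite[OF Cc_borel_measurable[OF X f] fin]) (use fB in auto)
  qed
  define P where "P = \<omega> \<inter> B"
  have P: "finite P" "P \<subseteq> X" "P \<subseteq> B" using fin[OF \<omega>(1)] \<omega>(1) by (auto simp: P_def configurations_def)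
  define m where "m = card P"
  \<comment> \<open>The integral is a sum of \<open>m\<close> terms, so each may move by
    \<open>e / (real m + 1)\<close>; the added 1 keeps the total strictly below \<open>e\<close> and
    covers \<open>m = 0\<close>.\<close>
  have "\<exists>d>0. \<forall>q\<in>X. dist q p < d \<longrightarrow> dist (f q) (f p) < e / (real m + 1)" if "p \<in> P" for p
  proof -
    have "continuous_on X f" using f by (simp add: Cc_def)
    moreover have "0 < e / (real m + 1)" using e(1) by simp
    moreover have "p \<in> X" using that P(2) by auto
    ultimately show ?thesis unfolding continuous_on_iff by blast
  qed
  then obtain d where d: "\<And>p. p \<in> P \<Longrightarrow> 0 < d p"
    "\<And>p q. p \<in> P \<Longrightarrow> q \<in> X \<Longrightarrow> dist q p < d p \<Longrightarrow> dist (f q) (f p) < e / (real m + 1)"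
    by metis
  \<comment> \<open>Neighbourhoods of radius half this separation are disjoint for distinct points
    of \<open>P\<close>.\<close>
  have "\<exists>s>0. \<forall>q\<in>P. q \<noteq> p \<longrightarrow> s \<le> dist p q" for p
    using finite_set_avoid[OF P(1)] by blast
  then obtain s where s: "\<And>p. 0 < s p" "\<And>p q. q \<in> P \<Longrightarrow> q \<noteq> p \<Longrightarrow> s p \<le> dist p q" by metis
  have "\<exists>U\<in>Bs. p \<in> U \<and> U \<subseteq> ball p (min (d p) (s p / 2)) \<inter> B" if "p \<in> P" for p
  proof -
    have "open (ball p (min (d p) (s p / 2)) \<inter> B)" by (auto simp: B_def)
    moreover have "p \<in> ball p (min (d p) (s p / 2)) \<inter> B" using d(1)[OF that] s(1)[of p] P(3) that by auto
    ultimately show ?thesis using topological_basisE[OF Bs] by metis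
  qed
  then obtain U where U: "\<And>p. p \<in> P \<Longrightarrow> U p \<in> Bs" "\<And>p. p \<in> P \<Longrightarrow> p \<in> U p"
    "\<And>p. p \<in> P \<Longrightarrow> U p \<subseteq> ball p (min (d p) (s p / 2)) \<inter> B" by metis
  have disj: "p = p'" if "p \<in> P" "p' \<in> P" "x \<in> U p" "x \<in> U p'" for p p' x
  proof (rule ccontr)
    assume ne: "p \<noteq> p'"
    have "dist p x < s p / 2" "dist p' x < s p' / 2" using U(3) that by force+
    moreover have "s p \<le> dist p p'" "s p' \<le> dist p p'" using s(2)[of p' p] s(2)[of p p'] ne that by (auto simp: dist_commute)
    moreover have "dist p p' \<le> dist p x + dist p' x" by (metis dist_triangle2 dist_commute)
    ultimately show False by linarith
  qed
  \<comment> \<open>One point in each of the disjoint sets \<open>U p\<close> and \<open>m\<close>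
    points in all of \<open>B\<close> leave no room for others: \<open>\<eta> \<inter> B\<close> is
    matched one to one with \<open>P\<close>.\<close>
  define F where "F = insert (B, m) ((\<lambda>p. (U p, 1)) ` P)"
  show thesis
  proof (rule that[of F])
    show "finite F" using P(1) by (simp add: F_def)
    show "(V \<in> Bs \<and> bounded V) \<or> V \<in> range (\<lambda>n. ball 0 (real n))" if VF: "(V, n) \<in> F" for V n
    proof (cases "V = B")
      case False
      then obtain p where p: "p \<in> P" "V = U p" using VF False by (auto simp: F_def)
      then have "bounded V" using U(3)[of p] by (meson bounded_Int bounded_ball bounded_subset)
      then show ?thesis using U(1) p by auto
    qed (auto simp: B_def)
    show "card (\<omega> \<inter> V) = n" if VF: "(V, n) \<in> F" for V n
    proof (cases "V = B \<and> n = m")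
      case False
      then obtain p where p: "p \<in> P" "V = U p" "n = 1" using VF False by (auto simp: F_def)
      have "\<omega> \<inter> U p = {p}"
      proof (intro set_eqI iffI)
        fix x assume x: "x \<in> \<omega> \<inter> U p"
        then have "x \<in> P" using U(3)[OF p(1)] by (auto simp: P_def)
        then show "x \<in> {p}" using disj[OF p(1) _ _ U(2)] x by auto
      qed (use U(2) p in \<open>auto simp: P_def\<close>)
      then show ?thesis using p by simp
    qed (auto simp: m_def P_def)
  next
    fix \<eta> assume \<eta>: "\<eta> \<in> configurations X" "\<forall>(U, n)\<in>F. card (\<eta> \<inter> U) = n"
    have "card (\<eta> \<inter> U p) = 1" if "p \<in> P" for p using \<eta>(2) that by (auto simp: F_def)
    then have "\<exists>q. \<eta> \<inter> U p = {q}" if "p \<in> P" for p using that card_1_singletonE by metis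
    then obtain q where q: "\<And>p. p \<in> P \<Longrightarrow> \<eta> \<inter> U p = {q p}" by metis
    have inj: "inj_on q P"
    proof (rule inj_onI)
      fix p p' assume "p \<in> P" "p' \<in> P" "q p = q p'"
      then show "p = p'" using disj[of p p' "q p"] q[of p] q[of p'] by auto
    qed
    have sub: "q ` P \<subseteq> \<eta> \<inter> B" using q U(3) by force
    have "card (\<eta> \<inter> B) = m" using \<eta>(2) by (auto simp: F_def)
    then have eq: "q ` P = \<eta> \<inter> B"
      using card_subset_eq[OF fin[OF \<eta>(1)] sub] inj by (simp add: card_image m_def)
    have "(\<integral>p. f p \<partial>config_measure \<eta>) = (\<Sum>p\<in>P. f (q p))"
      unfolding S[OF \<eta>(1)] eq[symmetric] using inj by (simp add: sum.reindex)
    moreover have "(\<integral>p. f p \<partial>config_measure \<omega>) = (\<Sum>p\<in>P. f p)" unfolding S[OF \<omega>(1)] P_def ..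
    ultimately have "dist (\<integral>p. f p \<partial>config_measure \<eta>) (\<integral>p. f p \<partial>config_measure \<omega>) = \<bar>\<Sum>p\<in>P. f (q p) - f p\<bar>"
      by (simp add: dist_real_def sum_subtractf)
    also have "\<dots> \<le> (\<Sum>p\<in>P. \<bar>f (q p) - f p\<bar>)" by (rule sum_abs)
    also have "\<dots> \<le> (\<Sum>p\<in>P. e / (real m + 1))"
    proof (rule sum_mono)
      fix p assume p: "p \<in> P"
      have "q p \<in> \<eta>" "q p \<in> U p" using q[OF p] by auto
      then have "q p \<in> X" "dist (q p) p < d p" using \<eta>(1) U(3)[OF p] by (auto simp: configurations_def dist_commute)
      then show "\<bar>f (q p) - f p\<bar> \<le> e / (real m + 1)" using d(2)[OF p] by (force simp: dist_real_def)
    qed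
    also have "\<dots> = real m * (e / (real m + 1))" by (simp add: m_def)
    also have "\<dots> < e" using e(1) by (simp add: field_simps)
    finally show "(\<integral>p. f p \<partial>config_measure \<eta>) \<in> V" using e(2) by (auto simp: dist_commute)
  qed
qed

text \<open>A vaguely open set may be an uncountable union of basic ones, so countability has to be
  gained. Around each of its configurations it contains a set \<open>C F\<close> of prescribed
  counts, and only countably many \<open>F\<close> occur. The converse inclusion obtains counts as
  limits of integrals.\<close>

lemma sets_config_borel_counts:
  fixes X :: "'a::euclidean_space set"
  assumes X: "closed X"
  shows "sets (config_borel X) = sigma_sets (configurations X) (count_generator X)"
proof
  show "sigma_sets (configurations X) (count_generator X) \<subseteq> sets (config_borel X)"
  proof (rule sets.sigma_sets_subset[of _ "config_borel X", simplified], rule subsetI)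
    fix A assume "A \<in> count_generator X"
    then obtain U n where "A = {\<omega> \<in> configurations X. card (\<omega> \<inter> U) = n}" "open U" "bounded U"
      by (auto simp: count_generator_def)
    then show "A \<in> sets (config_borel X)"
      using card_measurable_if_integrals_measurable[OF X, of U "config_borel X" n] integral_config_measurable
      by auto
  qed
  obtain Bs :: "'a set set" where Bs: "countable Bs" "topological_basis Bs"
    using ex_countable_basis by blast
  \<comment> \<open>Small neighbourhoods come from a countable base; the balls are added since the
    total count in a large ball is prescribed as well.\<close>
  define \<U> where "\<U> = {U\<in>Bs. bounded U} \<union> range (\<lambda>n. ball 0 (real n))"
  have U: "countable \<U>" "\<And>U. U \<in> \<U> \<Longrightarrow> open U \<and> bounded U"
    using Bs topological_basis_open by (auto simp: \<U>_def)
  define C where "C F = {\<omega> \<in> configurations X. \<forall>(U, n)\<in>F. card (\<omega> \<inter> U) = n}" for F :: "('a set \<times> nat) set"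
  define \<F> where "\<F> = {F. finite F \<and> F \<subseteq> \<U> \<times> (UNIV :: nat set)}"
  have cF: "countable \<F>" unfolding \<F>_def by (intro countable_Collect_finite_subset countable_SIGMA U(1) countableI_type)
  let ?S = "{{\<omega> \<in> configurations X. (\<integral>p. f p \<partial>config_measure \<omega>) \<in> U} |f U. f \<in> Cc X \<and> open U}"
  interpret sigma_algebra "configurations X" "sigma_sets (configurations X) (count_generator X)"
    by (rule sigma_algebra_sigma_sets) (auto simp: count_generator_def)
  have CF: "C F \<in> sigma_sets (configurations X) (count_generator X)" if "F \<in> \<F>" for F
  proof -
    have "finite F" "F \<subseteq> \<U> \<times> UNIV" using that by (auto simp: \<F>_def)
    then show ?thesis
    proof (induction F)
      case empty
      then show ?case using top by (simp add: C_def)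
    next
      case (insert p F)
      obtain V n where p: "p = (V, n)" by force
      have "C (insert p F) = {\<omega> \<in> configurations X. card (\<omega> \<inter> V) = n} \<inter> C F" by (auto simp: C_def p)
      moreover have "{\<omega> \<in> configurations X. card (\<omega> \<inter> V) = n} \<in> sigma_sets (configurations X) (count_generator X)"
        using U(2)[of V] insert.prems by (intro sigma_sets.Basic) (auto simp: count_generator_def p)
      ultimately show ?case using insert by auto
    qed
  qed
  \<comment> \<open>Induction over the generation of the topology: an intersection is served by the
    union of the two finite index sets, a union by the index set of one member.\<close>
  have nb: "\<exists>F\<in>\<F>. \<omega> \<in> C F \<and> C F \<subseteq> W" if "generate_topology_on ?S W" "\<omega> \<in> W" for W \<omega>
    using that
  proof (induction arbitrary: \<omega> rule: generate_topology_on.induct)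
    case (Int a b)
    then obtain F G where "F \<in> \<F>" "\<omega> \<in> C F" "C F \<subseteq> a" "G \<in> \<F>" "\<omega> \<in> C G" "C G \<subseteq> b" by blast
    moreover have "C (F \<union> G) = C F \<inter> C G" by (auto simp: C_def ball_Un)
    ultimately show ?case by (intro bexI[of _ "F \<union> G"]) (auto simp: \<F>_def)
  next
    case (UN K)
    then show ?case by (meson UnionE Sup_upper2)
  next
    case (Basis s)
    then obtain f V where s: "s = {\<omega> \<in> configurations X. (\<integral>p. f p \<partial>config_measure \<omega>) \<in> V}" "f \<in> Cc X" "open V" by blast
    have \<omega>: "\<omega> \<in> configurations X" "(\<integral>p. f p \<partial>config_measure \<omega>) \<in> V" using Basis.prems s(1) by auto
    obtain F where F: "finite F" "\<And>U n. (U, n) \<in> F \<Longrightarrow> (U \<in> Bs \<and> bounded U) \<or> U \<in> range (\<lambda>n. ball 0 (real n))"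
      "\<And>U n. (U, n) \<in> F \<Longrightarrow> card (\<omega> \<inter> U) = n"
      "\<And>\<eta>. \<eta> \<in> configurations X \<Longrightarrow> \<forall>(U, n)\<in>F. card (\<eta> \<inter> U) = n \<Longrightarrow> (\<integral>p. f p \<partial>config_measure \<eta>) \<in> V"
      using vague_neighbourhood_counts[OF X Bs(2) s(2,3) \<omega>] by metis
    have "F \<in> \<F>" using F(1,2) by (auto simp: \<F>_def \<U>_def)
    moreover have "\<omega> \<in> C F" using F(3) \<omega> by (auto simp: C_def)
    moreover have "C F \<subseteq> s" using F(4) s(1) by (auto simp: C_def)
    ultimately show ?case by blast
  qed auto
  show "sets (config_borel X) \<subseteq> sigma_sets (configurations X) (count_generator X)"
    unfolding sets_config_borel
  proof (rule sigma_sets_mono, rule subsetI)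
    fix W assume "W \<in> {U. openin (vague_topology X) U}"
    then have W: "generate_topology_on ?S W"
      by (simp add: vague_topology_def openin_topology_generated_by_iff)
    have eq: "W = (\<Union>F\<in>{F\<in>\<F>. C F \<subseteq> W}. C F)" using nb[OF W] by blast
    have "(\<Union>F\<in>{F\<in>\<F>. C F \<subseteq> W}. C F) \<in> sigma_sets (configurations X) (count_generator X)"
      using cF CF by (intro countable_UN'') (auto intro: countable_subset)
    then show "W \<in> sigma_sets (configurations X) (count_generator X)" unfolding eq[symmetric] .
  qed
qed

text \<open>Counts are written as integrals over \<open>count_space\<close>, the form in which sums
  over random points are shown to be measurable.\<close>

lemma measurable_config_borelI:
  fixes X :: "'a::euclidean_space set"
  assumes X: "closed X" and T: "\<And>n. n \<in> space M \<Longrightarrow> T n \<in> configurations X"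
    and meas: "\<And>U. open U \<Longrightarrow> bounded U \<Longrightarrow> (\<lambda>n. \<integral>\<^sup>+x. indicator U x \<partial>count_space (T n)) \<in> borel_measurable M"
  shows "T \<in> measurable M (config_borel X)"
proof (rule measurable_sigma_sets[OF sets_config_borel_counts[OF X]])
  show "count_generator X \<subseteq> Pow (configurations X)" by (auto simp: count_generator_def)
  show "T \<in> space M \<rightarrow> configurations X" using T by auto
  fix A assume "A \<in> count_generator X"
  then obtain U n where A: "A = {\<omega> \<in> configurations X. card (\<omega> \<inter> U) = n}" and U: "open U" "bounded U"
    by (auto simp: count_generator_def)
  note [measurable] = meas[OF U]
  have "T -` A \<inter> space M = {m \<in> space M. (\<integral>\<^sup>+x. indicator U x \<partial>count_space (T m)) = of_nat n}"
    using T configurations_finite_bounded[OF X _ U(2)]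
    by (auto simp: A nn_integral_indicator_count_space)
  also have "\<dots> \<in> sets M" by measurable
  finally show "T -` A \<inter> space M \<in> sets M" .
qed

section \<open>Measurability of sums over the points of a configuration\<close>

lemma nn_integral_count_space_ball_SUP:
  fixes f :: "'a::euclidean_space \<Rightarrow> ennreal"
  shows "(\<integral>\<^sup>+x. f x \<partial>count_space \<omega>) = (SUP k. \<integral>\<^sup>+x. f x * indicator (ball 0 (real k)) x \<partial>count_space \<omega>)"
proof -
  have "(\<integral>\<^sup>+x. f x \<partial>count_space \<omega>) = (\<integral>\<^sup>+x. (SUP k. f x * indicator (ball 0 (real k)) x) \<partial>count_space \<omega>)"
  proof (intro nn_integral_cong antisym)
    fix x :: 'a
    obtain k where "norm x < real k" using reals_Archimedean2 by blast
    then show "f x \<le> (SUP k. f x * indicator (ball 0 (real k)) x)"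
      by (intro SUP_upper2[of k]) auto
    show "(SUP k. f x * indicator (ball 0 (real k)) x) \<le> f x"
      by (rule SUP_least) (auto split: split_indicator)
  qed
  also have "\<dots> = (SUP k. \<integral>\<^sup>+x. f x * indicator (ball 0 (real k)) x \<partial>count_space \<omega>)"
    by (rule nn_integral_monotone_convergence_SUP)
      (auto simp: incseq_def le_fun_def split: split_indicator)
  finally show ?thesis .
qed

text \<open>Bounded sets are preferred as generators because counts and intensities are finite on
  them; a general open set is the countable union of its traces on balls.\<close>

lemma sets_restrict_borel_bounded:
  fixes X :: "'a::euclidean_space set"
  assumes X: "closed X"
  shows "sets (restrict_space borel X) = sigma_sets X {U \<inter> X |U. open U \<and> bounded U}"
proof
  have sp: "space (restrict_space borel X) = X" by (simp add: space_restrict_space)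
  have "{U \<inter> X |U. open U \<and> bounded U} \<subseteq> sets (restrict_space borel X)" by (auto simp: sets_restrict_space)
  from sets.sigma_sets_subset[OF this]
  show "sigma_sets X {U \<inter> X |U. open U \<and> bounded U} \<subseteq> sets (restrict_space borel X)" unfolding sp .
  have "sets (restrict_space borel X) = (\<inter>) X ` sigma_sets UNIV {S. open S}"
    by (simp add: sets_restrict_space borel_def)
  also have "\<dots> = sigma_sets X ((\<inter>) X ` {S. open S})"
    using sigma_sets_Int[of X UNIV "{S. open S}"] X sets_restrict_space[of borel X]
    by (metis borel_closed borel_def sets_measure_of_conv top_greatest Pow_UNIV)
  also have "\<dots> \<subseteq> sigma_sets X {U \<inter> X |U. open U \<and> bounded U}"
  proof (rule sigma_sets_mono, clarsimp)
    fix U :: "'a set" assume U: "open U"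
    have "X \<inter> U = (\<Union>k. U \<inter> ball 0 (real k) \<inter> X)" using UN_ball_Int[of "U \<inter> X"] by blast
    also have "\<dots> \<in> sigma_sets X {U \<inter> X |U. open U \<and> bounded U}"
      using U by (intro sigma_sets.Union sigma_sets.Basic) (auto intro: bounded_Int)
    finally show "X \<inter> U \<in> sigma_sets X {U \<inter> X |U. open U \<and> bounded U}" .
  qed
  finally show "sets (restrict_space borel X) \<subseteq> sigma_sets X {U \<inter> X |U. open U \<and> bounded U}" .
qed

lemma card_measurable:
  fixes X :: "'a::euclidean_space set"
  assumes X: "closed X" and W: "open W" "bounded W"
  shows "(\<lambda>\<omega>. card (\<omega> \<inter> W)) \<in> measurable (config_borel X) (count_space UNIV)"
proof -
  have "{\<omega> \<in> configurations X. card (\<omega> \<inter> W) = m} \<in> sets (config_borel X)" for m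
    unfolding sets_config_borel_counts[OF X] using W by (intro sigma_sets.Basic) (auto simp: count_generator_def)
  then show ?thesis
    by (intro measurable_count_space_eq2_countable[THEN iffD2]) (auto simp: vimage_def Int_def conj_commute)
qed

text \<open>For rectangles the sum is an indicator times a point count. A Dynkin class argument
  extends this to measurable sets, and approximation by simple functions to all \<open>F\<close>.
  Summing only inside a ball keeps the sums finite while complements have to be subtracted; the
  balls then grow.\<close>

lemma nn_integral_count_space_measurable:
  fixes X :: "'a::euclidean_space set"
  assumes X: "closed X" and T[measurable]: "T \<in> measurable M (config_borel X)"
    and F: "F \<in> borel_measurable (M \<Otimes>\<^sub>M restrict_space borel X)"
  shows "(\<lambda>n. \<integral>\<^sup>+x. F (n, x) \<partial>count_space (T n)) \<in> borel_measurable M"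
proof -
  let ?XM = "restrict_space borel X :: 'a measure"
  have Tsp: "T n \<in> configurations X" if "n \<in> space M" for n
    using measurable_space[OF T that] by simp
  have spX: "space ?XM = X" by (simp add: space_restrict_space)
  define Eb where "Eb = {U \<inter> X |U. open U \<and> bounded U}"
  have sX: "sets ?XM = sigma_sets (space ?XM) Eb"
    unfolding spX Eb_def by (rule sets_restrict_borel_bounded[OF X])
  have eq: "sets (M \<Otimes>\<^sub>M ?XM) = sigma_sets (space M \<times> X) {a \<times> b |a b. a \<in> sets M \<and> b \<in> Eb}"
  proof -
    have "sets (M \<Otimes>\<^sub>M ?XM) = sets (sigma (space M \<times> space ?XM) {a \<times> b |a b. a \<in> sets M \<and> b \<in> Eb})"
    proof (rule sets_pair_eq)
      show "sets ?XM = sigma_sets (space ?XM) Eb" by (rule sX)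
      show "range (\<lambda>k. ball 0 (real k) \<inter> X) \<subseteq> Eb" by (auto simp: Eb_def)
      show "\<Union> (range (\<lambda>k. ball 0 (real k) \<inter> X)) = space ?XM" unfolding spX by (rule UN_ball_Int)
      show "countable {space M}" by auto
    qed (auto simp: sets.sigma_sets_eq Eb_def spX sets.sets_into_space dest: sets.sets_into_space)
    also have "\<dots> = sigma_sets (space M \<times> X) {a \<times> b |a b. a \<in> sets M \<and> b \<in> Eb}"
      unfolding spX by (rule sets_measure_of) (auto simp: Eb_def dest: sets.sets_into_space)
    finally show ?thesis .
  qed
  have ball: "(\<lambda>n. \<integral>\<^sup>+x. indicator Q (n, x) * indicator (ball 0 (real k)) x \<partial>count_space (T n)) \<in> borel_measurable M"
    if Q: "Q \<in> sets (M \<Otimes>\<^sub>M ?XM)" for Q k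
  proof -
    have sub: "{a \<times> b |a b. a \<in> sets M \<and> b \<in> Eb} \<subseteq> Pow (space M \<times> X)"
      by (auto simp: Eb_def dest: sets.sets_into_space)
    have "Int_stable {a \<times> b |a b. a \<in> sets M \<and> b \<in> Eb}"
    proof (rule Int_stableI, clarsimp)
      fix a a' b b' assume "a \<in> sets M" "a' \<in> sets M" "b \<in> Eb" "b' \<in> Eb"
      then obtain U U' where "b = U \<inter> X" "b' = U' \<inter> X" "open U" "open U'" "bounded U" by (auto simp: Eb_def)
      then have "b \<inter> b' \<in> Eb" unfolding Eb_def by (intro CollectI exI[of _ "U \<inter> U'"]) auto
      then show "\<exists>c d. a \<times> b \<inter> a' \<times> b' = c \<times> d \<and> c \<in> sets M \<and> d \<in> Eb"
        using \<open>a \<in> sets M\<close> \<open>a' \<in> sets M\<close> by (intro exI[of _ "a \<inter> a'"] exI[of _ "b \<inter> b'"]) auto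
    qed
    then show ?thesis
      using sub Q unfolding eq
    proof (induction Q rule: sigma_sets_induct_disjoint)
    case (basic A)
    then obtain a U where A: "A = a \<times> (U \<inter> X)" and a: "a \<in> sets M" and U: "open U" by (auto simp: Eb_def)
    define W where "W = U \<inter> ball 0 (real k)"
    have W: "open W" "bounded W" using U by (auto simp: W_def)
    have [measurable]: "(\<lambda>n. card (T n \<inter> W)) \<in> measurable M (count_space UNIV)"
      by (rule measurable_compose[OF T card_measurable[OF X W]])
    have "(\<lambda>n. indicator a n * (of_nat (card (T n \<inter> W)) :: ennreal)) \<in> borel_measurable M"
      using a by measurable
    moreover have "(\<integral>\<^sup>+x. indicator A (n, x) * indicator (ball 0 (real k)) x \<partial>count_space (T n)) =
        indicator a n * of_nat (card (T n \<inter> W))" if n: "n \<in> space M" for n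
    proof -
      have "(\<integral>\<^sup>+x. indicator A (n, x) * indicator (ball 0 (real k)) x \<partial>count_space (T n)) =
         (\<integral>\<^sup>+x. indicator a n * indicator W x \<partial>count_space (T n))"
        using Tsp[OF n] by (intro nn_integral_cong) (auto simp: A W_def configurations_def split: split_indicator)
      then show ?thesis
        using configurations_finite_bounded[OF X Tsp[OF n] W(2)]
        by (simp add: nn_integral_cmult nn_integral_indicator_count_space)
    qed
    ultimately show ?case by (simp cong: measurable_cong)
  next
    case empty
    then show ?case by simp
  next
    case (compl A)
    have whole: "(\<lambda>n. \<integral>\<^sup>+x. indicator (ball 0 (real k)) x \<partial>count_space (T n)) \<in> borel_measurable M"
    proof -
      have [measurable]: "(\<lambda>n. card (T n \<inter> ball 0 (real k))) \<in> measurable M (count_space UNIV)"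
        by (rule measurable_compose[OF T card_measurable[OF X open_ball bounded_ball]])
      have "(\<lambda>n. of_nat (card (T n \<inter> ball 0 (real k))) :: ennreal) \<in> borel_measurable M" by measurable
      then show ?thesis
        using configurations_finite_bounded[OF X Tsp]
        by (simp add: nn_integral_indicator_count_space cong: measurable_cong)
    qed
    \<comment> \<open>Inside the ball the total count is finite, so the sum over the complement is a
      genuine difference.\<close>
    have "(\<integral>\<^sup>+x. indicator (space M \<times> X - A) (n, x) * indicator (ball 0 (real k)) x \<partial>count_space (T n)) =
      (\<integral>\<^sup>+x. indicator (ball 0 (real k)) x \<partial>count_space (T n)) -
      (\<integral>\<^sup>+x. indicator A (n, x) * indicator (ball 0 (real k)) x \<partial>count_space (T n))" if n: "n \<in> space M" for n
    proof -
      have fin: "(\<integral>\<^sup>+x. indicator (ball 0 (real k)) x \<partial>count_space (T n)) \<noteq> \<infinity>"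
        using configurations_finite_bounded[OF X Tsp[OF n]]
        by (simp add: nn_integral_indicator_count_space)
      have "(\<integral>\<^sup>+x. indicator A (n, x) * indicator (ball 0 (real k)) x \<partial>count_space (T n)) \<le>
        (\<integral>\<^sup>+x. indicator (ball 0 (real k)) x \<partial>count_space (T n))"
        by (intro nn_integral_mono) (auto split: split_indicator)
      then have fin': "(\<integral>\<^sup>+x. indicator A (n, x) * indicator (ball 0 (real k)) x \<partial>count_space (T n)) \<noteq> \<infinity>"
        using fin by (auto simp: top_unique)
      have "(\<integral>\<^sup>+x. indicator (space M \<times> X - A) (n, x) * indicator (ball 0 (real k)) x \<partial>count_space (T n)) =
        (\<integral>\<^sup>+x. indicator (ball 0 (real k)) x - indicator A (n, x) * indicator (ball 0 (real k)) x \<partial>count_space (T n))"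
        using Tsp[OF n] n by (intro nn_integral_cong) (auto simp: configurations_def split: split_indicator)
      also have "\<dots> = (\<integral>\<^sup>+x. indicator (ball 0 (real k)) x \<partial>count_space (T n)) -
        (\<integral>\<^sup>+x. indicator A (n, x) * indicator (ball 0 (real k)) x \<partial>count_space (T n))"
        using fin' by (intro nn_integral_diff) (auto split: split_indicator)
      finally show ?thesis .
    qed
    moreover have "(\<lambda>n. (\<integral>\<^sup>+x. indicator (ball 0 (real k)) x \<partial>count_space (T n)) -
      (\<integral>\<^sup>+x. indicator A (n, x) * indicator (ball 0 (real k)) x \<partial>count_space (T n))) \<in> borel_measurable M"
      using whole compl(2) by (rule borel_measurable_minus_ennreal)
    ultimately show ?case by (simp cong: measurable_cong)
  next
    case (union A)
    have "(\<integral>\<^sup>+x. indicator (\<Union> (range A)) (n, x) * indicator (ball 0 (real k)) x \<partial>count_space (T n)) =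
      (\<Sum>i. \<integral>\<^sup>+x. indicator (A i) (n, x) * indicator (ball 0 (real k)) x \<partial>count_space (T n))" for n
    proof -
      have "(\<integral>\<^sup>+x. indicator (\<Union> (range A)) (n, x) * indicator (ball 0 (real k)) x \<partial>count_space (T n)) =
        (\<integral>\<^sup>+x. (\<Sum>i. indicator (A i) (n, x) * indicator (ball 0 (real k)) x) \<partial>count_space (T n))"
        using union(1) by (intro nn_integral_cong) (simp add: suminf_indicator[symmetric] ennreal_suminf_multc)
      also have "\<dots> = (\<Sum>i. \<integral>\<^sup>+x. indicator (A i) (n, x) * indicator (ball 0 (real k)) x \<partial>count_space (T n))"
        by (rule nn_integral_suminf) simp
      finally show ?thesis .
    qed
    then show ?case using union(3) by simp
  qed
  qed
  show ?thesis
    using F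
  proof (induction F rule: borel_measurable_induct)
    case (cong f g)
    have "(\<integral>\<^sup>+x. f (n, x) \<partial>count_space (T n)) = (\<integral>\<^sup>+x. g (n, x) \<partial>count_space (T n))" if "n \<in> space M" for n
      using cong(3) that Tsp[OF that]
      by (intro nn_integral_cong) (auto simp: space_pair_measure spX configurations_def)
    then show ?case using cong(4) by (simp cong: measurable_cong)
  next
    case (set Q)
    show ?case
      by (subst nn_integral_count_space_ball_SUP) (use ball[OF set] in \<open>auto intro!: borel_measurable_SUP\<close>)
  next
    case (mult u c)
    then show ?case by (simp add: nn_integral_cmult)
  next
    case (add u v)
    then show ?case by (simp add: nn_integral_add)
  next
    case (seq U)
    have "(\<integral>\<^sup>+x. (SUP i. U i) (n, x) \<partial>count_space (T n)) = (SUP i. \<integral>\<^sup>+x. U i (n, x) \<partial>count_space (T n))" for n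
      unfolding SUP_apply using seq(3)
      by (intro nn_integral_monotone_convergence_SUP) (auto simp: incseq_def le_fun_def)
    then show ?case using seq by simp
  qed
qed

lemma nn_integral_count_space_insert:
  "x \<notin> \<omega> \<Longrightarrow> (\<integral>\<^sup>+y. f y \<partial>count_space (insert x \<omega>)) = f x + (\<integral>\<^sup>+y. f y \<partial>count_space \<omega>)"
proof -
  assume x: "x \<notin> \<omega>"
  have "(\<integral>\<^sup>+y. f y \<partial>count_space (insert x \<omega>)) =
    (\<integral>\<^sup>+y. f y * indicator {x} y + f y * indicator \<omega> y \<partial>count_space UNIV)"
    using x by (subst nn_integral_count_space_indicator) (auto intro!: nn_integral_cong split: split_indicator)
  also have "\<dots> = (\<integral>\<^sup>+y. f y * indicator {x} y \<partial>count_space UNIV) + (\<integral>\<^sup>+y. f y * indicator \<omega> y \<partial>count_space UNIV)"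
    by (rule nn_integral_add) auto
  also have "\<dots> = f x + (\<integral>\<^sup>+y. f y \<partial>count_space \<omega>)"
    by (simp add: nn_integral_count_space_indicator[symmetric] nn_integral_count_space_finite)
  finally show ?thesis .
qed

lemma measurable_restrict_borel[measurable]: "(\<lambda>x. x) \<in> measurable (restrict_space borel X) borel"
  by (intro measurable_restrict_space1) simp

lemma count_measurable:
  fixes X :: "'a::euclidean_space set"
  assumes "closed X" "B \<in> sets borel"
  shows "(\<lambda>\<omega>. \<integral>\<^sup>+x. indicator B x \<partial>count_space \<omega>) \<in> borel_measurable (config_borel X)"
proof -
  have [measurable]: "B \<in> sets borel" by fact
  have "(\<lambda>p. indicator B (snd p)) \<in> borel_measurable (config_borel X \<Otimes>\<^sub>M restrict_space borel X)"
    by measurable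
  from nn_integral_count_space_measurable[OF assms(1) measurable_ident this] show ?thesis by simp
qed

text \<open>The indicator of the diagonal has nonzero sum over the points of \<open>\<omega>\<close>
  exactly when \<open>x\<close> is one of them, so membership inherits measurability from such
  sums.\<close>

lemma config_mem_measurable:
  fixes X :: "'a::euclidean_space set"
  assumes X: "closed X"
  shows "Measurable.pred (restrict_space borel X \<Otimes>\<^sub>M config_borel X) (\<lambda>p. fst p \<in> snd p)"
proof -
  let ?P = "restrict_space borel X \<Otimes>\<^sub>M config_borel X"
  have [measurable]: "{q \<in> space (?P \<Otimes>\<^sub>M restrict_space borel X). snd q = fst (fst q)} \<in> sets (?P \<Otimes>\<^sub>M restrict_space borel X)"
    (is "?Q \<in> _") by measurable
  have [measurable]: "(\<lambda>p. \<integral>\<^sup>+y. indicator ?Q (p, y) \<partial>count_space (snd p)) \<in> borel_measurable ?P"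
    by (rule nn_integral_count_space_measurable[OF X]) measurable
  have "{p \<in> space ?P. (\<integral>\<^sup>+y. indicator ?Q (p, y) \<partial>count_space (snd p)) \<noteq> 0} \<in> sets ?P" by measurable
  also have "{p \<in> space ?P. (\<integral>\<^sup>+y. indicator ?Q (p, y) \<partial>count_space (snd p)) \<noteq> 0} = {p \<in> space ?P. fst p \<in> snd p}"
  proof (intro Collect_cong conj_cong refl)
    fix p assume p: "p \<in> space ?P"
    then have "snd p \<subseteq> X" by (auto simp: space_pair_measure configurations_def)
    then have "(\<integral>\<^sup>+y. indicator ?Q (p, y) \<partial>count_space (snd p)) = (\<integral>\<^sup>+y. indicator {fst p} y \<partial>count_space (snd p))"
      using p by (intro nn_integral_cong) (auto simp: space_pair_measure space_restrict_space split: split_indicator)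
    also have "\<dots> = (if fst p \<in> snd p then 1 else 0)"
      by (subst nn_integral_indicator_count_space) auto
    finally show "(\<integral>\<^sup>+y. indicator ?Q (p, y) \<partial>count_space (snd p)) \<noteq> 0 \<longleftrightarrow> fst p \<in> snd p" by simp
  qed
  finally show ?thesis by (simp add: pred_def)
qed

text \<open>Inserting a point raises the counts only if it is new, which is why measurability of
  membership enters.\<close>

lemma config_insert_measurable:
  fixes X :: "'a::euclidean_space set"
  assumes X: "closed X"
  shows "(\<lambda>p. insert (fst p) (snd p)) \<in> measurable (restrict_space borel X \<Otimes>\<^sub>M config_borel X) (config_borel X)"
proof (rule measurable_config_borelI[OF X])
  let ?P = "restrict_space borel X \<Otimes>\<^sub>M config_borel X"
  show "insert (fst p) (snd p) \<in> configurations X" if "p \<in> space ?P" for p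
    using that by (auto simp: space_pair_measure space_restrict_space intro: configurations_insert)
  fix U :: "'a set" assume U: "open U" "bounded U"
  have [measurable]: "U \<in> sets borel" using U by simp
  note [measurable] = config_mem_measurable[OF X] count_measurable[OF X]
  have "(\<lambda>p. if fst p \<in> snd p then \<integral>\<^sup>+x. indicator U x \<partial>count_space (snd p)
      else indicator U (fst p) + (\<integral>\<^sup>+x. indicator U x \<partial>count_space (snd p))) \<in> borel_measurable ?P"
    by measurable
  also have "(\<lambda>p. if fst p \<in> snd p then \<integral>\<^sup>+x. indicator U x \<partial>count_space (snd p)
      else indicator U (fst p) + (\<integral>\<^sup>+x. indicator U x \<partial>count_space (snd p))) =
    (\<lambda>p. \<integral>\<^sup>+x. indicator U x \<partial>count_space (insert (fst p) (snd p)))"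
    by (auto simp: fun_eq_iff nn_integral_count_space_insert insert_absorb)
  finally show "(\<lambda>p. \<integral>\<^sup>+x. indicator U x \<partial>count_space (insert (fst p) (snd p))) \<in> borel_measurable ?P" .
qed

text \<open>For nonnegative \<open>f\<close> the exponentials have values between 0 and 1, are
  closed under products because the exponents add, and give back the integrals of \<open>f\<close>
  through the logarithm; so they form a generating multiplicative class.\<close>

lemma laplace_functional_unique:
  fixes X :: "'a::euclidean_space set"
  assumes X: "closed X" and M: "finite_measure M" "sets M = sets (config_borel X)"
    and N: "finite_measure N" "sets N = sets (config_borel X)"
    and eq: "\<And>f. f \<in> Cc X \<Longrightarrow> (\<And>x. 0 \<le> f x) \<Longrightarrow>
      (\<integral>\<omega>. exp (- (\<integral>x. f x \<partial>config_measure \<omega>)) \<partial>M) = (\<integral>\<omega>. exp (- (\<integral>x. f x \<partial>config_measure \<omega>)) \<partial>N)"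
  shows "M = N"
proof -
  \<comment> \<open>The value 1 outside the configurations makes the constant 1 and all products
    members of the class as functions on the whole type, as
    \<open>multiplicative_class_measure_eq\<close> demands.\<close>
  define E where "E f \<omega> = (if \<omega> \<in> configurations X then exp (- (\<integral>x. f x \<partial>config_measure \<omega>)) else 1)"
    for f :: "'a \<Rightarrow> real" and \<omega>
  define \<Y> where "\<Y> = {E f |f. f \<in> Cc X \<and> (\<forall>x. 0 \<le> f x)}"
  have spM: "space M = configurations X" and spN: "space N = configurations X"
    using M(2) N(2) by (auto dest!: sets_eq_imp_space_eq)
  have meas: "E f \<in> borel_measurable (config_borel X)" if "f \<in> Cc X" for f
  proof -
    note [measurable] = integral_config_measurable[OF that]
    have "(\<lambda>\<omega>. exp (- (\<integral>x. f x \<partial>config_measure \<omega>))) \<in> borel_measurable (config_borel X)" by measurable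
    then show ?thesis by (rule measurable_cong[THEN iffD1, rotated]) (auto simp: E_def)
  qed
  show ?thesis
  proof (rule multiplicative_class_measure_eq[where \<Y>=\<Y>])
    show "sets M = sets N" using M N by simp
    show "Y \<in> borel_measurable M" if "Y \<in> \<Y>" for Y
      using that meas measurable_cong_sets[OF M(2) refl, of "borel :: real measure"] by (auto simp: \<Y>_def)
    show "0 \<le> Y x \<and> Y x \<le> 1" if "Y \<in> \<Y>" for Y x
      using that ennreal_integral_config_measure(2)[OF X] by (auto simp: \<Y>_def E_def)
    show "(\<lambda>_. 1) \<in> \<Y>"
      unfolding \<Y>_def by (intro CollectI exI[of _ "\<lambda>_. 0"]) (auto simp: E_def Cc_zero fun_eq_iff)
    show "(\<lambda>x. Y x * Z x) \<in> \<Y>" if YZ: "Y \<in> \<Y>" "Z \<in> \<Y>" for Y Z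
    proof -
      obtain f g where fg: "Y = E f" "f \<in> Cc X" "\<And>x. 0 \<le> f x" "Z = E g" "g \<in> Cc X" "\<And>x. 0 \<le> g x"
        using YZ by (auto simp: \<Y>_def)
      have "(\<lambda>x. Y x * Z x) = E (\<lambda>x. f x + g x)"
        using integral_config_measure_add[OF X fg(2,5)]
        by (auto simp: E_def fg(1,4) fun_eq_iff exp_add[symmetric])
      then show ?thesis using fg Cc_add[OF fg(2,5)] unfolding \<Y>_def by (intro CollectI exI[of _ "\<lambda>x. f x + g x"]) auto
    qed
    show "integral\<^sup>L M Y = integral\<^sup>L N Y" if Y: "Y \<in> \<Y>" for Y
    proof -
      obtain f where f: "Y = E f" "f \<in> Cc X" "\<And>x. 0 \<le> f x" using Y by (auto simp: \<Y>_def)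
      have "integral\<^sup>L M Y = (\<integral>\<omega>. exp (- (\<integral>x. f x \<partial>config_measure \<omega>)) \<partial>M)"
        by (rule Bochner_Integration.integral_cong) (auto simp: f(1) E_def spM)
      also have "\<dots> = (\<integral>\<omega>. exp (- (\<integral>x. f x \<partial>config_measure \<omega>)) \<partial>N)" by (rule eq[OF f(2,3)])
      also have "\<dots> = integral\<^sup>L N Y"
        by (rule Bochner_Integration.integral_cong) (auto simp: f(1) E_def spN)
      finally show ?thesis .
    qed
    define G where "G = {{x \<in> space M. Y x \<le> a} |Y a. Y \<in> \<Y>}"
    have GP: "G \<subseteq> Pow (space M)" by (auto simp: G_def)
    show "sets M = sigma_sets (space M) G"
    proof
      show "sigma_sets (space M) G \<subseteq> sets M"
      proof (rule sets.sigma_sets_subset, clarsimp simp: G_def \<Y>_def)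
        fix f a assume "f \<in> Cc X"
        note [measurable] = meas[OF this]
        have "{x \<in> space (config_borel X). E f x \<le> a} \<in> sets (config_borel X)" by measurable
        then show "{x \<in> space M. E f x \<le> a} \<in> sets M" by (simp add: M(2) spM)
      qed
      define \<Sigma> where "\<Sigma> = sigma (space M) G"
      have sp: "space \<Sigma> = configurations X" unfolding \<Sigma>_def using GP spM by (simp add: space_measure_of)
      have st: "sets \<Sigma> = sigma_sets (space M) G" unfolding \<Sigma>_def using GP by (simp add: sets_measure_of)
      have int: "(\<lambda>\<omega>. \<integral>x. f x \<partial>config_measure \<omega>) \<in> borel_measurable \<Sigma>"
        if f: "f \<in> Cc X" "\<And>x. 0 \<le> f x" for f
      proof -
        have [measurable]: "E f \<in> borel_measurable \<Sigma>"
        proof (rule borel_measurable_iff_le[THEN iffD2], rule allI)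
          fix a
          have "{x \<in> space M. E f x \<le> a} \<in> G" unfolding G_def \<Y>_def using f by blast
          then show "{w \<in> space \<Sigma>. E f w \<le> a} \<in> sets \<Sigma>" using st sp spM by auto
        qed
        \<comment> \<open>The logarithm recovers the integral of \<open>f\<close>, so the generated
          sigma-algebra contains all counts and hence everything.\<close>
        have "(\<lambda>\<omega>. - ln (E f \<omega>)) \<in> borel_measurable \<Sigma>" by measurable
        then show ?thesis by (rule measurable_cong[THEN iffD1, rotated]) (simp add: E_def sp)
      qed
      have "A \<in> sigma_sets (space M) G" if A: "A \<in> count_generator X" for A
      proof -
        obtain U n where "A = {\<omega> \<in> configurations X. card (\<omega> \<inter> U) = n}" "open U" "bounded U"
          using A by (auto simp: count_generator_def)
        then show ?thesis using card_measurable_if_integrals_measurable[OF X _ _ sp int] st by auto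
      qed
      then show "sets M \<subseteq> sigma_sets (space M) G"
        unfolding M(2) sets_config_borel_counts[OF X] spM[symmetric] by (intro sigma_sets_mono) auto
    qed
  qed (use M N in auto)
qed

section \<open>The Poisson measure and Mecke's formula\<close>

lemma one_minus_exp_le: "1 - exp (- y) \<le> y" for y :: real
  using exp_ge_add_one_self[of "- y"] by simp

text \<open>Sandwich between \<open>x - x\<^sup>2 / 2\<close> and \<open>x\<close>; after scaling by
  \<open>Suc n\<close> the quadratic term is of order 1/n. It serves both on single paths, for
  difference quotients, and for the exponents of the Laplace functional.\<close>

lemma one_minus_exp_scaled_tendsto:
  fixes y :: "nat \<Rightarrow> real"
  assumes y: "\<And>n. 0 \<le> y n" and lim: "(\<lambda>n. y n * real (Suc n)) \<longlonglongrightarrow> b"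
  shows "(\<lambda>n. (1 - exp (- y n)) * real (Suc n)) \<longlonglongrightarrow> b"
proof (rule tendsto_sandwich)
  have le: "x - x\<^sup>2 / 2 \<le> 1 - exp (- x)" if "0 \<le> x" for x :: real
  proof -
    have p: "0 < 1 + x + x\<^sup>2 / 2" using that by (simp add: add_pos_nonneg)
    have "exp (- x) \<le> 1 / (1 + x + x\<^sup>2 / 2)"
      using exp_lower_Taylor_quadratic[OF that] p by (simp add: exp_minus field_simps)
    also have "\<dots> \<le> 1 - x + x\<^sup>2 / 2"
    proof -
      \<comment> \<open>This product is at least 1, so \<open>1 - x + x\<^sup>2 / 2\<close> bounds
        the reciprocal of the quadratic Taylor polynomial of \<open>exp x\<close>, and that
        reciprocal bounds \<open>exp (- x)\<close>.\<close>
      have "(1 - x + x\<^sup>2 / 2) * (1 + x + x\<^sup>2 / 2) = 1 + (x\<^sup>2)\<^sup>2 / 4"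
        by (simp add: power2_eq_square field_simps)
      then have "1 \<le> (1 - x + x\<^sup>2 / 2) * (1 + x + x\<^sup>2 / 2)" by simp
      then show ?thesis using p by (simp add: pos_divide_le_eq)
    qed
    finally show ?thesis by simp
  qed
  show "\<forall>\<^sub>F n in sequentially. y n * real (Suc n) - (y n * real (Suc n))\<^sup>2 / 2 * inverse (real (Suc n))
      \<le> (1 - exp (- y n)) * real (Suc n)"
  proof (intro always_eventually allI)
    fix n
    have "y n * real (Suc n) - (y n * real (Suc n))\<^sup>2 / 2 * inverse (real (Suc n)) = (y n - (y n)\<^sup>2 / 2) * real (Suc n)"
      by (simp add: field_simps power2_eq_square)
    also have "\<dots> \<le> (1 - exp (- y n)) * real (Suc n)"
      by (intro mult_right_mono le y) simp
    finally show "y n * real (Suc n) - (y n * real (Suc n))\<^sup>2 / 2 * inverse (real (Suc n))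
      \<le> (1 - exp (- y n)) * real (Suc n)" .
  qed
  show "\<forall>\<^sub>F n in sequentially. (1 - exp (- y n)) * real (Suc n) \<le> y n * real (Suc n)"
  proof (intro always_eventually allI mult_right_mono)
    show "1 - exp (- y n) \<le> y n" for n by (rule one_minus_exp_le)
  qed simp
  have "(\<lambda>n. y n * real (Suc n) - (y n * real (Suc n))\<^sup>2 / 2 * inverse (real (Suc n))) \<longlonglongrightarrow> b - b\<^sup>2 / 2 * 0"
    by (intro tendsto_intros lim LIMSEQ_inverse_real_of_nat) simp
  then show "(\<lambda>n. y n * real (Suc n) - (y n * real (Suc n))\<^sup>2 / 2 * inverse (real (Suc n))) \<longlonglongrightarrow> b" by simp
qed (rule lim)

text \<open>The setting without a time coordinate. Finite mass on balls provides sigma-finiteness;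
  diffuseness ensures that \<open>insert x \<omega>\<close> adds a point for almost every
  pair.\<close>

locale poisson_configuration =
  fixes X :: "'a::euclidean_space set" and \<pi> :: "'a measure" and \<mu> :: "'a set measure"
  assumes X: "closed X"
    and sets_\<pi>: "sets \<pi> = sets (restrict_space borel X)"
    and finite_\<pi>: "\<And>k::nat. emeasure \<pi> (ball 0 (real k) \<inter> X) < \<infinity>"
    and diffuse_\<pi>: "\<And>x. emeasure \<pi> {x} = 0"
    and poisson: "poisson_measure X \<pi> \<mu>"
begin

sublocale prob_space \<mu> using poisson by (simp add: poisson_measure_def)

lemma sets_\<mu>[measurable_cong]: "sets \<mu> = sets (config_borel X)"
  using poisson by (simp add: poisson_measure_def)

lemma space_\<mu>[simp]: "space \<mu> = configurations X"
  using sets_eq_imp_space_eq[OF sets_\<mu>] by simp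

lemma space_\<pi>[simp]: "space \<pi> = X"
  using sets_eq_imp_space_eq[OF sets_\<pi>] by (simp add: space_restrict_space)

declare sets_\<pi>[measurable_cong]

lemma sigma_finite_\<pi>: "sigma_finite_measure \<pi>"
proof
  show "\<exists>A. countable A \<and> A \<subseteq> sets \<pi> \<and> \<Union> A = space \<pi> \<and> (\<forall>a\<in>A. emeasure \<pi> a \<noteq> \<infinity>)"
  proof (intro exI[of _ "range (\<lambda>k. ball 0 (real k) \<inter> X)"] conjI)
    show "\<Union> (range (\<lambda>k. ball 0 (real k) \<inter> X)) = space \<pi>"
      unfolding space_\<pi> by (rule UN_ball_Int)
    show "range (\<lambda>k. ball 0 (real k) \<inter> X) \<subseteq> sets \<pi>"
      by (auto simp: sets_\<pi> sets_restrict_space)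
  qed (use finite_\<pi> in \<open>auto simp: less_top[symmetric]\<close>)
qed

sublocale P: pair_sigma_finite \<pi> \<mu>
  using sigma_finite_\<pi> by (simp add: pair_sigma_finite_def sigma_finite_measure_axioms)

lemma borel_measurable_\<pi>: "f \<in> borel_measurable borel \<Longrightarrow> f \<in> borel_measurable \<pi>"
  using measurable_cong_sets[OF sets_\<pi> refl, of borel] by (auto intro: measurable_restrict_space1)

lemma Cc_measurable_\<pi>: "f \<in> Cc X \<Longrightarrow> f \<in> borel_measurable \<pi>"
  by (intro borel_measurable_\<pi> Cc_borel_measurable[OF X])

lemma Cc_integrable_\<pi>:
  assumes f: "f \<in> Cc X"
  shows "integrable \<pi> f"
proof -
  obtain r where r: "0 < r" "\<And>x. x \<notin> ball 0 r \<Longrightarrow> f x = 0" using Cc_bounded_support[OF f] by metis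
  obtain b where b: "0 \<le> b" "\<And>x. \<bar>f x\<bar> \<le> b" using Cc_bounded[OF f] by metis
  obtain k where k: "r \<le> real k" using real_arch_simple by blast
  show ?thesis
  proof (rule Bochner_Integration.integrable_bound)
    show "integrable \<pi> (\<lambda>x. b * indicator (ball 0 (real k) \<inter> X) x)"
      using finite_\<pi>[of k] by (intro integrable_mult_right integrable_real_indicator) (auto simp: sets_\<pi> sets_restrict_space)
    show "AE x in \<pi>. norm (f x) \<le> norm (b * indicator (ball 0 (real k) \<inter> X) x)"
      using b r k by (auto split: split_indicator)
  qed (rule Cc_measurable_\<pi>[OF f])
qed

lemma laplace_functional:
  assumes f: "f \<in> Cc X"
  shows "(\<integral>\<omega>. exp (- (\<integral>x. f x \<partial>config_measure \<omega>)) \<partial>\<mu>) = exp (- (\<integral>x. (1 - exp (- f x)) \<partial>\<pi>))"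
proof -
  have "(\<lambda>x. - f x) \<in> Cc X" using Cc_scale[OF f, of "-1"] by simp
  then have "(\<integral>\<omega>. exp (\<integral>x. - f x \<partial>config_measure \<omega>) \<partial>\<mu>) = exp (\<integral>x. exp (- f x) - 1 \<partial>\<pi>)"
    using poisson unfolding poisson_measure_def by blast
  also have "(\<integral>x. exp (- f x) - 1 \<partial>\<pi>) = - (\<integral>x. (1 - exp (- f x)) \<partial>\<pi>)"
    by (subst integral_minus[symmetric]) simp
  finally show ?thesis by simp
qed

text \<open>Derivative at \<open>\<epsilon> = 0\<close> of the Laplace functional at \<open>f + \<epsilon> g\<close>.\<close>

lemma mecke_Cc:
  assumes f: "f \<in> Cc X" "\<And>x. 0 \<le> f x" and g: "g \<in> Cc X" "\<And>x. 0 \<le> g x"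
  shows "integrable \<mu> (\<lambda>\<omega>. \<integral>x. g x \<partial>config_measure \<omega>)"
    and "(\<integral>\<omega>. (\<integral>x. g x \<partial>config_measure \<omega>) * exp (- (\<integral>x. f x \<partial>config_measure \<omega>)) \<partial>\<mu>) =
      (\<integral>x. g x * exp (- f x) \<partial>\<pi>) * (\<integral>\<omega>. exp (- (\<integral>x. f x \<partial>config_measure \<omega>)) \<partial>\<mu>)"
proof -
  define S where "S f \<omega> = (\<integral>x. f x \<partial>config_measure \<omega>)" for f :: "'a \<Rightarrow> real" and \<omega>
  have Sm[measurable]: "S f \<in> borel_measurable \<mu>" if "f \<in> Cc X" for f
    unfolding S_def using integral_config_measurable[OF that] by simp
  have S0: "0 \<le> S f \<omega>" if "f \<in> Cc X" "\<And>x. 0 \<le> f x" "\<omega> \<in> configurations X" for f \<omega>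
    unfolding S_def using ennreal_integral_config_measure(2)[OF X] that by blast
  note [measurable] = Sm[OF g(1)]
  define \<epsilon> where "\<epsilon> n = inverse (real (Suc n))" for n
  have e: "\<epsilon> n > 0" "\<epsilon> n * real (Suc n) = 1" for n by (auto simp: \<epsilon>_def)
  \<comment> \<open>The negated difference quotient of \<open>exp (- S f \<omega>)\<close> in the
    direction \<open>g\<close> with step \<open>\<epsilon> n\<close>, factored so that it is visibly
    nonnegative and bounded by \<open>S g \<omega> * exp (- S f \<omega>)\<close>.\<close>
  define \<phi> where "\<phi> f n \<omega> = exp (- S f \<omega>) * ((1 - exp (- (S g \<omega> * \<epsilon> n))) * real (Suc n))" for f n \<omega>
  have ptw: "(\<lambda>n. \<phi> f n \<omega>) \<longlonglongrightarrow> S g \<omega> * exp (- S f \<omega>)" if "\<omega> \<in> configurations X" for \<omega> f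
  proof -
    have "(\<lambda>n. (1 - exp (- (S g \<omega> * \<epsilon> n))) * real (Suc n)) \<longlonglongrightarrow> S g \<omega>"
      by (rule one_minus_exp_scaled_tendsto)
        (use S0[OF g that] e in \<open>auto simp: mult.assoc less_imp_le simp del: of_nat_Suc\<close>)
    then have "(\<lambda>n. \<phi> f n \<omega>) \<longlonglongrightarrow> exp (- S f \<omega>) * S g \<omega>"
      unfolding \<phi>_def by (intro tendsto_mult tendsto_const)
    then show ?thesis by (simp add: mult.commute)
  qed
  have \<phi>0: "0 \<le> \<phi> f n \<omega>" and \<phi>S: "\<phi> f n \<omega> \<le> S g \<omega> * exp (- S f \<omega>)"
    if "\<omega> \<in> configurations X" for f n \<omega>
  proof -
    have y: "0 \<le> S g \<omega> * \<epsilon> n" using S0[OF g that] e(1)[of n] by simp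
    then show "0 \<le> \<phi> f n \<omega>" by (simp add: \<phi>_def)
    have "(1 - exp (- (S g \<omega> * \<epsilon> n))) * real (Suc n) \<le> (S g \<omega> * \<epsilon> n) * real (Suc n)"
      by (intro mult_right_mono one_minus_exp_le) simp
    also have "\<dots> = S g \<omega>" using e(2)[of n] by (simp add: mult.assoc del: of_nat_Suc)
    finally show "\<phi> f n \<omega> \<le> S g \<omega> * exp (- S f \<omega>)"
      unfolding \<phi>_def by (subst mult.commute) (intro mult_right_mono, auto)
  qed
  have lim: "(\<lambda>n. \<integral>\<omega>. \<phi> f n \<omega> \<partial>\<mu>) \<longlonglongrightarrow> (\<integral>x. g x * exp (- f x) \<partial>\<pi>) * (\<integral>\<omega>. exp (- S f \<omega>) \<partial>\<mu>)"
    and int\<phi>: "\<And>n. integrable \<mu> (\<phi> f n)"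
    if f: "f \<in> Cc X" "\<And>x. 0 \<le> f x" for f
  proof -
    note [measurable] = Sm[OF f(1)]
    have exp_int: "integrable \<mu> (\<lambda>\<omega>. exp (- S f \<omega>))" if "f \<in> Cc X" "\<And>x. 0 \<le> f x" for f
      by (rule integrable_const_bound[where B=1]) (use S0[OF that] Sm[OF that(1)] in auto)
    define F where "F n x = f x + \<epsilon> n * g x" for n x
    have F: "F n \<in> Cc X" "\<And>x. 0 \<le> F n x" for n
      unfolding F_def using Cc_add[OF f(1) Cc_scale[OF g(1)]] f(2) g(2) e(1)[of n] by (auto simp: less_imp_le)
    have SF: "S (F n) \<omega> = S f \<omega> + S g \<omega> * \<epsilon> n" if "\<omega> \<in> configurations X" for n \<omega>
      unfolding F_def S_def using integral_config_measure_add[OF X f(1) Cc_scale[OF g(1)] that] by simp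
    have \<phi>eq: "\<phi> f n \<omega> = (exp (- S f \<omega>) - exp (- S (F n) \<omega>)) * real (Suc n)" if "\<omega> \<in> configurations X" for n \<omega>
      unfolding \<phi>_def SF[OF that] by (simp add: algebra_simps exp_diff exp_minus exp_add divide_inverse)
    show "integrable \<mu> (\<phi> f n)" for n
      using exp_int[OF f] exp_int[OF F]
      by (subst Bochner_Integration.integrable_cong[OF refl \<phi>eq]) auto
    define a where "a = (\<integral>x. (1 - exp (- f x)) \<partial>\<pi>)"
    \<comment> \<open>The exponent of the Laplace functional at \<open>F n\<close> splits as
      \<open>a + b n\<close>; the increment \<open>b n\<close> is of order
      \<open>\<epsilon> n\<close> and carries the derivative.\<close>
    define b where "b n = (\<integral>x. exp (- f x) * (1 - exp (- (g x * \<epsilon> n))) \<partial>\<pi>)" for n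
    have [measurable]: "f \<in> borel_measurable \<pi>" "g \<in> borel_measurable \<pi>"
      using Cc_measurable_\<pi> f g by auto
    have i1: "integrable \<pi> (\<lambda>x. 1 - exp (- f x))"
      by (rule Bochner_Integration.integrable_bound[OF Cc_integrable_\<pi>[OF f(1)]]) (use f(2) one_minus_exp_le in auto)
    have gb: "\<bar>exp (- f x) * (1 - exp (- (g x * \<epsilon> n)))\<bar> \<le> g x * \<epsilon> n" for x n
    proof -
      have "0 \<le> g x * \<epsilon> n" using g(2)[of x] e(1)[of n] by simp
      then have "\<bar>1 - exp (- (g x * \<epsilon> n))\<bar> \<le> g x * \<epsilon> n" using one_minus_exp_le by auto
      then have "exp (- f x) * \<bar>1 - exp (- (g x * \<epsilon> n))\<bar> \<le> 1 * (g x * \<epsilon> n)"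
        using f(2) by (intro mult_mono) auto
      then show ?thesis by (simp add: abs_mult)
    qed
    have i2: "integrable \<pi> (\<lambda>x. exp (- f x) * (1 - exp (- (g x * \<epsilon> n))))" for n
    proof (rule Bochner_Integration.integrable_bound)
      show "integrable \<pi> (\<lambda>x. g x * \<epsilon> n)" using Cc_integrable_\<pi>[OF g(1)] by simp
      show "AE x in \<pi>. norm (exp (- f x) * (1 - exp (- (g x * \<epsilon> n)))) \<le> norm (g x * \<epsilon> n)"
        using gb[of _ n] by (auto intro: order_trans[OF gb abs_ge_self])
    qed measurable
    have b0: "0 \<le> b n" for n
      unfolding b_def using g(2) e(1)[of n] by (intro integral_nonneg_AE) (auto simp: less_imp_le)
    have eF: "(\<integral>\<omega>. exp (- S (F n) \<omega>) \<partial>\<mu>) = exp (- a) * exp (- b n)" for n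
    proof -
      have "(\<integral>x. (1 - exp (- F n x)) \<partial>\<pi>) = (\<integral>x. (1 - exp (- f x)) + exp (- f x) * (1 - exp (- (g x * \<epsilon> n))) \<partial>\<pi>)"
        by (intro Bochner_Integration.integral_cong refl)
          (simp add: F_def exp_add exp_minus exp_diff algebra_simps divide_inverse)
      also have "\<dots> = a + b n" unfolding a_def b_def by (rule Bochner_Integration.integral_add[OF i1 i2])
      finally show ?thesis
        using laplace_functional[OF F(1), of n] by (simp add: S_def exp_add exp_minus exp_diff divide_inverse)
    qed
    have ef: "(\<integral>\<omega>. exp (- S f \<omega>) \<partial>\<mu>) = exp (- a)"
      using laplace_functional[OF f(1)] by (simp add: S_def a_def)
    have \<phi>int: "(\<integral>\<omega>. \<phi> f n \<omega> \<partial>\<mu>) = exp (- a) * ((1 - exp (- b n)) * real (Suc n))" for n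
    proof -
      have "(\<integral>\<omega>. \<phi> f n \<omega> \<partial>\<mu>) = (\<integral>\<omega>. (exp (- S f \<omega>) - exp (- S (F n) \<omega>)) * real (Suc n) \<partial>\<mu>)"
        by (intro Bochner_Integration.integral_cong refl \<phi>eq) simp
      also have "\<dots> = (exp (- a) - exp (- a) * exp (- b n)) * real (Suc n)"
        using exp_int[OF f] exp_int[OF F] by (simp add: ef eF del: of_nat_Suc)
      finally show ?thesis by (simp add: algebra_simps)
    qed
    have "(\<lambda>n. b n * real (Suc n)) \<longlonglongrightarrow> (\<integral>x. g x * exp (- f x) \<partial>\<pi>)"
    proof -
      have "(\<lambda>n. \<integral>x. exp (- f x) * (1 - exp (- (g x * \<epsilon> n))) * real (Suc n) \<partial>\<pi>) \<longlonglongrightarrow> (\<integral>x. g x * exp (- f x) \<partial>\<pi>)"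
      proof (rule integral_dominated_convergence[where w=g])
        show "integrable \<pi> g" by (rule Cc_integrable_\<pi>[OF g(1)])
        show "AE x in \<pi>. (\<lambda>n. exp (- f x) * (1 - exp (- (g x * \<epsilon> n))) * real (Suc n)) \<longlonglongrightarrow> g x * exp (- f x)"
        proof (rule AE_I2)
          fix x
          have "(\<lambda>n. (1 - exp (- (g x * \<epsilon> n))) * real (Suc n)) \<longlonglongrightarrow> g x"
            by (rule one_minus_exp_scaled_tendsto)
              (use g(2) e in \<open>auto simp: mult.assoc less_imp_le simp del: of_nat_Suc\<close>)
          then have "(\<lambda>n. exp (- f x) * ((1 - exp (- (g x * \<epsilon> n))) * real (Suc n))) \<longlonglongrightarrow> exp (- f x) * g x"
            by (intro tendsto_mult tendsto_const)
          then show "(\<lambda>n. exp (- f x) * (1 - exp (- (g x * \<epsilon> n))) * real (Suc n)) \<longlonglongrightarrow> g x * exp (- f x)"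
            by (simp add: mult.assoc mult.commute[of "g x"])
        qed
        show "AE x in \<pi>. norm (exp (- f x) * (1 - exp (- (g x * \<epsilon> n))) * real (Suc n)) \<le> g x" for n
        proof (rule AE_I2)
          fix x
          have "\<bar>exp (- f x) * (1 - exp (- (g x * \<epsilon> n)))\<bar> * real (Suc n) \<le> (g x * \<epsilon> n) * real (Suc n)"
            using gb by (intro mult_right_mono) auto
          also have "\<dots> = g x" using e(2)[of n] by (simp add: mult.assoc del: of_nat_Suc)
          finally show "norm (exp (- f x) * (1 - exp (- (g x * \<epsilon> n))) * real (Suc n)) \<le> g x"
            by (simp add: abs_mult)
        qed
      qed measurable
      then show ?thesis unfolding b_def by simp
    qed
    then have "(\<lambda>n. (1 - exp (- b n)) * real (Suc n)) \<longlonglongrightarrow> (\<integral>x. g x * exp (- f x) \<partial>\<pi>)"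
      by (rule one_minus_exp_scaled_tendsto[OF b0])
    then show "(\<lambda>n. \<integral>\<omega>. \<phi> f n \<omega> \<partial>\<mu>) \<longlonglongrightarrow> (\<integral>x. g x * exp (- f x) \<partial>\<pi>) * (\<integral>\<omega>. exp (- S f \<omega>) \<partial>\<mu>)"
      unfolding \<phi>int ef by (subst mult.commute) (intro tendsto_mult tendsto_const)
  qed
  \<comment> \<open>Dominated convergence needs \<open>S g\<close> as an integrable bound. Fatou's
    lemma at \<open>f = 0\<close>, where the limit of the means has just been computed, supplies its
    finite mean.\<close>
  have Sint: "integrable \<mu> (S g)"
  proof (rule integrableI_bounded)
    let ?z = "\<lambda>_::'a. 0::real"
    have z: "?z \<in> Cc X" "\<And>x. 0 \<le> ?z x" by (auto simp: Cc_zero)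
    have Sz: "S ?z \<omega> = 0" for \<omega> by (simp add: S_def)
    have "(\<integral>\<^sup>+\<omega>. ennreal (norm (S g \<omega>)) \<partial>\<mu>) = (\<integral>\<^sup>+\<omega>. liminf (\<lambda>n. ennreal (\<phi> ?z n \<omega>)) \<partial>\<mu>)"
    proof (rule nn_integral_cong)
      fix \<omega> assume "\<omega> \<in> space \<mu>"
      then have \<omega>: "\<omega> \<in> configurations X" by simp
      have "(\<lambda>n. ennreal (\<phi> ?z n \<omega>)) \<longlonglongrightarrow> ennreal (S g \<omega> * exp (- S ?z \<omega>))"
        by (intro tendsto_ennrealI ptw[OF \<omega>])
      then show "ennreal (norm (S g \<omega>)) = liminf (\<lambda>n. ennreal (\<phi> ?z n \<omega>))"
        using S0[OF g \<omega>] by (simp add: Sz lim_imp_Liminf)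
    qed
    also have "\<dots> \<le> liminf (\<lambda>n. \<integral>\<^sup>+\<omega>. ennreal (\<phi> ?z n \<omega>) \<partial>\<mu>)"
      using borel_measurable_integrable[OF int\<phi>[OF z]] by (intro nn_integral_liminf) simp
    also have "\<dots> = liminf (\<lambda>n. ennreal (\<integral>\<omega>. \<phi> ?z n \<omega> \<partial>\<mu>))"
      using int\<phi>[OF z] \<phi>0 by (intro arg_cong[where f=liminf] ext nn_integral_eq_integral) auto
    also have "\<dots> = ennreal ((\<integral>x. g x * exp (- ?z x) \<partial>\<pi>) * (\<integral>\<omega>. exp (- S ?z \<omega>) \<partial>\<mu>))"
      by (intro lim_imp_Liminf tendsto_ennrealI lim[OF z]) simp
    finally show "(\<integral>\<^sup>+\<omega>. ennreal (norm (S g \<omega>)) \<partial>\<mu>) < \<infinity>" by (rule le_less_trans) simp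
  qed measurable
  then show "integrable \<mu> (\<lambda>\<omega>. \<integral>x. g x \<partial>config_measure \<omega>)" by (simp add: S_def[abs_def])
  note [measurable] = Sm[OF f(1)] borel_measurable_integrable[OF int\<phi>[OF f]]
  have "(\<lambda>n. \<integral>\<omega>. \<phi> f n \<omega> \<partial>\<mu>) \<longlonglongrightarrow> (\<integral>\<omega>. S g \<omega> * exp (- S f \<omega>) \<partial>\<mu>)"
  proof (rule integral_dominated_convergence[where w="S g"])
    show "AE \<omega> in \<mu>. norm (\<phi> f n \<omega>) \<le> S g \<omega>" for n
    proof (rule AE_I2)
      fix \<omega> assume "\<omega> \<in> space \<mu>"
      then have \<omega>: "\<omega> \<in> configurations X" by simp
      have "S g \<omega> * exp (- S f \<omega>) \<le> S g \<omega> * 1"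
        using S0[OF g \<omega>] S0[OF f \<omega>] by (intro mult_left_mono) auto
      then show "norm (\<phi> f n \<omega>) \<le> S g \<omega>" using \<phi>0[OF \<omega>, of f n] \<phi>S[OF \<omega>, of f n] by simp
    qed
  qed (use Sint ptw in auto)
  then show "(\<integral>\<omega>. (\<integral>x. g x \<partial>config_measure \<omega>) * exp (- (\<integral>x. f x \<partial>config_measure \<omega>)) \<partial>\<mu>) =
      (\<integral>x. g x * exp (- f x) \<partial>\<pi>) * (\<integral>\<omega>. exp (- (\<integral>x. f x \<partial>config_measure \<omega>)) \<partial>\<mu>)"
    using lim[OF f] LIMSEQ_unique unfolding S_def by blast
qed

lemma emeasure_configurations[simp]: "emeasure \<mu> (configurations X) = 1"
  using emeasure_space_1 by simp

lemma insert_measurable[measurable]: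
  "(\<lambda>p. insert (fst p) (snd p)) \<in> measurable (\<pi> \<Otimes>\<^sub>M \<mu>) \<mu>"
  using config_insert_measurable[OF X]
  by (simp cong: measurable_cong_sets add: sets_pair_measure_cong[OF sets_\<pi> sets_\<mu>] sets_\<mu>)

lemma nn_integral_points_measurable:
  assumes "T \<in> measurable M \<mu>" "F \<in> borel_measurable (M \<Otimes>\<^sub>M \<pi>)"
  shows "(\<lambda>n. \<integral>\<^sup>+x. F (n, x) \<partial>count_space (T n)) \<in> borel_measurable M"
  using assms
  by (intro nn_integral_count_space_measurable[OF X])
    (simp_all cong: measurable_cong_sets add: sets_\<mu> sets_pair_measure_cong[OF refl sets_\<pi>])

lemma AE_notin_\<pi>:
  assumes "\<omega> \<in> configurations X"
  shows "AE x in \<pi>. x \<notin> \<omega>"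
proof (rule AE_discrete_difference)
  show "countable \<omega>" by (rule configurations_countable[OF X assms])
  show "{x} \<in> sets \<pi>" if "x \<in> \<omega>" for x
    using that assms by (auto simp: sets_\<pi> sets_restrict_space configurations_def intro!: image_eqI[of _ _ "{x}"])
qed (rule diffuse_\<pi>)

text \<open>A countable configuration is null for a diffuse measure; Fubini's theorem makes this a
  statement on pairs, so that insertion can be treated as adding a point.\<close>

lemma AE_pair_notin: "AE p in \<pi> \<Otimes>\<^sub>M \<mu>. fst p \<notin> snd p"
proof -
  have [measurable]: "Measurable.pred (\<pi> \<Otimes>\<^sub>M \<mu>) (\<lambda>p. fst p \<in> snd p)"
    using config_mem_measurable[OF X]
    by (simp cong: measurable_cong_sets add: sets_pair_measure_cong[OF sets_\<pi> sets_\<mu>])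
  have "AE \<omega> in \<mu>. AE x in \<pi>. x \<notin> \<omega>" by (rule AE_I2) (simp add: AE_notin_\<pi>)
  then have "AE x in \<pi>. AE \<omega> in \<mu>. x \<notin> \<omega>"
    by (subst P.AE_commute) (auto simp: case_prod_beta)
  then show ?thesis by (intro P.AE_pair_measure) auto
qed

text \<open>For fixed \<open>g\<close> both sides are measures in \<open>A\<close> with the same Laplace functional.\<close>

lemma mecke_Cc_set:
  assumes g: "g \<in> Cc X" "\<And>x. 0 \<le> g x" and A: "A \<in> sets \<mu>"
  shows "(\<integral>\<^sup>+\<omega>. indicator A \<omega> * (\<integral>\<^sup>+x. ennreal (g x) \<partial>count_space \<omega>) \<partial>\<mu>) =
    (\<integral>\<^sup>+x. \<integral>\<^sup>+\<omega>. ennreal (g x) * indicator A (insert x \<omega>) \<partial>\<mu> \<partial>\<pi>)"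
proof -
  define S where "S f \<omega> = (\<integral>x. f x \<partial>config_measure \<omega>)" for f :: "'a \<Rightarrow> real" and \<omega>
  have Sm[measurable]: "S f \<in> borel_measurable \<mu>" if "f \<in> Cc X" for f
    unfolding S_def using integral_config_measurable[OF that] by simp
  have S0: "0 \<le> S f \<omega>" and Snn: "ennreal (S f \<omega>) = (\<integral>\<^sup>+x. ennreal (f x) \<partial>count_space \<omega>)"
    if "f \<in> Cc X" "\<And>x. 0 \<le> f x" "\<omega> \<in> configurations X" for f \<omega>
    unfolding S_def using ennreal_integral_config_measure[OF X] that by blast+
  have Sins: "S f (insert x \<omega>) = f x + S f \<omega>"
    if f: "f \<in> Cc X" "\<And>x. 0 \<le> f x" and \<omega>: "\<omega> \<in> configurations X" "x \<in> X" "x \<notin> \<omega>" for f \<omega> x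
  proof -
    have "ennreal (S f (insert x \<omega>)) = ennreal (f x + S f \<omega>)"
      using Snn[OF f configurations_insert[OF \<omega>(1,2)]] Snn[OF f \<omega>(1)] S0[OF f \<omega>(1)] f(2)[of x]
      by (simp add: nn_integral_count_space_insert[OF \<omega>(3)])
    then show ?thesis
      using S0[OF f \<omega>(1)] f(2)[of x] S0[OF f configurations_insert[OF \<omega>(1,2)]]
      by (subst (asm) ennreal_inj) auto
  qed
  have [measurable]: "g \<in> borel_measurable \<pi>" "S g \<in> borel_measurable \<mu>"
    using Cc_measurable_\<pi>[OF g(1)] Sm[OF g(1)] by auto
  \<comment> \<open>\<open>Q1\<close> reweights \<open>\<mu>\<close> by the sum of \<open>g\<close>
    over the points; \<open>Q2\<close> is the image under insertion of the product measure weighted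
    by \<open>g\<close>. Both are finite because \<open>g\<close> is integrable.\<close>
  define Q1 where "Q1 = density \<mu> (\<lambda>\<omega>. ennreal (S g \<omega>))"
  define D where "D = density (\<pi> \<Otimes>\<^sub>M \<mu>) (\<lambda>p. ennreal (g (fst p)))"
  define Q2 where "Q2 = distr D \<mu> (\<lambda>p. insert (fst p) (snd p))"
  have [measurable_cong]: "sets D = sets (\<pi> \<Otimes>\<^sub>M \<mu>)" by (simp add: D_def)
  have Q1e: "(\<integral>\<^sup>+\<omega>. F \<omega> \<partial>Q1) = (\<integral>\<^sup>+\<omega>. ennreal (S g \<omega>) * F \<omega> \<partial>\<mu>)" if [measurable]: "F \<in> borel_measurable \<mu>" for F
    unfolding Q1_def by (rule nn_integral_density) auto
  have Q2e: "(\<integral>\<^sup>+\<omega>. F \<omega> \<partial>Q2) = (\<integral>\<^sup>+x. \<integral>\<^sup>+\<omega>. ennreal (g x) * F (insert x \<omega>) \<partial>\<mu> \<partial>\<pi>)"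
    if [measurable]: "F \<in> borel_measurable \<mu>" for F
  proof -
    have "(\<integral>\<^sup>+\<omega>. F \<omega> \<partial>Q2) = (\<integral>\<^sup>+p. F (insert (fst p) (snd p)) \<partial>D)"
      unfolding Q2_def by (rule nn_integral_distr) auto
    also have "\<dots> = (\<integral>\<^sup>+p. ennreal (g (fst p)) * F (insert (fst p) (snd p)) \<partial>(\<pi> \<Otimes>\<^sub>M \<mu>))"
      unfolding D_def by (rule nn_integral_density) auto
    also have "\<dots> = (\<integral>\<^sup>+x. \<integral>\<^sup>+\<omega>. ennreal (g x) * F (insert x \<omega>) \<partial>\<mu> \<partial>\<pi>)"
      by (subst nn_integral_fst[symmetric]) auto
    finally show ?thesis .
  qed
  have fing: "(\<integral>\<^sup>+x. ennreal (g x) \<partial>\<pi>) < \<infinity>"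
    using Cc_integrable_\<pi>[OF g(1)] g(2) by (simp add: nn_integral_eq_integral)
  have "Q1 = Q2"
  proof (rule laplace_functional_unique[OF X])
    have "emeasure Q1 (space Q1) = (\<integral>\<^sup>+\<omega>. 1 \<partial>Q1)" by simp
    also have "\<dots> = (\<integral>\<^sup>+\<omega>. ennreal (S g \<omega>) \<partial>\<mu>)" by (subst Q1e) auto
    also have "\<dots> < \<infinity>"
      using mecke_Cc(1)[OF Cc_zero _ g] S0[OF g] by (subst nn_integral_eq_integral) (auto simp: S_def[abs_def])
    finally show "finite_measure Q1" by (auto intro: finite_measureI)
    have "emeasure Q2 (space Q2) = (\<integral>\<^sup>+\<omega>. 1 \<partial>Q2)" by simp
    also have "\<dots> = (\<integral>\<^sup>+x. ennreal (g x) \<partial>\<pi>)" by (subst Q2e) auto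
    also have "\<dots> < \<infinity>" by (rule fing)
    finally show "finite_measure Q2" by (auto intro: finite_measureI)
    show "sets Q1 = sets (config_borel X)" "sets Q2 = sets (config_borel X)"
      by (simp_all add: Q1_def Q2_def sets_\<mu>)
    fix f assume f: "f \<in> Cc X" "\<And>x. 0 \<le> f x"
    note [measurable] = Sm[OF f(1)] Cc_measurable_\<pi>[OF f(1)]
    have Em[measurable]: "(\<lambda>\<omega>. ennreal (exp (- S f \<omega>))) \<in> borel_measurable \<mu>" by measurable
    have E1: "(\<integral>\<^sup>+\<omega>. ennreal (exp (- S f \<omega>)) \<partial>\<mu>) = ennreal (\<integral>\<omega>. exp (- S f \<omega>) \<partial>\<mu>)"
      by (intro nn_integral_eq_integral integrable_const_bound[where B=1]) (use S0[OF f] in auto)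
    have "(\<integral>\<^sup>+\<omega>. ennreal (exp (- S f \<omega>)) \<partial>Q1) = (\<integral>\<^sup>+\<omega>. ennreal (S g \<omega> * exp (- S f \<omega>)) \<partial>\<mu>)"
      by (simp add: Q1e ennreal_mult'' )
    also have "\<dots> = ennreal (\<integral>\<omega>. S g \<omega> * exp (- S f \<omega>) \<partial>\<mu>)"
    proof (rule nn_integral_eq_integral)
      show "integrable \<mu> (\<lambda>\<omega>. S g \<omega> * exp (- S f \<omega>))"
      proof (rule Bochner_Integration.integrable_bound)
        show "integrable \<mu> (S g)" using mecke_Cc(1)[OF Cc_zero _ g] by (simp add: S_def[abs_def])
        show "AE \<omega> in \<mu>. norm (S g \<omega> * exp (- S f \<omega>)) \<le> norm (S g \<omega>)"
          using S0[OF f] by (intro AE_I2) (auto simp: abs_mult intro!: mult_left_le)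
      qed measurable
    qed (use S0[OF g] in auto)
    also have "\<dots> = ennreal ((\<integral>x. g x * exp (- f x) \<partial>\<pi>) * (\<integral>\<omega>. exp (- S f \<omega>) \<partial>\<mu>))"
      using mecke_Cc(2)[OF f g] by (simp add: S_def)
    also have "\<dots> = (\<integral>\<^sup>+x. ennreal (g x * exp (- f x)) \<partial>\<pi>) * (\<integral>\<^sup>+\<omega>. ennreal (exp (- S f \<omega>)) \<partial>\<mu>)"
    proof -
      have "integrable \<pi> (\<lambda>x. g x * exp (- f x))"
      proof (rule Bochner_Integration.integrable_bound)
        show "integrable \<pi> g" by (rule Cc_integrable_\<pi>[OF g(1)])
        show "AE x in \<pi>. norm (g x * exp (- f x)) \<le> norm (g x)"
          using f by (intro AE_I2) (auto simp: abs_mult intro!: mult_left_le)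
      qed measurable
      then have "(\<integral>\<^sup>+x. ennreal (g x * exp (- f x)) \<partial>\<pi>) = ennreal (\<integral>x. g x * exp (- f x) \<partial>\<pi>)"
        using g(2) by (intro nn_integral_eq_integral) auto
      then show ?thesis using g(2) by (simp add: E1 ennreal_mult integral_nonneg_AE)
    qed
    also have "\<dots> = (\<integral>\<^sup>+x. \<integral>\<^sup>+\<omega>. ennreal (g x * exp (- f x)) * ennreal (exp (- S f \<omega>)) \<partial>\<mu> \<partial>\<pi>)"
      by (simp add: nn_integral_cmult nn_integral_multc)
    also have "\<dots> = (\<integral>\<^sup>+p. ennreal (g (fst p) * exp (- f (fst p))) * ennreal (exp (- S f (snd p))) \<partial>(\<pi> \<Otimes>\<^sub>M \<mu>))"
      by (subst nn_integral_fst[symmetric]) auto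
    also have "\<dots> = (\<integral>\<^sup>+p. ennreal (g (fst p)) * ennreal (exp (- S f (insert (fst p) (snd p)))) \<partial>(\<pi> \<Otimes>\<^sub>M \<mu>))"
    proof (rule nn_integral_cong_AE)
      \<comment> \<open>Here diffuseness enters: a point outside the configuration contributes
        exactly one new factor \<open>exp (- f (fst p))\<close>.\<close>
      show "AE p in \<pi> \<Otimes>\<^sub>M \<mu>. ennreal (g (fst p) * exp (- f (fst p))) * ennreal (exp (- S f (snd p))) =
        ennreal (g (fst p)) * ennreal (exp (- S f (insert (fst p) (snd p))))"
        using AE_pair_notin AE_space
      proof eventually_elim
        case (elim p)
        then have "S f (insert (fst p) (snd p)) = f (fst p) + S f (snd p)"
          by (intro Sins[OF f]) (auto simp: space_pair_measure)
        then show ?case using g(2)[of "fst p"]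
          by (simp add: ennreal_mult[symmetric] exp_add exp_minus exp_diff field_simps)
      qed
    qed
    also have "\<dots> = (\<integral>\<^sup>+x. \<integral>\<^sup>+\<omega>. ennreal (g x) * ennreal (exp (- S f (insert x \<omega>))) \<partial>\<mu> \<partial>\<pi>)"
      by (subst nn_integral_fst[symmetric]) auto
    also have "\<dots> = (\<integral>\<^sup>+\<omega>. ennreal (exp (- S f \<omega>)) \<partial>Q2)" by (simp add: Q2e)
    finally have nn: "(\<integral>\<^sup>+\<omega>. ennreal (exp (- S f \<omega>)) \<partial>Q1) = (\<integral>\<^sup>+\<omega>. ennreal (exp (- S f \<omega>)) \<partial>Q2)" .
    have m: "(\<lambda>\<omega>. exp (- S f \<omega>)) \<in> borel_measurable Q1" "(\<lambda>\<omega>. exp (- S f \<omega>)) \<in> borel_measurable Q2"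
      unfolding Q1_def Q2_def by measurable
    show "(\<integral>\<omega>. exp (- (\<integral>x. f x \<partial>config_measure \<omega>)) \<partial>Q1) = (\<integral>\<omega>. exp (- (\<integral>x. f x \<partial>config_measure \<omega>)) \<partial>Q2)"
      using nn unfolding S_def[symmetric] by (simp add: integral_eq_nn_integral m)
  qed
  have [measurable]: "A \<in> sets \<mu>" by fact
  have "(\<integral>\<^sup>+\<omega>. indicator A \<omega> * (\<integral>\<^sup>+x. ennreal (g x) \<partial>count_space \<omega>) \<partial>\<mu>) = (\<integral>\<^sup>+\<omega>. ennreal (S g \<omega>) * indicator A \<omega> \<partial>\<mu>)"
    by (intro nn_integral_cong) (simp add: Snn[OF g] mult.commute)
  also have "\<dots> = (\<integral>\<^sup>+\<omega>. indicator A \<omega> \<partial>Q1)" by (subst Q1e) auto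
  also have "\<dots> = (\<integral>\<^sup>+\<omega>. indicator A \<omega> \<partial>Q2)" using \<open>Q1 = Q2\<close> by simp
  also have "\<dots> = (\<integral>\<^sup>+x. \<integral>\<^sup>+\<omega>. ennreal (g x) * indicator A (insert x \<omega>) \<partial>\<mu> \<partial>\<pi>)"
    by (rule Q2e) simp
  finally show ?thesis .
qed

lemma points_measurable:
  assumes [measurable]: "F \<in> borel_measurable (\<pi> \<Otimes>\<^sub>M \<mu>)"
  shows "(\<lambda>\<omega>. \<integral>\<^sup>+x. F (x, \<omega>) \<partial>count_space \<omega>) \<in> borel_measurable \<mu>"
proof -
  have "(\<lambda>p. F (snd p, fst p)) \<in> borel_measurable (\<mu> \<Otimes>\<^sub>M \<pi>)" by measurable
  from nn_integral_points_measurable[OF measurable_ident this] show ?thesis by simp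
qed

text \<open>Functions in \<open>Cc X\<close> increase to the indicator of \<open>U\<close>, and both
  sides pass to the limit by monotone convergence.\<close>

lemma mecke_open_set:
  assumes U: "open U" "bounded U" and A[measurable]: "A \<in> sets \<mu>"
  shows "(\<integral>\<^sup>+\<omega>. \<integral>\<^sup>+x. indicator U x * indicator A \<omega> \<partial>count_space \<omega> \<partial>\<mu>) =
    (\<integral>\<^sup>+x. \<integral>\<^sup>+\<omega>. indicator U x * indicator A (insert x \<omega>) \<partial>\<mu> \<partial>\<pi>)"
proof -
  obtain f :: "nat \<Rightarrow> 'a \<Rightarrow> real" where f: "\<And>j. f j \<in> Cc X" "\<And>j x. 0 \<le> f j x"
    "\<And>x. incseq (\<lambda>j. f j x)" "\<And>x. x \<in> X \<Longrightarrow> (\<lambda>j. f j x) \<longlonglongrightarrow> indicator U x"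
    using Cc_approx_open[OF X U] by metis
  note [measurable] = Cc_measurable_\<pi>[OF f(1)]
  have [measurable]: "(\<lambda>x. indicator U x :: ennreal) \<in> borel_measurable \<pi>"
    using U by (intro borel_measurable_\<pi>) auto
  have sup: "indicator U x = (SUP j. ennreal (f j x))" if "x \<in> X" for x
  proof (rule LIMSEQ_unique)
    have "incseq (\<lambda>j. ennreal (f j x))" using f(3)[of x] by (auto simp: incseq_def intro!: ennreal_leI)
    then show "(\<lambda>j. ennreal (f j x)) \<longlonglongrightarrow> (SUP j. ennreal (f j x))" by (rule LIMSEQ_SUP)
    show "(\<lambda>j. ennreal (f j x)) \<longlonglongrightarrow> indicator U x"
      using tendsto_ennrealI[OF f(4)[OF that]] by (simp add: ennreal_indicator)
  qed
  have inc: "incseq (\<lambda>j. ennreal (f j x))" for x using f(3)[of x] by (auto simp: incseq_def intro!: ennreal_leI)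
  have mono: "ennreal (f j x) * c \<le> ennreal (f j' x) * c" if "j \<le> j'" for j j' x c
    using inc[of x] that by (auto simp: incseq_def intro!: mult_right_mono)
  have [measurable]: "(\<lambda>\<omega>. \<integral>\<^sup>+x. ennreal (f j x) \<partial>count_space \<omega>) \<in> borel_measurable \<mu>" for j
    using points_measurable[of "\<lambda>p. ennreal (f j (fst p))"] by simp
  have "(\<integral>\<^sup>+\<omega>. \<integral>\<^sup>+x. indicator U x * indicator A \<omega> \<partial>count_space \<omega> \<partial>\<mu>) =
    (\<integral>\<^sup>+\<omega>. (SUP j. indicator A \<omega> * (\<integral>\<^sup>+x. ennreal (f j x) \<partial>count_space \<omega>)) \<partial>\<mu>)"
  proof (rule nn_integral_cong)
    fix \<omega> assume \<omega>: "\<omega> \<in> space \<mu>"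
    have "(\<integral>\<^sup>+x. indicator U x * indicator A \<omega> \<partial>count_space \<omega>) =
      (\<integral>\<^sup>+x. (SUP j. ennreal (f j x) * indicator A \<omega>) \<partial>count_space \<omega>)"
      using \<omega> by (intro nn_integral_cong) (auto simp: sup configurations_def subset_iff SUP_mult_right_ennreal)
    also have "\<dots> = (SUP j. \<integral>\<^sup>+x. ennreal (f j x) * indicator A \<omega> \<partial>count_space \<omega>)"
      by (rule nn_integral_monotone_convergence_SUP) (auto simp: incseq_def le_fun_def intro!: mono)
    also have "\<dots> = (SUP j. indicator A \<omega> * (\<integral>\<^sup>+x. ennreal (f j x) \<partial>count_space \<omega>))"
      by (intro SUP_cong refl, subst nn_integral_multc) (auto simp: mult.commute)
    finally show "(\<integral>\<^sup>+x. indicator U x * indicator A \<omega> \<partial>count_space \<omega>) =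
      (SUP j. indicator A \<omega> * (\<integral>\<^sup>+x. ennreal (f j x) \<partial>count_space \<omega>))" .
  qed
  also have "\<dots> = (SUP j. \<integral>\<^sup>+\<omega>. indicator A \<omega> * (\<integral>\<^sup>+x. ennreal (f j x) \<partial>count_space \<omega>) \<partial>\<mu>)"
    by (rule nn_integral_monotone_convergence_SUP)
      (use inc in \<open>auto simp: incseq_def le_fun_def intro!: mult_left_mono nn_integral_mono\<close>)
  also have "\<dots> = (SUP j. \<integral>\<^sup>+x. \<integral>\<^sup>+\<omega>. ennreal (f j x) * indicator A (insert x \<omega>) \<partial>\<mu> \<partial>\<pi>)"
    using mecke_Cc_set[OF f(1,2) A] by simp
  also have "\<dots> = (SUP j. \<integral>\<^sup>+p. ennreal (f j (fst p)) * indicator A (insert (fst p) (snd p)) \<partial>(\<pi> \<Otimes>\<^sub>M \<mu>))"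
    by (subst nn_integral_fst[symmetric]) auto
  also have "\<dots> = (\<integral>\<^sup>+p. (SUP j. ennreal (f j (fst p)) * indicator A (insert (fst p) (snd p))) \<partial>(\<pi> \<Otimes>\<^sub>M \<mu>))"
    by (rule nn_integral_monotone_convergence_SUP[symmetric]) (auto simp: incseq_def le_fun_def intro!: mono)
  also have "\<dots> = (\<integral>\<^sup>+p. indicator U (fst p) * indicator A (insert (fst p) (snd p)) \<partial>(\<pi> \<Otimes>\<^sub>M \<mu>))"
    by (intro nn_integral_cong) (auto simp: space_pair_measure sup SUP_mult_right_ennreal)
  also have "\<dots> = (\<integral>\<^sup>+x. \<integral>\<^sup>+\<omega>. indicator U x * indicator A (insert x \<omega>) \<partial>\<mu> \<partial>\<pi>)"
    by (subst nn_integral_fst[symmetric]) auto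
  finally show ?thesis .
qed

text \<open>The two sides integrate \<open>F\<close> against the Campbell measure of
  \<open>\<mu>\<close> and against the image of \<open>\<pi> \<Otimes>\<^sub>M \<mu>\<close> under
  insertion. These agree on rectangles over bounded open sets, which generate and have finite mass,
  hence everywhere.\<close>

theorem mecke:
  assumes F: "F \<in> borel_measurable (\<pi> \<Otimes>\<^sub>M \<mu>)"
  shows "(\<integral>\<^sup>+\<omega>. \<integral>\<^sup>+x. F (x, \<omega>) \<partial>count_space \<omega> \<partial>\<mu>) = (\<integral>\<^sup>+x. \<integral>\<^sup>+\<omega>. F (x, insert x \<omega>) \<partial>\<mu> \<partial>\<pi>)"
proof -
  define C2 where "C2 = distr (\<pi> \<Otimes>\<^sub>M \<mu>) (\<pi> \<Otimes>\<^sub>M \<mu>) (\<lambda>p. (fst p, insert (fst p) (snd p)))"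
  have C2e: "(\<integral>\<^sup>+p. F p \<partial>C2) = (\<integral>\<^sup>+x. \<integral>\<^sup>+\<omega>. F (x, insert x \<omega>) \<partial>\<mu> \<partial>\<pi>)"
    if [measurable]: "F \<in> borel_measurable (\<pi> \<Otimes>\<^sub>M \<mu>)" for F
    unfolding C2_def by (subst nn_integral_distr) (auto simp: nn_integral_fst[symmetric])
  define c1 where "c1 Q = (\<integral>\<^sup>+\<omega>. \<integral>\<^sup>+x. indicator Q (x, \<omega>) \<partial>count_space \<omega> \<partial>\<mu>)" for Q
  \<comment> \<open>The Campbell measure is built from its values, being a mean of sums over a
    random set; countable additivity is what has to be checked.\<close>
  define C1 where "C1 = measure_of (space (\<pi> \<Otimes>\<^sub>M \<mu>)) (sets (\<pi> \<Otimes>\<^sub>M \<mu>)) c1"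
  have sC1: "sets C1 = sets (\<pi> \<Otimes>\<^sub>M \<mu>)"
    unfolding C1_def by simp
  have C1e: "emeasure C1 Q = c1 Q" if Q: "Q \<in> sets (\<pi> \<Otimes>\<^sub>M \<mu>)" for Q
    unfolding C1_def
  proof (rule emeasure_measure_of_sigma)
    show "countably_additive (sets (\<pi> \<Otimes>\<^sub>M \<mu>)) c1"
    proof (rule countably_additiveI)
      fix B :: "nat \<Rightarrow> ('a \<times> 'a set) set"
      assume B: "range B \<subseteq> sets (\<pi> \<Otimes>\<^sub>M \<mu>)" "disjoint_family B"
      have [measurable]: "B i \<in> sets (\<pi> \<Otimes>\<^sub>M \<mu>)" for i using B by auto
      have "c1 (\<Union>i. B i) = (\<integral>\<^sup>+\<omega>. \<integral>\<^sup>+x. (\<Sum>i. indicator (B i) (x, \<omega>)) \<partial>count_space \<omega> \<partial>\<mu>)"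
        unfolding c1_def using B(2) by (simp add: suminf_indicator)
      also have "\<dots> = (\<integral>\<^sup>+\<omega>. (\<Sum>i. \<integral>\<^sup>+x. indicator (B i) (x, \<omega>) \<partial>count_space \<omega>) \<partial>\<mu>)"
        by (intro nn_integral_cong nn_integral_suminf) simp
      also have "\<dots> = (\<Sum>i. c1 (B i))"
        unfolding c1_def by (intro nn_integral_suminf points_measurable) simp
      finally show "(\<Sum>i. c1 (B i)) = c1 (\<Union>i. B i)" ..
    qed
  qed (use Q in \<open>auto simp: positive_def c1_def sets.sigma_algebra_axioms\<close>)
  define Eb where "Eb = {U \<inter> X |U. open U \<and> bounded U}"
  have "C1 = C2"
  proof (rule measure_eqI_generator_eq[where \<Omega>="X \<times> configurations X" and
        E="{a \<times> b |a b. a \<in> Eb \<and> b \<in> sets \<mu>}" and A="\<lambda>k. (ball 0 (real k) \<inter> X) \<times> configurations X"])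
    note whole = UN_ball_Int[of X]
    show "Int_stable {a \<times> b |a b. a \<in> Eb \<and> b \<in> sets \<mu>}"
    proof (rule Int_stableI, clarsimp)
      fix a a' b b' assume "a \<in> Eb" "a' \<in> Eb" "b \<in> sets \<mu>" "b' \<in> sets \<mu>"
      then obtain U U' where "a = U \<inter> X" "a' = U' \<inter> X" "open U" "open U'" "bounded U" by (auto simp: Eb_def)
      then have "a \<inter> a' \<in> Eb" unfolding Eb_def by (intro CollectI exI[of _ "U \<inter> U'"]) auto
      then show "\<exists>c d. a \<times> b \<inter> a' \<times> b' = c \<times> d \<and> c \<in> Eb \<and> d \<in> sets \<mu>"
        using \<open>b \<in> sets \<mu>\<close> \<open>b' \<in> sets \<mu>\<close> by (intro exI[of _ "a \<inter> a'"] exI[of _ "b \<inter> b'"]) auto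
    qed
    show sub: "{a \<times> b |a b. a \<in> Eb \<and> b \<in> sets \<mu>} \<subseteq> Pow (X \<times> configurations X)"
      using sets.sets_into_space[of _ \<mu>] by (auto simp: Eb_def)
    have sX: "sets \<pi> = sigma_sets (space \<pi>) Eb"
      unfolding sets_\<pi> space_\<pi> Eb_def by (rule sets_restrict_borel_bounded[OF X])
    have "sets (\<pi> \<Otimes>\<^sub>M \<mu>) = sets (sigma (space \<pi> \<times> space \<mu>) {a \<times> b |a b. a \<in> Eb \<and> b \<in> sets \<mu>})"
    proof (rule sets_pair_eq)
      show "range (\<lambda>k. ball 0 (real k) \<inter> X) \<subseteq> Eb" by (auto simp: Eb_def)
      show "{space \<mu>} \<subseteq> sets \<mu>" using sets.top[of \<mu>] by simp
      show "sets \<mu> = sigma_sets (space \<mu>) (sets \<mu>)" by (simp only: sets.sigma_sets_eq)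
      show "sets \<mu> \<subseteq> Pow (space \<mu>)" by (rule sets.space_closed)
    qed (use sX whole in \<open>auto simp: Eb_def\<close>)
    then have s: "sets (\<pi> \<Otimes>\<^sub>M \<mu>) = sigma_sets (X \<times> configurations X) {a \<times> b |a b. a \<in> Eb \<and> b \<in> sets \<mu>}"
      using sub by (simp add: sets_measure_of)
    show "sets C1 = sigma_sets (X \<times> configurations X) {a \<times> b |a b. a \<in> Eb \<and> b \<in> sets \<mu>}"
      "sets C2 = sigma_sets (X \<times> configurations X) {a \<times> b |a b. a \<in> Eb \<and> b \<in> sets \<mu>}"
      using s sC1 by (simp_all add: C2_def)
    have rect: "emeasure C1 ((U \<inter> X) \<times> A) = emeasure C2 ((U \<inter> X) \<times> A) \<and>
        emeasure C2 ((U \<inter> X) \<times> A) \<le> emeasure \<pi> (U \<inter> X)"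
      if U: "open U" "bounded U" and A[measurable]: "A \<in> sets \<mu>" for U A
    proof -
      have UX[measurable]: "U \<inter> X \<in> sets \<pi>" using U(1) by (auto simp: sets_\<pi> sets_restrict_space)
      have m[measurable]: "(U \<inter> X) \<times> A \<in> sets (\<pi> \<Otimes>\<^sub>M \<mu>)" by measurable
      have "emeasure C1 ((U \<inter> X) \<times> A) = (\<integral>\<^sup>+\<omega>. \<integral>\<^sup>+x. indicator U x * indicator A \<omega> \<partial>count_space \<omega> \<partial>\<mu>)"
        unfolding C1e[OF m] c1_def
        by (intro nn_integral_cong) (auto simp: configurations_def split: split_indicator)
      also have "\<dots> = (\<integral>\<^sup>+x. \<integral>\<^sup>+\<omega>. indicator U x * indicator A (insert x \<omega>) \<partial>\<mu> \<partial>\<pi>)"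
        by (rule mecke_open_set[OF U A])
      also have "\<dots> = (\<integral>\<^sup>+x. \<integral>\<^sup>+\<omega>. indicator ((U \<inter> X) \<times> A) (x, insert x \<omega>) \<partial>\<mu> \<partial>\<pi>)"
        by (intro nn_integral_cong) (auto split: split_indicator)
      also have c2: "\<dots> = emeasure C2 ((U \<inter> X) \<times> A)"
        using C2e[of "indicator ((U \<inter> X) \<times> A)"] by (simp add: C2_def)
      finally have "emeasure C1 ((U \<inter> X) \<times> A) = emeasure C2 ((U \<inter> X) \<times> A)" .
      \<comment> \<open>The probability in the second factor is at most 1, so the mass is bounded by
        \<open>\<pi>\<close>; this gives the exhaustion by sets of finite mass that uniqueness
        needs.\<close>
      moreover have "emeasure C2 ((U \<inter> X) \<times> A) \<le> (\<integral>\<^sup>+x. \<integral>\<^sup>+\<omega>. indicator (U \<inter> X) x \<partial>\<mu> \<partial>\<pi>)"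
        unfolding c2[symmetric] by (intro nn_integral_mono) (auto split: split_indicator)
      then have "emeasure C2 ((U \<inter> X) \<times> A) \<le> emeasure \<pi> (U \<inter> X)"
        by (simp add: emeasure_space_1)
      ultimately show ?thesis by simp
    qed
    show "emeasure C1 Q = emeasure C2 Q" if Q: "Q \<in> {a \<times> b |a b. a \<in> Eb \<and> b \<in> sets \<mu>}" for Q
      using Q rect by (auto simp: Eb_def)
    show "range (\<lambda>k. (ball 0 (real k) \<inter> X) \<times> configurations X) \<subseteq> {a \<times> b |a b. a \<in> Eb \<and> b \<in> sets \<mu>}"
      using sets.top[of \<mu>] by (auto simp: Eb_def)
    show "(\<Union>k. (ball 0 (real k) \<inter> X) \<times> configurations X) = X \<times> configurations X"
      using whole by blast
    show "emeasure C1 ((ball 0 (real k) \<inter> X) \<times> configurations X) \<noteq> \<infinity>" for k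
      using rect[of "ball 0 (real k)" "configurations X"] sets.top[of \<mu>] finite_\<pi>[of k] by (auto simp: top_unique)
  qed
  show ?thesis
    using F
  proof (induction F rule: borel_measurable_induct)
    case (cong f g)
    have "(\<integral>\<^sup>+\<omega>. \<integral>\<^sup>+x. f (x, \<omega>) \<partial>count_space \<omega> \<partial>\<mu>) = (\<integral>\<^sup>+\<omega>. \<integral>\<^sup>+x. g (x, \<omega>) \<partial>count_space \<omega> \<partial>\<mu>)"
      using cong(3) by (intro nn_integral_cong) (auto simp: space_pair_measure configurations_def)
    moreover have "(\<integral>\<^sup>+x. \<integral>\<^sup>+\<omega>. f (x, insert x \<omega>) \<partial>\<mu> \<partial>\<pi>) = (\<integral>\<^sup>+x. \<integral>\<^sup>+\<omega>. g (x, insert x \<omega>) \<partial>\<mu> \<partial>\<pi>)"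
      using cong(3) by (intro nn_integral_cong) (auto simp: space_pair_measure configurations_insert)
    ultimately show ?case using cong(4) by simp
  next
    case (set Q)
    have "c1 Q = emeasure C2 Q" using C1e[OF set] \<open>C1 = C2\<close> by simp
    also have "\<dots> = (\<integral>\<^sup>+p. indicator Q p \<partial>C2)" using set by (simp add: C2_def)
    finally show ?case using C2e[of "indicator Q"] set by (simp add: c1_def)
  next
    case (mult u c)
    note [measurable] = mult(2)
    have "(\<integral>\<^sup>+\<omega>. \<integral>\<^sup>+x. c * u (x, \<omega>) \<partial>count_space \<omega> \<partial>\<mu>) = c * (\<integral>\<^sup>+\<omega>. \<integral>\<^sup>+x. u (x, \<omega>) \<partial>count_space \<omega> \<partial>\<mu>)"
      by (simp add: nn_integral_cmult points_measurable mult(2))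
    also have "\<dots> = c * (\<integral>\<^sup>+p. u p \<partial>C2)" by (simp add: mult C2e)
    also have "\<dots> = (\<integral>\<^sup>+p. c * u p \<partial>C2)" by (subst nn_integral_cmult) (auto simp: C2_def)
    also have "\<dots> = (\<integral>\<^sup>+x. \<integral>\<^sup>+\<omega>. c * u (x, insert x \<omega>) \<partial>\<mu> \<partial>\<pi>)" by (rule C2e) simp
    finally show ?case .
  next
    case (add u v)
    have [measurable]: "u \<in> borel_measurable (\<pi> \<Otimes>\<^sub>M \<mu>)" "v \<in> borel_measurable (\<pi> \<Otimes>\<^sub>M \<mu>)"
      using add by auto
    have "(\<integral>\<^sup>+\<omega>. \<integral>\<^sup>+x. v (x, \<omega>) + u (x, \<omega>) \<partial>count_space \<omega> \<partial>\<mu>) =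
      (\<integral>\<^sup>+\<omega>. (\<integral>\<^sup>+x. v (x, \<omega>) \<partial>count_space \<omega>) + (\<integral>\<^sup>+x. u (x, \<omega>) \<partial>count_space \<omega>) \<partial>\<mu>)"
      by (simp add: nn_integral_add)
    also have "\<dots> = (\<integral>\<^sup>+\<omega>. \<integral>\<^sup>+x. v (x, \<omega>) \<partial>count_space \<omega> \<partial>\<mu>) + (\<integral>\<^sup>+\<omega>. \<integral>\<^sup>+x. u (x, \<omega>) \<partial>count_space \<omega> \<partial>\<mu>)"
      by (intro nn_integral_add points_measurable) simp_all
    also have "\<dots> = (\<integral>\<^sup>+p. v p \<partial>C2) + (\<integral>\<^sup>+p. u p \<partial>C2)" by (simp add: add C2e)
    also have "\<dots> = (\<integral>\<^sup>+p. v p + u p \<partial>C2)" by (subst nn_integral_add) (auto simp: C2_def)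
    also have "\<dots> = (\<integral>\<^sup>+x. \<integral>\<^sup>+\<omega>. v (x, insert x \<omega>) + u (x, insert x \<omega>) \<partial>\<mu> \<partial>\<pi>)" by (rule C2e) simp
    finally show ?case by simp
  next
    case (seq U)
    note [measurable] = seq(1)
    have incU: "U i p \<le> U j p" if "i \<le> j" for i j p using le_funD[OF incseqD[OF seq(3) that]] .
    have "(\<integral>\<^sup>+\<omega>. \<integral>\<^sup>+x. (SUP i. U i) (x, \<omega>) \<partial>count_space \<omega> \<partial>\<mu>) =
      (\<integral>\<^sup>+\<omega>. (SUP i. \<integral>\<^sup>+x. U i (x, \<omega>) \<partial>count_space \<omega>) \<partial>\<mu>)"
      unfolding SUP_apply by (intro nn_integral_cong nn_integral_monotone_convergence_SUP)
        (auto simp: incseq_def le_fun_def intro!: incU)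
    also have "\<dots> = (SUP i. \<integral>\<^sup>+\<omega>. \<integral>\<^sup>+x. U i (x, \<omega>) \<partial>count_space \<omega> \<partial>\<mu>)"
      by (intro nn_integral_monotone_convergence_SUP points_measurable seq(1))
        (auto simp: incseq_def le_fun_def intro!: nn_integral_mono incU)
    also have "\<dots> = (SUP i. \<integral>\<^sup>+p. U i p \<partial>C2)" by (simp add: seq C2e)
    also have "\<dots> = (\<integral>\<^sup>+p. (SUP i. U i p) \<partial>C2)"
      by (intro nn_integral_monotone_convergence_SUP[symmetric])
        (auto simp: C2_def incseq_def le_fun_def intro!: incU)
    also have "\<dots> = (\<integral>\<^sup>+x. \<integral>\<^sup>+\<omega>. (SUP i. U i) (x, insert x \<omega>) \<partial>\<mu> \<partial>\<pi>)"
      unfolding SUP_apply by (rule C2e) simp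
    finally show ?case .
  qed
qed

lemma mean_points:
  assumes [measurable]: "F \<in> borel_measurable \<pi>"
  shows "(\<integral>\<^sup>+\<omega>. \<integral>\<^sup>+x. F x \<partial>count_space \<omega> \<partial>\<mu>) = (\<integral>\<^sup>+x. F x \<partial>\<pi>)"
  using mecke[of "\<lambda>p. F (fst p)"] by (simp add: emeasure_space_1)

text \<open>By Mecke's formula, the mean number of points sharing their value of \<open>h\<close> with another point is at
  most the \<open>\<pi>\<close>-integral of the probability
  that \<open>\<omega>\<close> meets the \<open>\<pi>\<close>-null fibre of \<open>h\<close> through \<open>x\<close>.\<close>

lemma AE_inj_on_points:
  fixes h :: "'a \<Rightarrow> 'b::euclidean_space"
  assumes h[measurable]: "h \<in> borel_measurable borel"
    and null: "\<And>x. x \<in> X \<Longrightarrow> emeasure \<pi> {y \<in> X. h y = h x} = 0"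
  shows "AE \<omega> in \<mu>. inj_on h \<omega>"
proof -
  have [measurable]: "h \<in> borel_measurable \<pi>" by (rule borel_measurable_\<pi>[OF h]) 
  have [measurable]: "(\<lambda>x. x) \<in> borel_measurable \<pi>" by (rule borel_measurable_\<pi>) simp
  \<comment> \<open>Number of points on the fibre through \<open>x\<close> with \<open>x\<close>
    itself left out, so that the point inserted by Mecke's formula does not count.\<close>
  define G where "G p = (\<integral>\<^sup>+y. indicator {(x, y). y \<noteq> x \<and> h y = h x} (fst p, y) \<partial>count_space (snd p))" for p :: "'a \<times> 'a set"
  have [measurable]: "(\<lambda>q. indicator {(x, y). y \<noteq> x \<and> h y = h x} (fst (fst q), snd q) :: ennreal)
      \<in> borel_measurable ((\<pi> \<Otimes>\<^sub>M \<mu>) \<Otimes>\<^sub>M \<pi>)"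
    unfolding indicator_def by measurable
  have [measurable]: "G \<in> borel_measurable (\<pi> \<Otimes>\<^sub>M \<mu>)"
    unfolding G_def using nn_integral_points_measurable[of snd "\<pi> \<Otimes>\<^sub>M \<mu>"
      "\<lambda>q. indicator {(x, y). y \<noteq> x \<and> h y = h x} (fst (fst q), snd q)"] by simp
  have "(\<integral>\<^sup>+\<omega>. \<integral>\<^sup>+x. G (x, \<omega>) \<partial>count_space \<omega> \<partial>\<mu>) = (\<integral>\<^sup>+x. \<integral>\<^sup>+\<omega>. G (x, insert x \<omega>) \<partial>\<mu> \<partial>\<pi>)"
    by (rule mecke) simp
  also have "\<dots> = 0"
  proof (subst nn_integral_0_iff_AE, measurable, rule AE_I2)
    fix x assume x: "x \<in> space \<pi>"
    have fibre[measurable]: "{y \<in> X. h y = h x} \<in> sets \<pi>"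
    proof -
      have "{y \<in> space \<pi>. h y = h x} \<in> sets \<pi>" by measurable
      then show ?thesis by simp
    qed
    have "(\<integral>\<^sup>+\<omega>. G (x, insert x \<omega>) \<partial>\<mu>) \<le> (\<integral>\<^sup>+\<omega>. \<integral>\<^sup>+y. indicator {y \<in> X. h y = h x} y \<partial>count_space \<omega> \<partial>\<mu>)"
    proof (rule nn_integral_mono)
      fix \<omega> assume "\<omega> \<in> space \<mu>"
      then have sub: "\<omega> \<subseteq> X" by (auto simp: configurations_def)
      have "G (x, insert x \<omega>) = (\<integral>\<^sup>+y. indicator {y. y \<noteq> x \<and> h y = h x} y \<partial>count_space (insert x \<omega>))"
        unfolding G_def fst_conv snd_conv by (intro nn_integral_cong) (auto split: split_indicator)
      also have "\<dots> \<le> (\<integral>\<^sup>+y. indicator {y. y \<noteq> x \<and> h y = h x} y \<partial>count_space \<omega>)"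
        by (cases "x \<in> \<omega>") (auto simp: insert_absorb nn_integral_count_space_insert)
      also have "\<dots> \<le> (\<integral>\<^sup>+y. indicator {y \<in> X. h y = h x} y \<partial>count_space \<omega>)"
        using sub by (intro nn_integral_mono) (auto split: split_indicator)
      finally show "G (x, insert x \<omega>) \<le> \<dots>" .
    qed
    also have "\<dots> = 0" using null[of x] x by (subst mean_points) auto
    finally show "(\<integral>\<^sup>+\<omega>. G (x, insert x \<omega>) \<partial>\<mu>) = 0" by simp
  qed
  finally have "AE \<omega> in \<mu>. (\<integral>\<^sup>+x. G (x, \<omega>) \<partial>count_space \<omega>) = 0"
    by (subst (asm) nn_integral_0_iff_AE) (auto intro: points_measurable)
  then show ?thesis
  proof eventually_elim
    case (elim \<omega>)
    show ?case
    proof (rule inj_onI, rule ccontr)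
      fix x y assume xy: "x \<in> \<omega>" "y \<in> \<omega>" "h x = h y" "x \<noteq> y"
      have "G (x, \<omega>) = 0" using elim xy(1) by (auto simp: nn_integral_0_iff_AE AE_count_space)
      then have "indicator {(x, y). y \<noteq> x \<and> h y = h x} (x, y) = (0::ennreal)"
        using xy(2) by (auto simp: G_def nn_integral_0_iff_AE AE_count_space)
      then show False using xy by simp
    qed
  qed
qed

end

section \<open>Time and predictability\<close>

lemma borel_Times: "A \<in> sets borel \<Longrightarrow> B \<in> sets borel \<Longrightarrow> A \<times> B \<in> sets (borel :: ('a::second_countable_topology \<times> 'b::second_countable_topology) measure)"
  by (subst borel_prod[symmetric]) simp

lemma mem_time_space[simp]: "x \<in> time_space \<longleftrightarrow> 0 \<le> fst x"
  by (cases x) (auto simp: time_space_def)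

lemma closed_time_space: "closed (time_space :: (real \<times> 'z::topological_space) set)"
  unfolding time_space_def by (intro closed_Times) auto

lemma space_halfline[simp]: "space halfline = {0..}"
  by (simp add: halfline_def space_restrict_space)

lemma sets_halfline: "sets halfline = sets (restrict_space borel {0..})"
  unfolding halfline_def by (rule sets_restrict_space_cong) simp

lemma emeasure_halfline_le: "A \<in> sets borel \<Longrightarrow> emeasure halfline ({0..} \<inter> A) \<le> emeasure lborel A"
  unfolding halfline_def by (subst emeasure_restrict_space) (auto intro: emeasure_mono)

lemma nn_integral_halfline:
  "(\<integral>\<^sup>+t. f t \<partial>halfline) = (\<integral>\<^sup>+t. f t * indicator {0..} t \<partial>lborel)"
  unfolding halfline_def by (subst nn_integral_restrict_space) auto

lemma sigma_finite_halfline: "sigma_finite_measure halfline"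
  unfolding halfline_def by (rule sigma_finite_measure_restrict_space) (auto intro: lborel.sigma_finite_measure_axioms)

text \<open>Brings the product of half-line and space into the form assumed in
  \<open>poisson_configuration\<close>, a closed subset of a Euclidean space with its Borel
  sets.\<close>

lemma sets_halfline_pair:
  fixes \<sigma> :: "'z::euclidean_space measure"
  assumes \<sigma>: "sets \<sigma> = sets borel"
  shows "sets (halfline \<Otimes>\<^sub>M \<sigma>) = sets (restrict_space borel time_space)"
proof
  have sp: "space \<sigma> = UNIV" using sets_eq_imp_space_eq[OF \<sigma>] by simp
  have id: "(\<lambda>p. p) \<in> measurable (halfline \<Otimes>\<^sub>M \<sigma>) borel"
  proof -
    have "fst \<in> measurable (halfline \<Otimes>\<^sub>M \<sigma>) borel"
      by (rule measurable_compose[OF measurable_fst]) (simp add: measurable_cong_sets[OF sets_halfline refl] measurable_restrict_space1)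
    moreover have "snd \<in> measurable (halfline \<Otimes>\<^sub>M \<sigma>) borel"
      by (rule measurable_compose[OF measurable_snd]) (simp add: measurable_cong_sets[OF \<sigma> refl])
    ultimately have "(\<lambda>p. (fst p, snd p)) \<in> measurable (halfline \<Otimes>\<^sub>M \<sigma>) borel"
      by (rule borel_measurable_Pair)
    then show ?thesis by simp
  qed
  show "sets (restrict_space borel time_space) \<subseteq> sets (halfline \<Otimes>\<^sub>M \<sigma>)"
  proof
    fix A assume "A \<in> sets (restrict_space borel (time_space :: (real \<times> 'z) set))"
    then obtain C where C: "C \<in> sets borel" "A = time_space \<inter> C" by (auto simp: sets_restrict_space)
    have "A = (\<lambda>p. p) -` C \<inter> space (halfline \<Otimes>\<^sub>M \<sigma>)"
      unfolding C(2) by (auto simp: space_pair_measure sp time_space_def)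
    then show "A \<in> sets (halfline \<Otimes>\<^sub>M \<sigma>)" using measurable_sets[OF id C(1)] by simp
  qed
  have sp2: "space (halfline \<Otimes>\<^sub>M \<sigma>) = time_space" by (auto simp: space_pair_measure sp time_space_def)
  have "{a \<times> b |a b. a \<in> sets halfline \<and> b \<in> sets \<sigma>} \<subseteq> sets (restrict_space borel time_space)"
  proof clarsimp
    fix a :: "real set" and b :: "'z set" assume "a \<in> sets halfline" "b \<in> sets \<sigma>"
    then obtain A where A: "A \<in> sets borel" "a = {0..} \<inter> A" and b: "b \<in> sets borel"
      by (auto simp: sets_halfline sets_restrict_space \<sigma>)
    have "A \<times> b \<in> sets borel" using A b by (intro borel_Times)
    moreover have "a \<times> b = time_space \<inter> (A \<times> b)" by (auto simp: A time_space_def)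
    ultimately show "a \<times> b \<in> sets (restrict_space borel time_space)" by (auto simp: sets_restrict_space)
  qed
  then show "sets (halfline \<Otimes>\<^sub>M \<sigma>) \<subseteq> sets (restrict_space borel time_space)"
    unfolding sets_pair_measure sp2[unfolded space_pair_measure]
    using sets.sigma_sets_subset[of _ "restrict_space borel (time_space :: (real \<times> 'z) set)"]
    by (simp add: space_restrict_space)
qed

text \<open>The inequality is strict: a point at time \<open>t\<close> does not belong to its own
  past, so inserting it changes nothing there, in accordance with the left limit of the
  filtration.\<close>

definition before :: "real \<Rightarrow> (real \<times> 'z) set \<Rightarrow> (real \<times> 'z) set" where
  "before t \<omega> = {x \<in> \<omega>. fst x < t}"

lemma before_configurations:
  "\<omega> \<in> configurations X \<Longrightarrow> before t \<omega> \<in> configurations X"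
  by (rule configurations_subset) (auto simp: before_def)

lemma before_before[simp]: "s \<le> t \<Longrightarrow> before s (before t \<omega>) = before s \<omega>"
  by (auto simp: before_def)

lemma before_insert[simp]: "before (fst x) (insert x \<omega>) = before (fst x) \<omega>"
  by (auto simp: before_def)

lemma space_filt[simp]: "space (filt t) = configurations time_space"
  unfolding filt_def by (rule space_measure_of) auto

lemma space_filt_left[simp]: "space (filt_left t) = configurations time_space"
  unfolding filt_left_def using sets.sets_into_space[of _ "filt _"] by (intro space_measure_of) auto

lemma sets_filt_left: "sets (filt_left t) = sigma_sets (configurations time_space) (\<Union>s \<in> {0} \<union> {0..<t}. sets (filt s))"
  unfolding filt_left_def using sets.sets_into_space[of _ "filt _"] by (intro sets_measure_of) auto

lemma sets_filt: "sets (filt t) = sigma_sets (configurations time_space)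
  {{\<omega> \<in> configurations time_space. emeasure (config_measure \<omega>) ({0..s} \<times> B) \<in> C} | s B C.
        0 \<le> s \<and> s \<le> t \<and> B \<in> sets borel \<and> C \<in> sets borel}"
  unfolding filt_def by (rule sets_measure_of) auto

lemma sets_filt_subset:
  "sets (filt t :: (real \<times> 'z::euclidean_space) set measure) \<subseteq> sets (config_borel time_space)"
  unfolding sets_filt
proof (rule sets.sigma_sets_subset[of _ "config_borel time_space", simplified], clarsimp)
  fix s :: real and B :: "'z set" and C :: "ennreal set"
  assume B: "B \<in> sets borel" and C[measurable]: "C \<in> sets borel"
  have m: "{0..s} \<times> B \<in> sets borel" using B by (intro borel_Times) auto
  note [measurable] = count_measurable[OF closed_time_space m]
  have "{\<omega> \<in> space (config_borel time_space). (\<integral>\<^sup>+x. indicator ({0..s} \<times> B) x \<partial>count_space \<omega>) \<in> C} \<in> sets (config_borel time_space)"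
    by measurable
  then show "{\<omega> \<in> configurations time_space. emeasure (config_measure \<omega>) ({0..s} \<times> B) \<in> C} \<in> sets (config_borel time_space)"
    by (simp add: emeasure_config_measure[OF m])
qed

lemma sets_filt_left_subset:
  "sets (filt_left t :: (real \<times> 'z::euclidean_space) set measure) \<subseteq> sets (config_borel time_space)"
  unfolding sets_filt_left
  using sets_filt_subset by (intro sets.sigma_sets_subset[of _ "config_borel time_space", simplified]) blast

text \<open>The filtration is generated by counts in \<open>{0..r} \<times> B\<close>. Such
  rectangles are stable under intersection and generate the Borel sets, and within the bounded box
  all counts are finite, so a Dynkin argument reaches every Borel \<open>Q\<close>.\<close>

lemma count_filt_left_measurable:
  fixes Q :: "(real \<times> 'z::euclidean_space) set"
  assumes s: "0 \<le> s" "s < t" and Q: "Q \<in> sets borel"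
  shows "(\<lambda>\<omega>. \<integral>\<^sup>+x. indicator (Q \<inter> ({0..s} \<times> ball 0 (real k))) x \<partial>count_space \<omega>) \<in> borel_measurable (filt_left t)"
proof -
  let ?D = "{0..s} \<times> ball (0::'z) (real k)"
  define N where "N Q \<omega> = (\<integral>\<^sup>+x. indicator (Q \<inter> ?D) x \<partial>count_space \<omega>)" for Q \<omega>
  have bD: "bounded ?D" by (intro bounded_Times) auto
  have Nfin: "N Q \<omega> \<noteq> \<infinity>" if "\<omega> \<in> configurations time_space" for Q \<omega>
  proof -
    have "finite (\<omega> \<inter> (Q \<inter> ?D))"
      by (rule configurations_finite_bounded[OF closed_time_space that]) (use bD in \<open>auto intro: bounded_subset\<close>)
    then show ?thesis by (simp add: N_def nn_integral_indicator_count_space)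
  qed
  have rect: "N ({..a} \<times> B) \<in> borel_measurable (filt_left t)" if B: "B \<in> sets borel" for a B
  proof (cases "0 \<le> a")
    case False
    then have "({..a} \<times> B) \<inter> ?D = {}" by auto
    then show ?thesis by (simp add: N_def[abs_def])
  next
    case True
    define r where "r = min a s"
    have r: "0 \<le> r" "r < t" using True s by (auto simp: r_def)
    have B': "B \<inter> ball 0 (real k) \<in> sets borel" using B by simp
    have m: "{0..r} \<times> (B \<inter> ball 0 (real k)) \<in> sets borel" using B' by (intro borel_Times) auto
    have "({..a} \<times> B) \<inter> ?D = {0..r} \<times> (B \<inter> ball 0 (real k))" by (auto simp: r_def)
    then have N: "N ({..a} \<times> B) \<omega> = emeasure (config_measure \<omega>) ({0..r} \<times> (B \<inter> ball 0 (real k)))" for \<omega>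
      by (simp add: N_def emeasure_config_measure[OF m])
    show ?thesis
    proof (rule measurableI)
      fix C :: "ennreal set" assume C: "C \<in> sets borel"
      have "N ({..a} \<times> B) -` C \<inter> space (filt_left t) =
        {\<omega> \<in> configurations time_space. emeasure (config_measure \<omega>) ({0..r} \<times> (B \<inter> ball 0 (real k))) \<in> C}"
        by (auto simp: N)
      also have "\<dots> \<in> sets (filt r)"
        unfolding sets_filt using r B' C by (intro sigma_sets.Basic) auto
      finally show "N ({..a} \<times> B) -` C \<inter> space (filt_left t) \<in> sets (filt_left t)"
        unfolding sets_filt_left using r by (intro sigma_sets.Basic) auto
    qed simp
  qed
  have UN: "(\<Union>n. {..real n}) = UNIV" using real_arch_simple by auto
  have gen: "sets (borel :: (real \<times> 'z) measure) = sigma_sets UNIV {a \<times> b |a b. a \<in> range atMost \<and> b \<in> sets borel}"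
  proof -
    have "sets (borel :: (real \<times> 'z) measure) = sets ((borel :: real measure) \<Otimes>\<^sub>M (borel :: 'z measure))" by (simp only: borel_prod)
    also have "\<dots> = sets (sigma (space borel \<times> space borel) {a \<times> b |a b. a \<in> range (atMost :: real \<Rightarrow> _) \<and> b \<in> sets (borel :: 'z measure)})"
    proof (rule sets_pair_eq)
      show "sets borel = sigma_sets (space borel) (range (atMost :: real \<Rightarrow> _))"
        by (subst borel_eq_atMost) (simp add: sets_measure_of)
      show "sets borel = sigma_sets (space borel) (sets (borel :: 'z measure))" by (simp only: sets.sigma_sets_eq)
      show "countable (range (\<lambda>n. {..real n}))" "countable {UNIV :: 'z set}" by auto
      show "range (\<lambda>n. {..real n}) \<subseteq> range atMost" by auto
      show "\<Union> (range (\<lambda>n. {..real n})) = space borel" using UN by simp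
    qed auto
    also have "\<dots> = sigma_sets UNIV {a \<times> b |a b. a \<in> range atMost \<and> b \<in> sets borel}"
      by (simp add: sets_measure_of)
    finally show ?thesis .
  qed
  have stable: "Int_stable {a \<times> b |a b. a \<in> range (atMost :: real \<Rightarrow> _) \<and> b \<in> sets (borel :: 'z measure)}"
  proof (rule Int_stableI, clarsimp)
    fix a a' :: real and b b' :: "'z set" assume "b \<in> sets borel" "b' \<in> sets borel"
    then show "\<exists>c d. {..a} \<times> b \<inter> {..a'} \<times> b' = c \<times> d \<and> c \<in> range atMost \<and> d \<in> sets borel"
      by (intro exI[of _ "{..min a a'}"] exI[of _ "b \<inter> b'"]) auto
  qed
  have "N Q \<in> borel_measurable (filt_left t)"
    using stable subset_UNIV[of "{a \<times> b |a b. a \<in> range (atMost :: real \<Rightarrow> _) \<and> b \<in> sets (borel :: 'z measure)}", folded Pow_UNIV] Q[unfolded gen]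
  proof (induction Q rule: sigma_sets_induct_disjoint)
    case (basic A)
    then show ?case using rect by auto
  next
    case empty
    then show ?case by (simp add: N_def[abs_def])
  next
    case (compl A)
    have eq: "N (UNIV - A) \<omega> = N UNIV \<omega> - N A \<omega>" if "\<omega> \<in> space (filt_left t)" for \<omega>
    proof -
      have "N (UNIV - A) \<omega> = (\<integral>\<^sup>+x. indicator (UNIV \<inter> ?D) x - indicator (A \<inter> ?D) x \<partial>count_space \<omega>)"
        unfolding N_def by (intro nn_integral_cong) (auto split: split_indicator)
      also have "\<dots> = N UNIV \<omega> - N A \<omega>"
        unfolding N_def using Nfin[of \<omega> A] that
        by (intro nn_integral_diff) (auto simp: N_def split: split_indicator)
      finally show ?thesis .
    qed
    have "(\<lambda>\<omega>. N UNIV \<omega> - N A \<omega>) \<in> borel_measurable (filt_left t)"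
    proof (rule borel_measurable_minus_ennreal)
      have "N UNIV = (\<lambda>\<omega>. N ({..s} \<times> UNIV) \<omega>)"
        unfolding N_def by (intro ext nn_integral_cong) (auto split: split_indicator)
      then show "N UNIV \<in> borel_measurable (filt_left t)" using rect[of UNIV s] by simp
    qed (rule compl(2))
    then show ?case by (subst measurable_cong[OF eq])
  next
    case (union A)
    have "N (\<Union> (range A)) = (\<lambda>\<omega>. \<Sum>i. N (A i) \<omega>)"
    proof
      fix \<omega>
      have "N (\<Union> (range A)) \<omega> = (\<integral>\<^sup>+x. (\<Sum>i. indicator (A i \<inter> ?D) x) \<partial>count_space \<omega>)"
      proof -
        have "disjoint_family (\<lambda>i. A i \<inter> ?D)" using union(1) by (auto simp: disjoint_family_on_def)
        then show ?thesis unfolding N_def by (simp add: suminf_indicator)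
      qed
      also have "\<dots> = (\<Sum>i. N (A i) \<omega>)" unfolding N_def by (rule nn_integral_suminf) simp
      finally show "N (\<Union> (range A)) \<omega> = (\<Sum>i. N (A i) \<omega>)" .
    qed
    then show ?case using union(3) by simp
  qed
  then show ?thesis by (simp add: N_def[abs_def])
qed

text \<open>The points strictly before \<open>t\<close> are exhausted by those up to times
  \<open>s n\<close> increasing to \<open>t\<close>, and counts up to \<open>s n < t\<close> are
  measurable for the left limit.\<close>

lemma before_measurable:
  assumes t: "0 < t"
  shows "before t \<in> measurable (filt_left t) (config_borel (time_space :: (real \<times> 'z::euclidean_space) set))"
proof (rule measurable_config_borelI[OF closed_time_space])
  show "before t \<omega> \<in> configurations time_space" if "\<omega> \<in> space (filt_left t)" for \<omega> :: "(real \<times> 'z) set"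
    using that by (simp add: before_configurations)
  fix U :: "(real \<times> 'z) set" assume U: "open U" "bounded U"
  define s where "s n = t - t / (real n + 2)" for n
  have s: "0 \<le> s n" "s n < t" for n
    using t by (auto simp: s_def field_simps)
  define I where "I n \<omega> = (\<integral>\<^sup>+x. indicator (U \<inter> ({0..s n} \<times> ball 0 (real n))) x \<partial>count_space \<omega>)" for n \<omega>
  have m: "I n \<in> borel_measurable (filt_left t)" for n
    using count_filt_left_measurable[OF s, of U n n] U by (simp add: I_def[abs_def])
  have eq: "(\<integral>\<^sup>+x. indicator U x \<partial>count_space (before t \<omega>)) = (SUP n. I n \<omega>)" if \<omega>: "\<omega> \<in> space (filt_left t)" for \<omega>
  proof -
    have that: "\<omega> \<in> configurations time_space" using \<omega> by simp
    have "(\<integral>\<^sup>+x. indicator U x \<partial>count_space (before t \<omega>)) =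
      (\<integral>\<^sup>+x. indicator U x * indicator (before t \<omega>) x \<partial>count_space \<omega>)"
      by (subst nn_integral_count_space_indicator, simp, subst nn_integral_count_space_indicator[of \<omega>], simp)
        (auto intro!: nn_integral_cong simp: before_def split: split_indicator)
    also have "\<dots> = (\<integral>\<^sup>+x. (SUP n. indicator (U \<inter> ({0..s n} \<times> ball 0 (real n))) x) \<partial>count_space \<omega>)"
    proof (intro nn_integral_cong antisym)
      fix x assume x: "x \<in> space (count_space \<omega>)"
      show "indicator U x * indicator (before t \<omega>) x \<le> (SUP n. indicator (U \<inter> ({0..s n} \<times> ball 0 (real n))) x :: ennreal)"
      proof (cases "x \<in> U \<and> fst x < t")
        case True
        obtain n1 :: nat where n1: "norm (snd x) < real n1" using reals_Archimedean2 by blast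
        obtain n2 :: nat where n2: "t / (t - fst x) < real n2" using reals_Archimedean2 by blast
        define n where "n = max n1 n2"
        have "t / (t - fst x) < real n + 2" using n2 by (simp add: n_def)
        then have "t < (real n + 2) * (t - fst x)" using True by (simp add: field_simps)
        then have "fst x \<le> s n" by (simp add: s_def field_simps)
        moreover have "0 \<le> fst x" using x that by (auto simp: configurations_def time_space_def)
        moreover have "norm (snd x) < real n" using n1 by (simp add: n_def)
        ultimately have "x \<in> U \<inter> ({0..s n} \<times> ball 0 (real n))" using True by (cases x) auto
        then show ?thesis by (intro SUP_upper2[of n]) (auto split: split_indicator)
      qed (auto simp: before_def split: split_indicator)
      show "(SUP n. indicator (U \<inter> ({0..s n} \<times> ball 0 (real n))) x :: ennreal) \<le> indicator U x * indicator (before t \<omega>) x"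
        using s(2) x by (intro SUP_least) (auto simp: before_def split: split_indicator intro: le_less_trans)
    qed
    also have "\<dots> = (SUP n. I n \<omega>)"
      unfolding I_def
    proof (rule nn_integral_monotone_convergence_SUP)
      have "s m \<le> s n" if "m \<le> n" for m n
        using t that by (auto simp: s_def intro!: divide_left_mono)
      then show "incseq (\<lambda>n x. indicator (U \<inter> ({0..s n} \<times> ball 0 (real n))) x :: ennreal)"
        unfolding incseq_def le_fun_def by (auto split: split_indicator intro: order_trans) 
    qed simp
    finally show ?thesis .
  qed
  have "(\<lambda>\<omega>. SUP n. I n \<omega>) \<in> borel_measurable (filt_left t)"
    using m by (intro borel_measurable_SUP) auto
  then show "(\<lambda>\<omega>. \<integral>\<^sup>+x. indicator U x \<partial>count_space (before t \<omega>)) \<in> borel_measurable (filt_left t)"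
    by (subst measurable_cong[OF eq])
qed

text \<open>A generator at a time \<open>r \<le> s\<close> counts only points that survive in
  \<open>before t \<omega>\<close>, and complements and countable unions preserve the
  equivalence.\<close>

lemma filt_before:
  assumes A: "A \<in> sets (filt s)" and s: "s < t" and \<omega>: "\<omega> \<in> configurations (time_space :: (real \<times> 'z::euclidean_space) set)"
  shows "before t \<omega> \<in> A \<longleftrightarrow> \<omega> \<in> A"
  using A unfolding sets_filt
proof (induction A rule: sigma_sets.induct)
  case (Basic A)
  then obtain r and B :: "'z set" and C where A: "A = {\<omega> \<in> configurations time_space. emeasure (config_measure \<omega>) ({0..r} \<times> B) \<in> C}"
    and r: "r \<le> s" and B: "B \<in> sets borel" by auto
  have m: "{0..r} \<times> B \<in> sets borel" using B by (intro borel_Times) auto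
  have "(\<integral>\<^sup>+x. indicator ({0..r} \<times> B) x \<partial>count_space (before t \<omega>)) = (\<integral>\<^sup>+x. indicator ({0..r} \<times> B) x \<partial>count_space \<omega>)"
    by (subst (1 2) nn_integral_count_space_indicator, simp, simp)
      (use r s in \<open>auto intro!: nn_integral_cong simp: before_def split: split_indicator\<close>)
  then show ?case using \<omega> by (simp add: A emeasure_config_measure[OF m] before_configurations)
next
  case (Compl A)
  then show ?case using \<omega> by (auto simp: before_configurations)
qed auto

lemma space_predictable_sigma:
    "space (predictable_sigma :: ((real \<times> 'z::euclidean_space) set \<times> (real \<times> 'z)) measure) =
      configurations time_space \<times> time_space"
  and sets_predictable_sigma: "sets (predictable_sigma :: ((real \<times> 'z::euclidean_space) set \<times> (real \<times> 'z)) measure) =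
    sigma_sets (configurations time_space \<times> time_space)
     ({A \<times> ({s<..t} \<times> B) | A s t B. 0 \<le> s \<and> s < t \<and> A \<in> sets (filt s) \<and> B \<in> sets borel} \<union>
      {A \<times> ({0} \<times> B) | A B. A \<in> sets (filt 0) \<and> B \<in> sets borel})"
proof -
  have filt_space: "\<omega> \<in> configurations time_space" if "A \<in> sets (filt s)" "\<omega> \<in> A" for A s and \<omega> :: "(real \<times> 'z) set"
    using sets.sets_into_space[OF that(1)] that(2) by auto
  have "({A \<times> ({s<..t} \<times> B) | A s t B. 0 \<le> s \<and> s < t \<and> A \<in> sets (filt s) \<and> B \<in> sets borel} \<union>
      {A \<times> ({0} \<times> B) | A B. A \<in> sets (filt 0) \<and> B \<in> sets borel}) \<subseteq>
      Pow (configurations (time_space :: (real \<times> 'z) set) \<times> time_space)"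
    by (auto dest: filt_space)
  then show "space (predictable_sigma :: ((real \<times> 'z) set \<times> (real \<times> 'z)) measure) = configurations time_space \<times> time_space"
    "sets (predictable_sigma :: ((real \<times> 'z::euclidean_space) set \<times> (real \<times> 'z)) measure) =
    sigma_sets (configurations time_space \<times> time_space)
     ({A \<times> ({s<..t} \<times> B) | A s t B. 0 \<le> s \<and> s < t \<and> A \<in> sets (filt s) \<and> B \<in> sets borel} \<union>
      {A \<times> ({0} \<times> B) | A B. A \<in> sets (filt 0) \<and> B \<in> sets borel})"
    unfolding predictable_sigma_def by (rule space_measure_of sets_measure_of; assumption)+
qed

lemma sets_predictable_sigma_subset:
  "sets (predictable_sigma :: ((real \<times> 'z::euclidean_space) set \<times> (real \<times> 'z)) measure) \<subseteq>
    sets (config_borel time_space \<Otimes>\<^sub>M restrict_space borel time_space)"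
proof -
  have s: "S \<in> sets (restrict_space borel time_space)" if "S \<in> sets borel" "S \<subseteq> time_space" for S :: "(real \<times> 'z) set"
    using that by (auto simp: sets_restrict_space intro!: image_eqI[of _ _ S])
  have "A \<times> ({s<..t} \<times> B) \<in> sets (config_borel time_space \<Otimes>\<^sub>M restrict_space borel time_space)"
    if "0 \<le> s" "A \<in> sets (filt s)" "B \<in> sets borel" for s t and A :: "(real \<times> 'z) set set" and B :: "'z set"
    using that by (intro pair_measureI s borel_Times subsetD[OF sets_filt_subset]) auto
  moreover have "A \<times> ({0} \<times> B) \<in> sets (config_borel time_space \<Otimes>\<^sub>M restrict_space borel time_space)"
    if "A \<in> sets (filt 0)" "B \<in> sets borel" for A :: "(real \<times> 'z) set set" and B :: "'z set"
    using that by (intro pair_measureI s borel_Times subsetD[OF sets_filt_subset]) auto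
  ultimately show ?thesis
    unfolding sets_predictable_sigma
    by (intro sets.sigma_sets_subset[of _ "config_borel time_space \<Otimes>\<^sub>M restrict_space borel time_space",
        simplified space_pair_measure space_config_borel space_restrict_space space_borel Int_UNIV_right]) auto
qed

text \<open>Converts predictability into literal dependence on the strict past. On a generator over
  \<open>{s<..t}\<close> the time of \<open>x\<close> exceeds \<open>s\<close>, so the event in
  \<open>filt s\<close> ignores everything from that time on; the generators at time 0 do not
  contain \<open>x\<close>.\<close>

lemma predictable_before:
  assumes S: "S \<in> sets predictable_sigma" and \<omega>: "\<omega> \<in> configurations (time_space :: (real \<times> 'z::euclidean_space) set)"
    and x: "x \<in> time_space" "0 < fst x"
  shows "(before (fst x) \<omega>, x) \<in> S \<longleftrightarrow> (\<omega>, x) \<in> S"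
  using S unfolding sets_predictable_sigma
proof (induction S rule: sigma_sets.induct)
  case (Basic S)
  then consider A s t B where "S = A \<times> ({s<..t} \<times> B)" "A \<in> sets (filt s)"
    | A B where "S = A \<times> ({0} \<times> B)" "A \<in> sets (filt 0)" by blast
  then show ?case
  proof cases
    case 1
    then show ?thesis using filt_before[OF 1(2) _ \<omega>, of "fst x"] by (cases x) auto
  next
    case 2
    then show ?thesis using x by (cases x) auto
  qed
next
  case (Compl A)
  then show ?case using \<omega> x by (auto simp: before_configurations)
qed auto

section \<open>Girsanov's formula\<close>

text \<open>\<open>real_cond_exp\<close> is the difference of the extended conditional expectations
  of positive and negative part; here the latter vanishes and the former is finite almost
  everywhere.\<close>

lemma (in sigma_finite_subalgebra) nn_cond_exp_eq_real_cond_exp: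
  assumes f: "integrable M f" "AE x in M. 0 \<le> f x"
  shows "AE x in M. nn_cond_exp M F (\<lambda>x. ennreal (f x)) x = ennreal (real_cond_exp M F f x)"
proof -
  have [measurable]: "f \<in> borel_measurable M" using f(1) by auto
  have "AE x in M. ennreal (- f x) = 0" using f(2) by (auto elim: AE_mp simp: ennreal_neg)
  then have "AE x in M. nn_cond_exp M F (\<lambda>x. ennreal (- f x)) x = nn_cond_exp M F (\<lambda>x. 0) x"
    by (intro nn_cond_exp_cong) auto
  moreover have "AE x in M. 0 = nn_cond_exp M F (\<lambda>x. 0) x"
    by (rule nn_cond_exp_F_meas) simp
  moreover have "AE x in M. nn_cond_exp M F (\<lambda>x. ennreal (f x)) x \<noteq> \<infinity>"
  proof (rule nn_integral_PInf_AE)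
    have "(\<integral>\<^sup>+x. nn_cond_exp M F (\<lambda>x. ennreal (f x)) x \<partial>M) = (\<integral>\<^sup>+x. ennreal (f x) \<partial>M)"
      using nn_cond_exp_intg[of "\<lambda>_. 1" "\<lambda>x. ennreal (f x)"] by simp
    also have "\<dots> < \<infinity>" using f by (simp add: nn_integral_eq_integral)
    finally show "(\<integral>\<^sup>+x. nn_cond_exp M F (\<lambda>x. ennreal (f x)) x \<partial>M) \<noteq> \<infinity>" by simp
  qed simp
  ultimately show ?thesis
    by eventually_elim (simp add: real_cond_exp_def less_top)
qed

text \<open>Pathwise form of predictability. Time 0 is exempt, being null for the intensity.\<close>

definition nonanticipating :: "((real \<times> 'z) \<times> (real \<times> 'z::topological_space) set \<Rightarrow> 'b) \<Rightarrow> bool" where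
  "nonanticipating H \<longleftrightarrow>
    (\<forall>\<omega>\<in>configurations time_space. \<forall>x. 0 < fst x \<longrightarrow> H (x, before (fst x) \<omega>) = H (x, \<omega>))"

locale poisson_density =
  fixes \<sigma> :: "'z::euclidean_space measure" and \<mu> \<nu> :: "(real \<times> 'z) set measure"
    and L :: "(real \<times> 'z) set \<Rightarrow> real" and u :: "real \<Rightarrow> 'z \<Rightarrow> (real \<times> 'z) set \<Rightarrow> real"
  assumes sigma: "diffuse_radon_measure \<sigma>"
    and poisson_halfline: "poisson_measure time_space (halfline \<Otimes>\<^sub>M \<sigma>) \<mu>"
    and L_meas: "L \<in> borel_measurable \<mu>"
    and L_pos: "AE \<omega> in \<mu>. 0 < L \<omega>"
    and prob_\<nu>: "prob_space \<nu>"
    and \<nu>_eq: "\<nu> = density \<mu> (\<lambda>\<omega>. ennreal (L \<omega>))"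
    and u_pred: "predictable u"
    and u_eq: "AE (t, z) in halfline \<Otimes>\<^sub>M \<sigma>. AE \<omega> in \<mu>.
        u t z \<omega> = real_cond_exp \<mu> (filt_left t) (grad t z L) \<omega> /
                   real_cond_exp \<mu> (filt_left t) L \<omega>"
    and grad_integrable: "AE (t, z) in halfline \<Otimes>\<^sub>M \<sigma>. integrable \<mu> (grad t z L)"
begin

abbreviation \<pi> :: "(real \<times> 'z) measure" where "\<pi> \<equiv> halfline \<Otimes>\<^sub>M \<sigma>"

lemma sets_\<sigma>[measurable_cong]: "sets \<sigma> = sets borel"
  using sigma by (simp add: diffuse_radon_measure_def)

lemma space_\<sigma>[simp]: "space \<sigma> = UNIV"
  using sets_eq_imp_space_eq[OF sets_\<sigma>] by simp

lemma sigma_finite_\<sigma>: "sigma_finite_measure \<sigma>"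
proof
  show "\<exists>A. countable A \<and> A \<subseteq> sets \<sigma> \<and> \<Union> A = space \<sigma> \<and> (\<forall>a\<in>A. emeasure \<sigma> a \<noteq> \<infinity>)"
  proof (intro exI[of _ "range (\<lambda>k. cball 0 (real k))"] conjI)
    show "\<Union> (range (\<lambda>k. cball 0 (real k))) = space \<sigma>"
      using UN_ball_real[where 'a='z] ball_subset_cball by (simp add: set_eq_iff) (meson less_imp_le)
    show "range (\<lambda>k. cball 0 (real k)) \<subseteq> sets \<sigma>" by (auto simp: sets_\<sigma>)
    show "\<forall>a\<in>range (\<lambda>k. cball 0 (real k)). emeasure \<sigma> a \<noteq> \<infinity>"
      using sigma by (auto simp: diffuse_radon_measure_def less_top[symmetric])
  qed simp
qed

sublocale \<pi>: pair_sigma_finite halfline \<sigma>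
  using sigma_finite_\<sigma> sigma_finite_halfline by (simp add: pair_sigma_finite_def)

lemma emeasure_\<pi>_Times:
  assumes "A \<in> sets borel" "B \<in> sets borel"
  shows "emeasure \<pi> (({0..} \<inter> A) \<times> B) = emeasure halfline ({0..} \<inter> A) * emeasure \<sigma> B"
  using assms by (intro \<pi>.M2.emeasure_pair_measure_Times) (auto simp: sets_halfline sets_restrict_space sets_\<sigma>)

lemma emeasure_\<pi>_box_finite: "emeasure \<pi> (({0..} \<inter> {0..real k}) \<times> cball 0 (real k)) < \<infinity>"
proof -
  have "emeasure halfline ({0..} \<inter> {0..real k}) \<le> emeasure lborel {0..real k}" by (rule emeasure_halfline_le) simp
  then have "emeasure halfline ({0..} \<inter> {0..real k}) < \<infinity>" by (rule le_less_trans) simp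
  moreover have "emeasure \<sigma> (cball 0 (real k)) < \<infinity>" using sigma by (auto simp: diffuse_radon_measure_def)
  ultimately show ?thesis by (subst emeasure_\<pi>_Times) (auto simp: ennreal_mult_less_top)
qed

lemma emeasure_\<pi>_singleton_time: "emeasure \<pi> ({t} \<times> UNIV) = 0"
proof (cases "0 \<le> t")
  case True
  have "emeasure halfline ({0..} \<inter> {t}) \<le> emeasure lborel {t}" by (rule emeasure_halfline_le) simp
  then have "emeasure \<pi> (({0..} \<inter> {t}) \<times> UNIV) = 0" by (subst emeasure_\<pi>_Times) auto
  then show ?thesis using True by simp
next
  case False
  then have "{t} \<times> (UNIV :: 'z set) \<notin> sets \<pi>"
    using sets.sets_into_space[of "{t} \<times> (UNIV :: 'z set)" \<pi>] by (auto simp: space_pair_measure)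
  then show ?thesis by (rule emeasure_notin_sets)
qed

lemma emeasure_\<pi>_singleton_space: "emeasure \<pi> ({0..} \<times> {z}) = 0"
  using emeasure_\<pi>_Times[of UNIV "{z}"] sigma by (simp add: diffuse_radon_measure_def)

sublocale poisson_configuration time_space \<pi> \<mu>
proof
  show "closed (time_space :: (real \<times> 'z) set)" by (rule closed_time_space)
  show "sets \<pi> = sets (restrict_space borel time_space)" by (rule sets_halfline_pair[OF sets_\<sigma>])
  show "poisson_measure time_space \<pi> \<mu>" by (rule poisson_halfline)
  show "emeasure \<pi> {x} = 0" for x
  proof -
    have "emeasure \<pi> {x} \<le> emeasure \<pi> ({0..} \<times> {snd x})" if "0 \<le> fst x"
      using that by (intro emeasure_mono) (auto simp: mem_Times_iff sets_\<sigma> sets_halfline sets_restrict_space intro!: pair_measureI image_eqI[of _ _ UNIV])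
    moreover have "{x} \<notin> sets \<pi>" if "\<not> 0 \<le> fst x"
      using that sets.sets_into_space[of "{x}" \<pi>] by (auto simp: space_pair_measure)
    ultimately show ?thesis using emeasure_\<pi>_singleton_space[of "snd x"] by (cases "0 \<le> fst x") (auto intro: emeasure_notin_sets)
  qed
  show "emeasure \<pi> (ball 0 (real k) \<inter> time_space) < \<infinity>" for k
  proof -
    have "emeasure \<pi> (ball 0 (real k) \<inter> time_space) \<le> emeasure \<pi> (({0..} \<inter> {0..real k}) \<times> cball 0 (real k))"
    proof (rule emeasure_mono)
      show "ball 0 (real k) \<inter> time_space \<subseteq> ({0..} \<inter> {0..real k}) \<times> cball (0::'z) (real k)"
      proof (clarsimp)
        fix a :: real and b :: 'z assume "norm (a, b) < real k" "0 \<le> a"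
        then show "a \<le> real k \<and> norm b \<le> real k"
          using norm_fst_le[of a b] norm_snd_le[of b a] by auto
      qed
      show "({0..} \<inter> {0..real k}) \<times> cball (0::'z) (real k) \<in> sets \<pi>"
        by (auto simp: sets_\<sigma> sets_halfline sets_restrict_space intro!: pair_measureI image_eqI[of _ _ "{0..real k}"])
    qed
    also have "\<dots> < \<infinity>" by (rule emeasure_\<pi>_box_finite)
    finally show ?thesis .
  qed
qed

declare L_meas[measurable]

lemma AE_time_pos: "AE x in \<pi>. 0 < fst x"
proof (rule AE_I[of _ _ "{0} \<times> UNIV"])
  show "emeasure \<pi> ({0} \<times> UNIV) = 0" by (rule emeasure_\<pi>_singleton_time)
  show "{0} \<times> UNIV \<in> sets \<pi>"
    by (auto simp: sets_\<sigma> sets_halfline sets_restrict_space intro!: pair_measureI image_eqI[of _ _ "{0}"])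
  show "{x \<in> space \<pi>. \<not> 0 < fst x} \<subseteq> {0} \<times> UNIV" by (auto simp: time_space_def)
qed

lemma subalgebra_filt_left: "subalgebra \<mu> (filt_left t)"
  using sets_filt_left_subset by (simp add: subalgebra_def sets_\<mu>)

lemma sigma_finite_subalgebra_filt_left: "sigma_finite_subalgebra \<mu> (filt_left t)"
  using subalgebra_filt_left
  by (intro finite_measure_subalgebra_is_sigma_finite)
    (simp add: finite_measure_subalgebra_def finite_measure_subalgebra_axioms_def finite_measure_axioms)

text \<open>The section of \<open>H\<close> at \<open>x\<close> factors through
  \<open>before (fst x)\<close>, which is measurable with respect to
  \<open>filt_left (fst x)\<close>.\<close>

lemma adapted:
  assumes H: "H \<in> measurable (\<pi> \<Otimes>\<^sub>M \<mu>) N" and na: "nonanticipating H" and x: "0 < fst x"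
  shows "(\<lambda>\<omega>. H (x, \<omega>)) \<in> measurable (filt_left (fst x)) N"
proof -
  have "x \<in> space \<pi>" using x by (cases x) (auto simp: time_space_def)
  then have "(\<lambda>\<omega>. H (x, \<omega>)) \<in> measurable \<mu> N"
    by (rule measurable_compose[OF measurable_Pair1' H])
  then have "(\<lambda>\<omega>. H (x, \<omega>)) \<in> measurable (config_borel time_space) N"
    by (simp cong: measurable_cong_sets add: sets_\<mu>)
  then have "(\<lambda>\<omega>. H (x, before (fst x) \<omega>)) \<in> measurable (filt_left (fst x)) N"
    by (rule measurable_compose[OF before_measurable[OF x]])
  then show ?thesis
    by (rule measurable_cong[THEN iffD1, rotated]) (use na x in \<open>simp add: nonanticipating_def del: split_paired_All\<close>)
qed

definition U :: "(real \<times> 'z) \<times> (real \<times> 'z) set \<Rightarrow> real" where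
  "U p = u (fst (fst p)) (snd (fst p)) (snd p)"

lemma U_measurable[measurable]: "U \<in> borel_measurable (\<pi> \<Otimes>\<^sub>M \<mu>)"
proof -
  let ?f = "\<lambda>(\<omega>, (t, z)). u t z \<omega>"
  have f: "?f \<in> borel_measurable predictable_sigma" using u_pred by (simp add: predictable_def)
  have "?f \<in> borel_measurable (config_borel time_space \<Otimes>\<^sub>M restrict_space borel time_space)"
  proof (rule measurableI)
    fix A :: "real set" assume "A \<in> sets borel"
    from measurable_sets[OF f this]
    show "?f -` A \<inter> space (config_borel time_space \<Otimes>\<^sub>M restrict_space borel time_space) \<in>
      sets (config_borel time_space \<Otimes>\<^sub>M restrict_space borel time_space)"
      using sets_predictable_sigma_subset
      by (auto simp: space_predictable_sigma space_pair_measure space_restrict_space)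
  qed simp
  then have "?f \<in> borel_measurable (\<mu> \<Otimes>\<^sub>M \<pi>)"
    by (simp cong: measurable_cong_sets add: sets_pair_measure_cong[OF sets_\<mu> sets_\<pi>])
  then have "(\<lambda>p. ?f (snd p, fst p)) \<in> borel_measurable (\<pi> \<Otimes>\<^sub>M \<mu>)" by measurable
  then show ?thesis by (simp add: U_def[abs_def] split_beta)
qed

text \<open>The level set of \<open>u\<close> through \<open>(\<omega>, x)\<close> is a predictable
  set, so it also contains the pair in which \<open>\<omega>\<close> is cut down to its strict
  past.\<close>

lemma U_nonanticipating: "nonanticipating U"
  unfolding nonanticipating_def
proof (intro ballI allI impI)
  fix \<omega> :: "(real \<times> 'z) set" and x :: "real \<times> 'z" assume \<omega>: "\<omega> \<in> configurations time_space" and x: "0 < fst x"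
  let ?f = "\<lambda>(\<omega>, (t, z)). u t z \<omega>"
  have f: "?f \<in> borel_measurable predictable_sigma" using u_pred by (simp add: predictable_def)
  have "?f -` {U (x, \<omega>)} \<inter> space predictable_sigma \<in> sets predictable_sigma"
    by (rule measurable_sets[OF f]) simp
  from predictable_before[OF this \<omega> _ x]
  have "(before (fst x) \<omega>, x) \<in> ?f -` {U (x, \<omega>)} \<inter> space predictable_sigma"
    using x \<omega> by (cases x) (auto simp: U_def space_predictable_sigma)
  then show "U (x, before (fst x) \<omega>) = U (x, \<omega>)" by (cases x) (auto simp: U_def)
qed

lemma L_integrable: "integrable \<mu> L"
proof -
  have "(\<integral>\<^sup>+\<omega>. ennreal (L \<omega>) \<partial>\<mu>) = (\<integral>\<^sup>+\<omega>. 1 \<partial>\<nu>)"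
    unfolding \<nu>_eq by (subst nn_integral_density) auto
  also have "\<dots> = 1" using prob_space.emeasure_space_1[OF prob_\<nu>] by simp
  finally show ?thesis
    using L_pos by (intro integrableI_nn_integral_finite[where x=1]) (auto elim: AE_mp)
qed

text \<open>Mecke's formula for the indicator of \<open>L \<omega> \<le> 0\<close>: a sum over
  points vanishes off that null event, so inserting a point almost never leaves the set where the
  density is positive.\<close>

lemma AE_insert_pos: "AE x in \<pi>. AE \<omega> in \<mu>. 0 < L (insert x \<omega>)"
proof -
  have m[measurable]: "(\<lambda>p. indicator {..0} (L (snd p)) :: ennreal) \<in> borel_measurable (\<pi> \<Otimes>\<^sub>M \<mu>)" by measurable
  have m2[measurable]: "(\<lambda>p. indicator {..0} (L (insert (fst p) (snd p))) :: ennreal) \<in> borel_measurable (\<pi> \<Otimes>\<^sub>M \<mu>)" by measurable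
  have "(\<integral>\<^sup>+x. \<integral>\<^sup>+\<omega>. indicator {..0} (L (insert x \<omega>)) \<partial>\<mu> \<partial>\<pi>) =
    (\<integral>\<^sup>+\<omega>. \<integral>\<^sup>+x. indicator {..0} (L \<omega>) \<partial>count_space \<omega> \<partial>\<mu>)"
    using mecke[OF m] by simp
  also have "\<dots> = (\<integral>\<^sup>+\<omega>. 0 \<partial>\<mu>)"
    using L_pos by (intro nn_integral_cong_AE) (auto elim!: AE_mp)
  finally have z: "(\<integral>\<^sup>+x. \<integral>\<^sup>+\<omega>. indicator {..0} (L (insert x \<omega>)) \<partial>\<mu> \<partial>\<pi>) = 0" by simp
  have "(\<lambda>x. \<integral>\<^sup>+\<omega>. indicator {..0} (L (insert x \<omega>)) \<partial>\<mu>) \<in> borel_measurable \<pi>"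
    using sigma_finite_measure.borel_measurable_nn_integral_fst[OF sigma_finite_measure_axioms m2] by simp
  from z nn_integral_0_iff_AE[OF this]
  have "AE x in \<pi>. (\<integral>\<^sup>+\<omega>. indicator {..0} (L (insert x \<omega>)) \<partial>\<mu>) = 0" by simp
  then show ?thesis
    using AE_space
  proof eventually_elim
    case (elim x)
    have [measurable]: "(\<lambda>\<omega>. L (insert x \<omega>)) \<in> borel_measurable \<mu>"
      using measurable_compose[OF measurable_Pair1'[OF elim(2)] measurable_compose[OF insert_measurable L_meas]] by simp
    have "AE \<omega> in \<mu>. indicator {..0} (L (insert x \<omega>)) = (0::ennreal)"
      using elim(1) by (subst (asm) nn_integral_0_iff_AE) auto
    then show ?case by eventually_elim (auto split: split_indicator_asm)
  qed
qed

text \<open>By \<open>L (insert x \<omega>) = grad t z L \<omega> + L \<omega>\<close> and the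
  formula for \<open>u\<close>, the conditional expectation of the left side given the strict past
  is \<open>1 + u\<close> times that of \<open>L\<close>. Both are positive, which forces
  \<open>u > -1\<close>. The test functions \<open>h\<close> are quantified inside the
  almost-everywhere statement, as they will depend on \<open>x\<close>.\<close>

lemma conditional_density:
  "AE x in \<pi>. (AE \<omega> in \<mu>. -1 < U (x, \<omega>)) \<and>
    (\<forall>h\<in>borel_measurable (filt_left (fst x)).
      (\<integral>\<^sup>+\<omega>. h \<omega> * ennreal (L (insert x \<omega>)) \<partial>\<mu>) =
      (\<integral>\<^sup>+\<omega>. h \<omega> * ennreal (1 + U (x, \<omega>)) * ennreal (L \<omega>) \<partial>\<mu>))"
  using AE_insert_pos u_eq grad_integrable AE_time_pos AE_space
proof eventually_elim
  case (elim x)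
  obtain t z where x: "x = (t, z)" by force
  define F where "F = (filt_left t :: (real \<times> 'z) set measure)"
  interpret F: sigma_finite_subalgebra \<mu> F
    unfolding F_def by (rule sigma_finite_subalgebra_filt_left)
  define Lx where "Lx \<omega> = L (insert x \<omega>)" for \<omega>
  have Lxm[measurable]: "Lx \<in> borel_measurable \<mu>"
    unfolding Lx_def using measurable_compose[OF measurable_Pair1'[OF elim(5)] measurable_compose[OF insert_measurable L_meas]] by simp
  have gr: "integrable \<mu> (grad t z L)" using elim(3) x by simp
  have Lxeq: "Lx = (\<lambda>\<omega>. grad t z L \<omega> + L \<omega>)" by (auto simp: Lx_def grad_def x)
  have Lxint: "integrable \<mu> Lx" unfolding Lxeq using gr L_integrable by simp
  have Lxpos: "AE \<omega> in \<mu>. 0 < Lx \<omega>" using elim(1) by (simp add: Lx_def)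
  have E1: "AE \<omega> in \<mu>. 0 < real_cond_exp \<mu> F L \<omega>" by (rule F.real_cond_exp_gr_c[OF L_integrable L_pos])
  have Ex: "AE \<omega> in \<mu>. 0 < real_cond_exp \<mu> F Lx \<omega>" by (rule F.real_cond_exp_gr_c[OF Lxint Lxpos])
  have sum: "AE \<omega> in \<mu>. real_cond_exp \<mu> F Lx \<omega> = real_cond_exp \<mu> F (grad t z L) \<omega> + real_cond_exp \<mu> F L \<omega>"
    unfolding Lxeq by (rule F.real_cond_exp_add[OF gr L_integrable])
  have ueq: "AE \<omega> in \<mu>. U (x, \<omega>) = real_cond_exp \<mu> F (grad t z L) \<omega> / real_cond_exp \<mu> F L \<omega>"
    using elim(2) by (simp add: U_def x F_def)
  have mult: "AE \<omega> in \<mu>. -1 < U (x, \<omega>) \<and> real_cond_exp \<mu> F Lx \<omega> = (1 + U (x, \<omega>)) * real_cond_exp \<mu> F L \<omega>"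
    using E1 Ex sum ueq
  proof eventually_elim
    case (elim \<omega>)
    have eq: "real_cond_exp \<mu> F Lx \<omega> = (1 + U (x, \<omega>)) * real_cond_exp \<mu> F L \<omega>"
      using elim(1) unfolding elim(3,4) by (simp add: field_simps)
    with elim(1,2) show ?case by (simp add: zero_less_mult_iff)
  qed
  show ?case
  proof (intro conjI ballI)
    show "AE \<omega> in \<mu>. -1 < U (x, \<omega>)" using mult by eventually_elim simp
    fix h :: "(real \<times> 'z) set \<Rightarrow> ennreal" assume "h \<in> borel_measurable (filt_left (fst x))"
    then have h[measurable]: "h \<in> borel_measurable F" by (simp add: F_def x)
    have UF[measurable]: "(\<lambda>\<omega>. U (x, \<omega>)) \<in> borel_measurable F"
      unfolding F_def using adapted[OF U_measurable U_nonanticipating elim(4)] x by simp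
    have nnL: "AE \<omega> in \<mu>. nn_cond_exp \<mu> F (\<lambda>x. ennreal (L x)) \<omega> = ennreal (real_cond_exp \<mu> F L \<omega>)"
      using L_pos by (intro F.nn_cond_exp_eq_real_cond_exp L_integrable) (auto elim: AE_mp)
    have nnLx: "AE \<omega> in \<mu>. nn_cond_exp \<mu> F (\<lambda>x. ennreal (Lx x)) \<omega> = ennreal (real_cond_exp \<mu> F Lx \<omega>)"
      using Lxpos by (intro F.nn_cond_exp_eq_real_cond_exp Lxint) (auto elim: AE_mp)
    have "(\<integral>\<^sup>+\<omega>. h \<omega> * ennreal (Lx \<omega>) \<partial>\<mu>) = (\<integral>\<^sup>+\<omega>. h \<omega> * nn_cond_exp \<mu> F (\<lambda>x. ennreal (Lx x)) \<omega> \<partial>\<mu>)"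
      by (rule F.nn_cond_exp_intg[symmetric]) auto
    \<comment> \<open>\<open>1 + U (x, \<omega>)\<close> is measurable for the strict past, so it
      joins \<open>h\<close> as a test function and the conditioning of \<open>L\<close> can be
      undone.\<close>
    also have "\<dots> = (\<integral>\<^sup>+\<omega>. (h \<omega> * ennreal (1 + U (x, \<omega>))) * nn_cond_exp \<mu> F (\<lambda>x. ennreal (L x)) \<omega> \<partial>\<mu>)"
      using mult nnL nnLx E1
      by (intro nn_integral_cong_AE, eventually_elim) (simp add: ennreal_mult mult.assoc)
    also have "\<dots> = (\<integral>\<^sup>+\<omega>. h \<omega> * ennreal (1 + U (x, \<omega>)) * ennreal (L \<omega>) \<partial>\<mu>)"
      by (rule F.nn_cond_exp_intg) auto
    finally show "(\<integral>\<^sup>+\<omega>. h \<omega> * ennreal (L (insert x \<omega>)) \<partial>\<mu>) =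
      (\<integral>\<^sup>+\<omega>. h \<omega> * ennreal (1 + U (x, \<omega>)) * ennreal (L \<omega>) \<partial>\<mu>)" by (simp add: Lx_def)
  qed
qed

text \<open>Mecke's formula inserts the point, nonanticipation removes it again from the argument of
  \<open>H\<close>, and \<open>conditional_density\<close> replaces the remaining
  \<open>L (insert x \<omega>)\<close> by \<open>(1 + U (x, \<omega>)) * L \<omega>\<close>, with
  \<open>H\<close> as the test function.\<close>

theorem girsanov:
  assumes [measurable]: "H \<in> borel_measurable (\<pi> \<Otimes>\<^sub>M \<mu>)" and na: "nonanticipating H"
  shows "(\<integral>\<^sup>+\<omega>. \<integral>\<^sup>+x. H (x, \<omega>) \<partial>count_space \<omega> \<partial>\<nu>) =
    (\<integral>\<^sup>+\<omega>. \<integral>\<^sup>+x. H (x, \<omega>) * ennreal (1 + U (x, \<omega>)) \<partial>\<pi> \<partial>\<nu>)"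
proof -
  have "(\<integral>\<^sup>+\<omega>. \<integral>\<^sup>+x. H (x, \<omega>) \<partial>count_space \<omega> \<partial>\<nu>) =
    (\<integral>\<^sup>+\<omega>. ennreal (L \<omega>) * (\<integral>\<^sup>+x. H (x, \<omega>) \<partial>count_space \<omega>) \<partial>\<mu>)"
    unfolding \<nu>_eq by (rule nn_integral_density) (auto intro: points_measurable)
  also have "\<dots> = (\<integral>\<^sup>+\<omega>. \<integral>\<^sup>+x. H (x, \<omega>) * ennreal (L \<omega>) \<partial>count_space \<omega> \<partial>\<mu>)"
    by (intro nn_integral_cong, subst nn_integral_multc) (auto simp: mult.commute)
  also have "\<dots> = (\<integral>\<^sup>+x. \<integral>\<^sup>+\<omega>. H (x, insert x \<omega>) * ennreal (L (insert x \<omega>)) \<partial>\<mu> \<partial>\<pi>)"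
    using mecke[of "\<lambda>p. H p * ennreal (L (snd p))"] by simp
  also have "\<dots> = (\<integral>\<^sup>+x. \<integral>\<^sup>+\<omega>. H (x, \<omega>) * ennreal (1 + U (x, \<omega>)) * ennreal (L \<omega>) \<partial>\<mu> \<partial>\<pi>)"
  proof (rule nn_integral_cong_AE)
    show "AE x in \<pi>. (\<integral>\<^sup>+\<omega>. H (x, insert x \<omega>) * ennreal (L (insert x \<omega>)) \<partial>\<mu>) =
      (\<integral>\<^sup>+\<omega>. H (x, \<omega>) * ennreal (1 + U (x, \<omega>)) * ennreal (L \<omega>) \<partial>\<mu>)"
      using conditional_density AE_time_pos AE_space
    proof eventually_elim
      case (elim x)
      have "H (x, insert x \<omega>) = H (x, \<omega>)" if "\<omega> \<in> space \<mu>" for \<omega>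
      proof -
        have "insert x \<omega> \<in> configurations time_space" "\<omega> \<in> configurations time_space"
          using that elim(2) configurations_insert[of \<omega> time_space x] by auto
        then show ?thesis
          using na elim(2) unfolding nonanticipating_def by (metis before_insert)
      qed
      then have "(\<integral>\<^sup>+\<omega>. H (x, insert x \<omega>) * ennreal (L (insert x \<omega>)) \<partial>\<mu>) =
        (\<integral>\<^sup>+\<omega>. H (x, \<omega>) * ennreal (L (insert x \<omega>)) \<partial>\<mu>)"
        by (intro nn_integral_cong) simp
      also have "\<dots> = (\<integral>\<^sup>+\<omega>. H (x, \<omega>) * ennreal (1 + U (x, \<omega>)) * ennreal (L \<omega>) \<partial>\<mu>)"
        using elim(1) adapted[OF assms elim(2)] by auto
      finally show ?case .
    qed
  qed
  also have "\<dots> = (\<integral>\<^sup>+\<omega>. \<integral>\<^sup>+x. H (x, \<omega>) * ennreal (1 + U (x, \<omega>)) * ennreal (L \<omega>) \<partial>\<pi> \<partial>\<mu>)"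
    by (rule P.Fubini'[symmetric]) simp
  also have "\<dots> = (\<integral>\<^sup>+\<omega>. ennreal (L \<omega>) * (\<integral>\<^sup>+x. H (x, \<omega>) * ennreal (1 + U (x, \<omega>)) \<partial>\<pi>) \<partial>\<mu>)"
  proof (rule nn_integral_cong)
    fix \<omega> assume \<omega>: "\<omega> \<in> space \<mu>"
    have [measurable]: "(\<lambda>x. H (x, \<omega>)) \<in> borel_measurable \<pi>" "(\<lambda>x. U (x, \<omega>)) \<in> borel_measurable \<pi>"
      using \<omega> by measurable
    show "(\<integral>\<^sup>+x. H (x, \<omega>) * ennreal (1 + U (x, \<omega>)) * ennreal (L \<omega>) \<partial>\<pi>) =
      ennreal (L \<omega>) * (\<integral>\<^sup>+x. H (x, \<omega>) * ennreal (1 + U (x, \<omega>)) \<partial>\<pi>)"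
      by (subst nn_integral_multc) (auto simp: mult.commute)
  qed
  also have "\<dots> = (\<integral>\<^sup>+\<omega>. \<integral>\<^sup>+x. H (x, \<omega>) * ennreal (1 + U (x, \<omega>)) \<partial>\<pi> \<partial>\<nu>)"
    unfolding \<nu>_eq by (rule nn_integral_density[symmetric]) measurable
  finally show ?thesis .
qed

lemma AE_\<nu>: "AE \<omega> in \<mu>. Q \<omega> \<Longrightarrow> AE \<omega> in \<nu>. Q \<omega>"
  unfolding \<nu>_eq by (subst AE_density) auto

end

text \<open>Cutting \<open>g\<close> off after \<open>s\<close> makes \<open>F s\<close> a total
  integral, which reduces the claim to the whole half-line.\<close>

lemma exp_indefinite_integral_partial:
  fixes g F :: "real \<Rightarrow> real"
  assumes int: "set_integrable lborel {0..} g"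
    and [measurable]: "g \<in> borel_measurable borel"
    and nonneg: "AE s in lborel. 0 \<le> s \<longrightarrow> 0 \<le> g s"
    and F: "\<And>t. 0 \<le> t \<Longrightarrow> F t = (LINT s:{0..t}|lborel. g s)"
    and s: "0 \<le> s"
  shows "(LINT t:{0..s}|lborel. exp (F t) * g t) = exp (F s) - 1"
proof -
  define g' where "g' t = indicator {..s} t * g t" for t
  define F' where "F' t = (LINT r:{0..t}|lborel. g' r)" for t
  have eq: "indicator {0..} t *\<^sub>R g' t = indicator {0..s} t *\<^sub>R g t" for t
    by (auto simp: g'_def split: split_indicator)
  have "set_integrable lborel {0..} g'"
    using set_integrable_subset[OF int, of "{0..s}"] unfolding set_integrable_def eq by simp
  moreover have [measurable]: "g' \<in> borel_measurable borel" unfolding g'_def by measurable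
  moreover have "AE t in lborel. 0 \<le> t \<longrightarrow> 0 \<le> g' t"
    using nonneg by eventually_elim (auto simp: g'_def split: split_indicator)
  moreover have "F s = (LINT t:{0..}|lborel. g' t)"
    using F[OF s] unfolding set_lebesgue_integral_def eq .
  ultimately have "(LINT t:{0..}|lborel. exp (F' t) * g' t) = exp (F s) - 1"
    by (intro exp_indefinite_integral(2)) (auto simp: F'_def)
  moreover have "(LINT t:{0..}|lborel. exp (F' t) * g' t) = (LINT t:{0..s}|lborel. exp (F t) * g t)"
    unfolding set_lebesgue_integral_def
  proof (intro Bochner_Integration.integral_cong refl)
    fix t
    have "F' t = F t" if "0 \<le> t" "t \<le> s"
      unfolding F'_def F[OF that(1)] set_lebesgue_integral_def
      using that by (intro Bochner_Integration.integral_cong) (auto simp: g'_def split: split_indicator)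
    then show "indicator {0..} t *\<^sub>R (exp (F' t) * g' t) = indicator {0..s} t *\<^sub>R (exp (F t) * g t)"
      by (auto simp: g'_def split: split_indicator)
  qed
  ultimately show ?thesis by simp
qed

text \<open>A later cut retains the whole strict past of \<open>x\<close>, so both sides equal the
  value on that past.\<close>

lemma nonanticipatingD:
  assumes "nonanticipating H" "\<omega> \<in> configurations time_space" "0 < fst x" "fst x \<le> t"
  shows "H (x, before t \<omega>) = H (x, \<omega>)"
proof -
  have "H (x, before (fst x) (before t \<omega>)) = H (x, before t \<omega>)" "H (x, before (fst x) \<omega>) = H (x, \<omega>)"
    using assms before_configurations[OF assms(2), of t] unfolding nonanticipating_def by blast+
  then show ?thesis using assms(4) by simp
qed

text \<open>Agreement is asked for positive times because nonanticipation says nothing at time 0; a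
  single point does not affect the integral.\<close>

lemma set_integral_before:
  fixes k :: "real \<Rightarrow> real"
  assumes "\<And>s. 0 < s \<Longrightarrow> s \<le> t \<Longrightarrow> k s = k' s"
  shows "(LINT s:{0..t}|lborel. k s) = (LINT s:{0..t}|lborel. k' s)"
  unfolding set_lebesgue_integral_def
proof (rule integral_discrete_difference[of "{0}"])
  show "indicator {0..t} s *\<^sub>R k s = indicator {0..t} s *\<^sub>R k' s" if "s \<notin> {0}" for s
    using assms[of s] that by (auto split: split_indicator)
qed auto

lemma max_measurable_halfline[measurable]: "(\<lambda>s::real. max 0 s) \<in> measurable borel halfline"
proof -
  have "(\<lambda>s::real. max 0 s) \<in> measurable borel (restrict_space borel {0..})"
    by (intro measurable_restrict_space2) auto
  then show ?thesis by (simp cong: measurable_cong_sets add: sets_halfline)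
qed

lemma fst_measurable_halfline[measurable]: "(\<lambda>s::real. s) \<in> measurable halfline borel"
  using measurable_restrict_borel[of "{0::real..}"] by (simp cong: measurable_cong_sets add: sets_halfline)

lemma AE_halfline: "(AE t in halfline. Q t) \<longleftrightarrow> (AE t in lborel. 0 \<le> t \<longrightarrow> Q t)"
  unfolding halfline_def by (subst AE_restrict_space_iff) auto

section \<open>The time change as a function of point and configuration\<close>

context poisson_density
begin

definition V :: "(real \<times> 'z) \<times> (real \<times> 'z) set \<Rightarrow> real" where
  "V p = time_change u (fst (fst p)) (snd (fst p)) (snd p)"

text \<open>Clamping the time at 0 keeps the argument of \<open>U\<close> in the half-line for every
  real \<open>s\<close>, so that the integrand is jointly measurable over the whole line.\<close>

lemma time_integral_U: "time_integral u t z \<omega> = (LINT s:{0..t}|lborel. U ((max 0 s, z), \<omega>))"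
  unfolding time_integral_def set_lebesgue_integral_def
  by (intro Bochner_Integration.integral_cong) (auto simp: U_def split: split_indicator)

lemma set_integral_measurable:
  fixes k :: "(real \<times> 'z) \<times> (real \<times> 'z) set \<Rightarrow> real \<Rightarrow> real"
  assumes [measurable]: "(\<lambda>q. k (fst q) (snd q)) \<in> borel_measurable ((\<pi> \<Otimes>\<^sub>M \<mu>) \<Otimes>\<^sub>M borel)"
  shows "(\<lambda>p. LINT s:{0..fst (fst p)}|lborel. k p s) \<in> borel_measurable (\<pi> \<Otimes>\<^sub>M \<mu>)"
proof -
  have "(\<lambda>(p, s). indicator {0..fst (fst p)} s *\<^sub>R k p s) \<in> borel_measurable ((\<pi> \<Otimes>\<^sub>M \<mu>) \<Otimes>\<^sub>M lborel)"
  proof -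
    have "(\<lambda>q. if 0 \<le> snd q \<and> snd q \<le> fst (fst (fst q)) then k (fst q) (snd q) else 0)
      \<in> borel_measurable ((\<pi> \<Otimes>\<^sub>M \<mu>) \<Otimes>\<^sub>M borel)" by measurable
    also have "(\<lambda>q. if 0 \<le> snd q \<and> snd q \<le> fst (fst (fst q)) then k (fst q) (snd q) else 0) =
      (\<lambda>(p, s). indicator {0..fst (fst p)} s *\<^sub>R k p s)" by (auto simp: fun_eq_iff split: split_indicator)
    finally show ?thesis
      by (simp cong: measurable_cong_sets add: sets_pair_measure_cong[OF refl sets_lborel])
  qed
  then show ?thesis
    unfolding set_lebesgue_integral_def by (rule lborel.borel_measurable_lebesgue_integral)
qed

lemma V_measurable[measurable]: "V \<in> borel_measurable (\<pi> \<Otimes>\<^sub>M \<mu>)"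
proof -
  have [measurable]: "(\<lambda>p. time_integral u (fst (fst p)) (snd (fst p)) (snd p)) \<in> borel_measurable (\<pi> \<Otimes>\<^sub>M \<mu>)"
    unfolding time_integral_U by (rule set_integral_measurable) measurable
  have "(\<lambda>p. fst (fst p) + time_integral u (fst (fst p)) (snd (fst p)) (snd p)) \<in> borel_measurable (\<pi> \<Otimes>\<^sub>M \<mu>)"
    by measurable
  then show ?thesis by (simp add: V_def[abs_def] time_change_def)
qed

lemma V_nonanticipating: "nonanticipating V"
  unfolding nonanticipating_def
proof (intro ballI allI impI)
  fix \<omega> :: "(real \<times> 'z) set" and x :: "real \<times> 'z" assume \<omega>: "\<omega> \<in> configurations time_space" and x: "0 < fst x"
  have "time_integral u (fst x) (snd x) (before (fst x) \<omega>) = time_integral u (fst x) (snd x) \<omega>"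
    unfolding time_integral_def
  proof (rule set_integral_before)
    fix s assume "0 < s" "s \<le> fst x"
    then have "U ((s, snd x), before (fst x) \<omega>) = U ((s, snd x), \<omega>)"
      by (intro nonanticipatingD[OF U_nonanticipating \<omega>]) auto
    then show "u s (snd x) (before (fst x) \<omega>) = u s (snd x) \<omega>" by (simp add: U_def)
  qed
  then show "V (x, before (fst x) \<omega>) = V (x, \<omega>)" by (simp add: V_def time_change_def)
qed

lemma AE_U_gt: "AE \<omega> in \<mu>. AE x in \<pi>. -1 < U (x, \<omega>)"
proof -
  have "AE x in \<pi>. AE \<omega> in \<mu>. -1 < U (x, \<omega>)" using conditional_density by eventually_elim simp
  moreover have "{p \<in> space (\<pi> \<Otimes>\<^sub>M \<mu>). -1 < U (fst p, snd p)} \<in> sets (\<pi> \<Otimes>\<^sub>M \<mu>)" by measurable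
  ultimately show ?thesis by (subst (asm) P.AE_commute) auto
qed

text \<open>Brings the location outside, since the substitution is carried out in time at a fixed
  location.\<close>

lemma AE_swap_halfline:
  assumes "AE x in \<pi>. Q x" and m: "{x \<in> space \<pi>. Q x} \<in> sets \<pi>"
  shows "AE z in \<sigma>. AE t in halfline. Q (t, z)"
proof -
  have "AE t in halfline. AE z in \<sigma>. Q (t, z)" using \<pi>.AE_pair[OF assms(1)] by simp
  then show ?thesis by (subst (asm) \<pi>.AE_commute) (use m in auto)
qed

end

locale poisson_time_change = poisson_density \<sigma> \<mu> \<nu> L u
  for \<sigma> :: "'z::euclidean_space measure" and \<mu> \<nu> :: "(real \<times> 'z) set measure"
    and L :: "(real \<times> 'z) set \<Rightarrow> real" and u :: "real \<Rightarrow> 'z \<Rightarrow> (real \<times> 'z) set \<Rightarrow> real" +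
  assumes integral_welldef: "AE \<omega> in \<mu>. AE z in \<sigma>. \<forall>t\<ge>0. set_integrable lborel {0..t} (\<lambda>s. u s z \<omega>)"
    and inverse_welldef: "AE \<omega> in \<mu>. AE z in \<sigma>. bij_betw (\<lambda>t. time_change u t z \<omega>) {0..} {0..}"
begin

text \<open>Substitution with derivative \<open>1 + u\<close>, which is nonnegative at almost every
  time. The quantifier over \<open>h\<close> stands inside both almost-everywhere statements,
  because \<open>h\<close> will be the slice at \<open>z\<close> of a function on time and
  space.\<close>

lemma AE_time_change:
  "AE \<omega> in \<mu>. AE z in \<sigma>. bij_betw (\<lambda>t. V ((t, z), \<omega>)) {0..} {0..} \<and> mono_on {0..} (\<lambda>t. V ((t, z), \<omega>)) \<and>
    (\<forall>h\<in>borel_measurable borel. (\<integral>\<^sup>+t. h (V ((t, z), \<omega>)) * ennreal (1 + U ((t, z), \<omega>)) \<partial>halfline) =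
      (\<integral>\<^sup>+r. h r \<partial>halfline))"
  using integral_welldef inverse_welldef AE_U_gt AE_space
proof eventually_elim
  case (elim \<omega>)
  have [measurable]: "(\<lambda>x. U (x, \<omega>)) \<in> borel_measurable \<pi>" using elim(4) by measurable
  have "{x \<in> space \<pi>. -1 < U (x, \<omega>)} \<in> sets \<pi>" by measurable
  note swap = AE_swap_halfline[OF elim(3) this]
  show ?case
    using elim(1,2) swap
  proof eventually_elim
    case (elim z)
    define g where "g s = 1 + U ((max 0 s, z), \<omega>)" for s
    define F where "F t = V ((t, z), \<omega>)" for t
    have [measurable]: "g \<in> borel_measurable borel" unfolding g_def by measurable
    have ueq: "indicator {0..t} s *\<^sub>R g s = indicator {0..t} s *\<^sub>R (1 + u s z \<omega>)" for s t
      by (auto simp: g_def U_def split: split_indicator)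
    have int1: "set_integrable lborel {0..t} (\<lambda>s. 1::real)" for t :: real
      unfolding set_integrable_def by (auto intro!: integrable_real_indicator simp: emeasure_lborel_Icc_eq)
    have int: "set_integrable lborel {0..t} g" if "0 \<le> t" for t
    proof -
      have "set_integrable lborel {0..t} (\<lambda>s. 1 + u s z \<omega>)"
        using elim(1) that int1 by (intro set_integral_add) auto
      then show ?thesis unfolding set_integrable_def ueq .
    qed
    have F: "F t = (LINT s:{0..t}|lborel. g s)" if "0 \<le> t" for t
    proof -
      have "(LINT s:{0..t}|lborel. g s) = (LINT s:{0..t}|lborel. 1 + u s z \<omega>)"
        unfolding set_lebesgue_integral_def ueq ..
      also have "\<dots> = (LINT s:{0..t}|lborel. 1) + (LINT s:{0..t}|lborel. u s z \<omega>)"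
        using elim(1) that int1 by (intro set_integral_add) auto
      also have "(LINT s:{0..t}|lborel. 1) = t" using that by (simp add: set_lebesgue_integral_def)
      finally show ?thesis by (simp add: F_def V_def time_change_def time_integral_def)
    qed
    have nonneg: "AE s in lborel. 0 \<le> s \<longrightarrow> 0 \<le> g s"
      using elim(3) unfolding AE_halfline by eventually_elim (auto simp: g_def)
    have bij: "bij_betw F {0..} {0..}" using elim(2) by (simp add: F_def[abs_def] V_def)
    have mono: "mono_on {0..} F"
    proof (rule mono_onI)
      fix s t :: real assume st: "s \<in> {0..}" "t \<in> {0..}" "s \<le> t"
      have "(LINT r:{0..s}|lborel. g r) \<le> (LINT r:{0..t}|lborel. g r)"
        unfolding set_lebesgue_integral_def
      proof (rule integral_mono_AE)
        show "AE r in lborel. indicator {0..s} r *\<^sub>R g r \<le> indicator {0..t} r *\<^sub>R g r"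
          using nonneg by eventually_elim (use st in \<open>auto split: split_indicator\<close>)
      qed (use int st in \<open>auto simp: set_integrable_def\<close>)
      then show "F s \<le> F t" using F st by simp
    qed
    define C where "C = (\<integral>\<^sup>+s. ennreal (g s) * indicator {0..} s \<partial>lborel)"
    have FC: "ennreal (F t) \<le> C" if t: "0 \<le> t" for t
    proof -
      have "ennreal (F t) = (\<integral>\<^sup>+s. ennreal (indicator {0..t} s *\<^sub>R g s) \<partial>lborel)"
        unfolding F[OF t] set_lebesgue_integral_def
      proof (rule nn_integral_eq_integral[symmetric])
        show "AE s in lborel. 0 \<le> indicator {0..t} s *\<^sub>R g s"
          using nonneg by eventually_elim (auto split: split_indicator)
      qed (use int[OF t] in \<open>simp add: set_integrable_def\<close>)
      also have "\<dots> \<le> C" unfolding C_def by (intro nn_integral_mono) (auto split: split_indicator)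
      finally show ?thesis .
    qed
    \<comment> \<open>Surjectivity of the time change onto the half-line excludes a finite total
      mass, so the image measure is Lebesgue measure on all of \<open>{0..}\<close>.\<close>
    have "C = top"
    proof (rule ccontr)
      assume "C \<noteq> top"
      then obtain c where c: "C = ennreal c" "0 \<le> c" by (cases C) auto
      have "c + 1 \<in> F ` {0..}" using bij c(2) by (auto simp: bij_betw_def)
      then obtain t where "0 \<le> t" "F t = c + 1" by auto
      then show False using FC[of t] c by (simp add: ennreal_le_iff)
    qed
    have "(\<integral>\<^sup>+t. h (F t) * ennreal (1 + U ((t, z), \<omega>)) \<partial>halfline) = (\<integral>\<^sup>+r. h r \<partial>halfline)"
      if h[measurable]: "h \<in> borel_measurable borel" for h
    proof -
      have "(\<integral>\<^sup>+t. h (F t) * ennreal (1 + U ((t, z), \<omega>)) \<partial>halfline) =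
        (\<integral>\<^sup>+t. h (F t) * ennreal (g t) * indicator {0..} t \<partial>lborel)"
        unfolding nn_integral_halfline by (intro nn_integral_cong) (auto simp: g_def split: split_indicator)
      also have "\<dots> = (\<integral>\<^sup>+r. h r * indicator {r. 0 \<le> r \<and> ennreal r < C} r \<partial>lborel)"
        by (rule nn_integral_indefinite_integral_substitution[OF int _ nonneg F _ C_def]) auto
      also have "\<dots> = (\<integral>\<^sup>+r. h r \<partial>halfline)"
        unfolding nn_integral_halfline \<open>C = top\<close> by (intro nn_integral_cong) (auto split: split_indicator)
      finally show ?thesis .
    qed
    then show ?case using bij mono unfolding F_def by blast
  qed
qed

text \<open>At \<open>r = time_change u t z \<omega>\<close> the difference
  \<open>r - time_change_inv u r z \<omega>\<close> is the time integral of \<open>u\<close>, and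
  the time change carries \<open>(1 + u) dt\<close> to \<open>dr\<close>.\<close>

lemma cost_eq_inverse_cost:
  "(\<integral>\<^sup>+\<omega>. ennreal (L \<omega>) *
      (\<integral>\<^sup>+z. (\<integral>\<^sup>+t. ennreal (\<bar>time_integral u t z \<omega>\<bar>\<^sup>2 * (1 + u t z \<omega>)) \<partial>halfline) \<partial>\<sigma>) \<partial>\<mu>) =
   (\<integral>\<^sup>+\<omega>. ennreal (L \<omega>) *
      (\<integral>\<^sup>+z. (\<integral>\<^sup>+r. ennreal (\<bar>r - time_change_inv u r z \<omega>\<bar>\<^sup>2) \<partial>halfline) \<partial>\<sigma>) \<partial>\<mu>)"
proof (rule nn_integral_cong_AE)
  show "AE \<omega> in \<mu>. ennreal (L \<omega>) *
      (\<integral>\<^sup>+z. (\<integral>\<^sup>+t. ennreal (\<bar>time_integral u t z \<omega>\<bar>\<^sup>2 * (1 + u t z \<omega>)) \<partial>halfline) \<partial>\<sigma>) =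
      ennreal (L \<omega>) * (\<integral>\<^sup>+z. (\<integral>\<^sup>+r. ennreal (\<bar>r - time_change_inv u r z \<omega>\<bar>\<^sup>2) \<partial>halfline) \<partial>\<sigma>)"
    using AE_time_change
  proof eventually_elim
    case (elim \<omega>)
    have "(\<integral>\<^sup>+z. (\<integral>\<^sup>+t. ennreal (\<bar>time_integral u t z \<omega>\<bar>\<^sup>2 * (1 + u t z \<omega>)) \<partial>halfline) \<partial>\<sigma>) =
      (\<integral>\<^sup>+z. (\<integral>\<^sup>+r. ennreal (\<bar>r - time_change_inv u r z \<omega>\<bar>\<^sup>2) \<partial>halfline) \<partial>\<sigma>)"
    proof (rule nn_integral_cong_AE)
      show "AE z in \<sigma>. (\<integral>\<^sup>+t. ennreal (\<bar>time_integral u t z \<omega>\<bar>\<^sup>2 * (1 + u t z \<omega>)) \<partial>halfline) =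
        (\<integral>\<^sup>+r. ennreal (\<bar>r - time_change_inv u r z \<omega>\<bar>\<^sup>2) \<partial>halfline)"
        using elim
      proof eventually_elim
        case (elim z)
        define F where "F t = V ((t, z), \<omega>)" for t
        define J where "J = the_inv_into {0..} F"
        have bij: "bij_betw F {0..} {0..}" and mono: "mono_on {0..} F" using elim by (auto simp: F_def[abs_def])
        have JF: "J (F t) = t" if "0 \<le> t" for t
          unfolding J_def using bij that by (intro the_inv_into_f_f) (auto simp: bij_betw_def)
        have FJ: "F (J r) = r" and J0: "0 \<le> J r" if "0 \<le> r" for r
        proof -
          have r: "r \<in> F ` {0..}" using bij that by (auto simp: bij_betw_def)
          show "F (J r) = r" unfolding J_def using bij r by (intro f_the_inv_into_f) (auto simp: bij_betw_def)
          show "0 \<le> J r" using the_inv_into_into[OF _ r, of "{0..}"] bij by (auto simp: bij_betw_def J_def)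
        qed
        have inv: "time_change_inv u r z \<omega> = J r" for r
          unfolding time_change_inv_def J_def F_def V_def by simp
        \<comment> \<open>Extended to negative arguments by clamping, the inverse is monotone on the
          whole line and hence Borel, as the substitution demands.\<close>
        define J' where "J' r = J (max 0 r)" for r
        have "mono J'"
        proof (rule monoI)
          fix a b :: real assume "a \<le> b"
          then have ab: "max 0 a \<le> max 0 b" by simp
          show "J' a \<le> J' b"
          proof (rule ccontr)
            assume "\<not> J' a \<le> J' b"
            then have lt: "J (max 0 b) < J (max 0 a)" by (simp add: J'_def)
            then have "F (J (max 0 b)) \<le> F (J (max 0 a))" using J0 by (intro mono_onD[OF mono]) auto
            then have "max 0 a = max 0 b" using FJ[of "max 0 a"] FJ[of "max 0 b"] ab by simp
            then show False using lt by simp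
          qed
        qed
        then have [measurable]: "J' \<in> borel_measurable borel" by (rule borel_measurable_mono)
        have "(\<integral>\<^sup>+t. ennreal (\<bar>time_integral u t z \<omega>\<bar>\<^sup>2 * (1 + u t z \<omega>)) \<partial>halfline) =
          (\<integral>\<^sup>+t. ennreal (\<bar>F t - J' (F t)\<bar>\<^sup>2) * ennreal (1 + U ((t, z), \<omega>)) \<partial>halfline)"
        proof (rule nn_integral_cong)
          fix t assume "t \<in> space halfline"
          then have t: "0 \<le> t" by simp
          have "F t \<in> {0..}" using bij t by (auto simp: bij_betw_def)
          then have "F t - J' (F t) = time_integral u t z \<omega>"
            using JF[OF t] by (simp add: J'_def max_def) (simp add: F_def V_def time_change_def)
          then show "ennreal (\<bar>time_integral u t z \<omega>\<bar>\<^sup>2 * (1 + u t z \<omega>)) =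
            ennreal (\<bar>F t - J' (F t)\<bar>\<^sup>2) * ennreal (1 + U ((t, z), \<omega>))"
            by (simp add: ennreal_mult' U_def)
        qed
        also have "\<dots> = (\<integral>\<^sup>+r. ennreal (\<bar>r - J' r\<bar>\<^sup>2) \<partial>halfline)"
        proof -
          have "(\<lambda>r. ennreal (\<bar>r - J' r\<bar>\<^sup>2)) \<in> borel_measurable borel" by measurable
          then show ?thesis using elim by (auto simp: F_def)
        qed
        also have "\<dots> = (\<integral>\<^sup>+r. ennreal (\<bar>r - time_change_inv u r z \<omega>\<bar>\<^sup>2) \<partial>halfline)"
          by (intro nn_integral_cong) (simp add: inv J'_def max_def)
        finally show ?case .
      qed
    qed
    then show ?case by simp
  qed
qed

end

section \<open>The transported configuration and its mean measure\<close>

context poisson_time_change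
begin

sublocale \<nu>: prob_space \<nu> by (rule prob_\<nu>)

lemma sets_\<nu>[measurable_cong]: "sets \<nu> = sets \<mu>"
  by (simp add: \<nu>_eq)

lemma space_\<nu>[simp]: "space \<nu> = configurations time_space"
  using sets_eq_imp_space_eq[OF sets_\<nu>] by simp

lemma shift_measurable[measurable]:
  "(\<lambda>p. (V p, snd (fst p))) \<in> measurable (\<pi> \<Otimes>\<^sub>M \<mu>) borel"
proof -
  have [measurable]: "(\<lambda>p. snd (fst p)) \<in> borel_measurable (\<pi> \<Otimes>\<^sub>M \<mu>)"
    using measurable_compose[OF measurable_fst measurable_snd, of halfline \<sigma> \<mu>]
    by (simp cong: measurable_cong_sets add: sets_\<sigma>)
  show ?thesis by (rule borel_measurable_Pair) measurable
qed

text \<open>At almost every location the time change maps \<open>(1 + u) dt\<close> to Lebesgue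
  measure, and it keeps the location; so the compensator, transported along it, is the deterministic
  \<open>\<pi>\<close>.\<close>

lemma AE_time_changed_integral:
  "AE \<omega> in \<mu>. \<forall>k\<in>borel_measurable borel.
    (\<integral>\<^sup>+x. k (V (x, \<omega>), snd x) * ennreal (1 + U (x, \<omega>)) \<partial>\<pi>) = (\<integral>\<^sup>+x. k x \<partial>\<pi>)"
  using AE_time_change AE_space
proof eventually_elim
  case (elim \<omega>)
  show ?case
  proof
    fix k :: "real \<times> 'z \<Rightarrow> ennreal" assume k[measurable]: "k \<in> borel_measurable borel"
    have [measurable]: "k \<in> borel_measurable \<pi>" by (rule borel_measurable_\<pi>[OF k])
    have "(\<lambda>p. k (V p, snd (fst p)) * ennreal (1 + U p)) \<in> borel_measurable (\<pi> \<Otimes>\<^sub>M \<mu>)"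
      using measurable_compose[OF shift_measurable k] by measurable
    from measurable_compose[OF measurable_Pair2'[OF elim(2)] this]
    have m: "(\<lambda>x. k (V (x, \<omega>), snd x) * ennreal (1 + U (x, \<omega>))) \<in> borel_measurable \<pi>" by simp
    have "(\<integral>\<^sup>+x. k (V (x, \<omega>), snd x) * ennreal (1 + U (x, \<omega>)) \<partial>\<pi>) =
      (\<integral>\<^sup>+z. \<integral>\<^sup>+t. k (V ((t, z), \<omega>), z) * ennreal (1 + U ((t, z), \<omega>)) \<partial>halfline \<partial>\<sigma>)"
      using \<pi>.nn_integral_snd[OF m] by simp
    also have "\<dots> = (\<integral>\<^sup>+z. \<integral>\<^sup>+r. k (r, z) \<partial>halfline \<partial>\<sigma>)"
    proof (rule nn_integral_cong_AE)
      show "AE z in \<sigma>. (\<integral>\<^sup>+t. k (V ((t, z), \<omega>), z) * ennreal (1 + U ((t, z), \<omega>)) \<partial>halfline) = (\<integral>\<^sup>+r. k (r, z) \<partial>halfline)"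
        using elim(1)
      proof eventually_elim
        case (elim z)
        have "(\<lambda>r. k (r, z)) \<in> borel_measurable borel"
          by (rule measurable_compose[OF _ k]) (intro borel_measurable_continuous_onI continuous_intros)
        then show ?case using elim by auto
      qed
    qed
    also have "\<dots> = (\<integral>\<^sup>+x. k x \<partial>\<pi>)" by (rule \<pi>.nn_integral_snd) measurable
    finally show "(\<integral>\<^sup>+x. k (V (x, \<omega>), snd x) * ennreal (1 + U (x, \<omega>)) \<partial>\<pi>) = (\<integral>\<^sup>+x. k x \<partial>\<pi>)" .
  qed
qed

text \<open>First-moment version of the claim that the transported points are Poisson. It is
  available before the law is known, and yields nonnegativity of the new times and local
  finiteness.\<close>

lemma mean_time_changed:
  assumes k[measurable]: "k \<in> borel_measurable borel"
  shows "(\<integral>\<^sup>+\<omega>. \<integral>\<^sup>+x. k (V (x, \<omega>), snd x) \<partial>count_space \<omega> \<partial>\<nu>) = (\<integral>\<^sup>+x. k x \<partial>\<pi>)"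
proof -
  have "(\<integral>\<^sup>+\<omega>. \<integral>\<^sup>+x. k (V (x, \<omega>), snd x) \<partial>count_space \<omega> \<partial>\<nu>) =
    (\<integral>\<^sup>+\<omega>. \<integral>\<^sup>+x. k (V (x, \<omega>), snd x) * ennreal (1 + U (x, \<omega>)) \<partial>\<pi> \<partial>\<nu>)"
  proof -
    have "(\<lambda>p. k (V p, snd (fst p))) \<in> borel_measurable (\<pi> \<Otimes>\<^sub>M \<mu>)"
      by (rule measurable_compose[OF shift_measurable k])
    moreover have "nonanticipating (\<lambda>p. k (V p, snd (fst p)))"
      using V_nonanticipating by (simp add: nonanticipating_def del: split_paired_All)
    ultimately show ?thesis using girsanov[of "\<lambda>p. k (V p, snd (fst p))"] by simp
  qed
  also have "\<dots> = (\<integral>\<^sup>+\<omega>. (\<integral>\<^sup>+x. k x \<partial>\<pi>) \<partial>\<nu>)"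
    by (intro nn_integral_cong_AE AE_\<nu>) (use AE_time_changed_integral in eventually_elim, simp)
  also have "\<dots> = (\<integral>\<^sup>+x. k x \<partial>\<pi>)" using \<nu>.emeasure_space_1 by simp
  finally show ?thesis .
qed

text \<open>Distinct times are needed for the jump identity, distinct locations for injectivity of
  the transport, positive times because nonanticipation starts there, and the two conditions on
  \<open>V\<close> for the transport to be a configuration again.\<close>

definition good :: "(real \<times> 'z) set \<Rightarrow> bool" where
  "good \<omega> \<longleftrightarrow> \<omega> \<in> configurations time_space \<and> (\<forall>x\<in>\<omega>. 0 < fst x \<and> 0 \<le> V (x, \<omega>)) \<and>
    inj_on fst \<omega> \<and> inj_on snd \<omega> \<and> (\<forall>n::nat. finite {x \<in> \<omega>. V (x, \<omega>) \<le> real n \<and> norm (snd x) \<le> real n})"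

text \<open>The conditions on the points alone hold under \<open>\<mu>\<close> and pass to the
  absolutely continuous \<open>\<nu>\<close>. Those on \<open>V\<close> are read off under
  \<open>\<nu>\<close> itself, where the mean number of transported points in a set is its
  intensity: zero for negative times, finite for bounded boxes.\<close>

lemma AE_good: "AE \<omega> in \<nu>. good \<omega>"
proof -
  have fst_inj: "AE \<omega> in \<mu>. inj_on fst \<omega>"
  proof (rule AE_inj_on_points)
    fix x :: "real \<times> 'z" assume "x \<in> time_space"
    then have eq: "{y \<in> time_space. fst y = fst x} = {fst x} \<times> UNIV" by auto
    show "emeasure \<pi> {y \<in> time_space. fst y = fst x} = 0" unfolding eq by (rule emeasure_\<pi>_singleton_time)
  qed (intro borel_measurable_continuous_onI continuous_intros)
  have snd_inj: "AE \<omega> in \<mu>. inj_on snd \<omega>"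
  proof (rule AE_inj_on_points)
    fix x :: "real \<times> 'z" assume "x \<in> time_space"
    have eq: "{y \<in> time_space. snd y = snd x} = {0..} \<times> {snd x}" by auto
    show "emeasure \<pi> {y \<in> time_space. snd y = snd x} = 0" unfolding eq by (rule emeasure_\<pi>_singleton_space)
  qed (intro borel_measurable_continuous_onI continuous_intros)
  have pos: "AE \<omega> in \<mu>. \<forall>x\<in>\<omega>. 0 < fst x"
  proof -
    have m: "(\<lambda>x. indicator {..0} (fst x) :: ennreal) \<in> borel_measurable \<pi>" by measurable
    have "(\<integral>\<^sup>+\<omega>. \<integral>\<^sup>+x. indicator {..0} (fst x) \<partial>count_space \<omega> \<partial>\<mu>) = (\<integral>\<^sup>+x. indicator {..0} (fst x) \<partial>\<pi>)"
      by (rule mean_points[OF m])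
    also have "\<dots> = (\<integral>\<^sup>+x. 0 \<partial>\<pi>)"
      using AE_time_pos by (intro nn_integral_cong_AE) (auto elim!: AE_mp)
    finally have z: "(\<integral>\<^sup>+\<omega>. \<integral>\<^sup>+x. indicator {..0} (fst x) \<partial>count_space \<omega> \<partial>\<mu>) = 0" by simp
    have "(\<lambda>\<omega>. \<integral>\<^sup>+x. indicator {..0} (fst x) \<partial>count_space \<omega>) \<in> borel_measurable \<mu>"
      using points_measurable[of "\<lambda>p. indicator {..0} (fst (fst p))"] m by simp
    from z nn_integral_0_iff_AE[OF this]
    have "AE \<omega> in \<mu>. (\<integral>\<^sup>+x. indicator {..0} (fst x) \<partial>count_space \<omega>) = (0::ennreal)" by simp
    then show ?thesis
      by eventually_elim (auto simp: nn_integral_0_iff_AE AE_count_space indicator_eq_0_iff)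
  qed
  have meas: "(\<lambda>\<omega>. \<integral>\<^sup>+x. indicator Q (V (x, \<omega>), snd x) \<partial>count_space \<omega>) \<in> borel_measurable \<nu>"
    if Q: "Q \<in> sets borel" for Q
  proof -
    have "(\<lambda>p. indicator Q (V p, snd (fst p)) :: ennreal) \<in> borel_measurable (\<pi> \<Otimes>\<^sub>M \<mu>)"
      using borel_measurable_indicator[OF Q] by (rule measurable_compose[OF shift_measurable])
    from points_measurable[OF this] show ?thesis by (simp cong: measurable_cong_sets add: sets_\<nu>)
  qed
  have Vpos: "AE \<omega> in \<nu>. \<forall>x\<in>\<omega>. 0 \<le> V (x, \<omega>)"
  proof -
    have Q: "{..<0} \<times> UNIV \<in> sets (borel :: (real \<times> 'z) measure)" by (intro borel_Times) auto
    have "(\<integral>\<^sup>+\<omega>. \<integral>\<^sup>+x. indicator ({..<0} \<times> UNIV) (V (x, \<omega>), snd x) \<partial>count_space \<omega> \<partial>\<nu>) =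
      (\<integral>\<^sup>+x. indicator ({..<0} \<times> UNIV) x \<partial>\<pi>)"
      using Q by (intro mean_time_changed) auto
    also have "\<dots> = (\<integral>\<^sup>+x. 0 \<partial>\<pi>)" by (intro nn_integral_cong) (auto split: split_indicator)
    finally have z: "(\<integral>\<^sup>+\<omega>. \<integral>\<^sup>+x. indicator ({..<0} \<times> UNIV) (V (x, \<omega>), snd x) \<partial>count_space \<omega> \<partial>\<nu>) = 0" by simp
    from z nn_integral_0_iff_AE[OF meas[OF Q]]
    have "AE \<omega> in \<nu>. (\<integral>\<^sup>+x. indicator ({..<0} \<times> UNIV) (V (x, \<omega>), snd x) \<partial>count_space \<omega>) = (0::ennreal)" by simp
    then show ?thesis
      by eventually_elim (auto simp: nn_integral_0_iff_AE AE_count_space indicator_eq_0_iff not_less)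
  qed
  have fin: "AE \<omega> in \<nu>. finite {x \<in> \<omega>. V (x, \<omega>) \<le> real n \<and> norm (snd x) \<le> real n}" for n :: nat
  proof -
    let ?Q = "{..real n} \<times> cball (0::'z) (real n)"
    have Q: "?Q \<in> sets borel" by (intro borel_Times) auto
    have "(\<integral>\<^sup>+\<omega>. \<integral>\<^sup>+x. indicator ?Q (V (x, \<omega>), snd x) \<partial>count_space \<omega> \<partial>\<nu>) = (\<integral>\<^sup>+x. indicator ?Q x \<partial>\<pi>)"
      using Q by (intro mean_time_changed) auto
    also have "\<dots> = (\<integral>\<^sup>+x. indicator (({0..} \<inter> {0..real n}) \<times> cball 0 (real n)) x \<partial>\<pi>)"
      by (intro nn_integral_cong) (auto split: split_indicator)
    also have "\<dots> = emeasure \<pi> (({0..} \<inter> {0..real n}) \<times> cball 0 (real n))"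
      by (intro nn_integral_indicator pair_measureI) (auto simp: sets_\<sigma> sets_halfline sets_restrict_space)
    also have "\<dots> < \<infinity>" by (rule emeasure_\<pi>_box_finite)
    finally have "AE \<omega> in \<nu>. (\<integral>\<^sup>+x. indicator ?Q (V (x, \<omega>), snd x) \<partial>count_space \<omega>) \<noteq> \<infinity>"
      by (intro nn_integral_PInf_AE meas[OF Q]) auto
    then show ?thesis
    proof eventually_elim
      case (elim \<omega>)
      let ?A = "{x \<in> \<omega>. V (x, \<omega>) \<le> real n \<and> norm (snd x) \<le> real n}"
      have "(\<integral>\<^sup>+x. indicator ?Q (V (x, \<omega>), snd x) \<partial>count_space \<omega>) = (\<integral>\<^sup>+x. indicator ?A x \<partial>count_space \<omega>)"
        by (intro nn_integral_cong) (auto split: split_indicator)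
      also have "\<dots> = emeasure (count_space \<omega>) ?A" by (rule nn_integral_indicator) auto
      finally show ?case using elim by (subst (asm) emeasure_count_space) (auto split: if_splits)
    qed
  qed
  have "AE \<omega> in \<nu>. \<forall>n::nat. finite {x \<in> \<omega>. V (x, \<omega>) \<le> real n \<and> norm (snd x) \<le> real n}"
    using fin by (simp add: AE_all_countable)
  then show ?thesis
    using AE_\<nu>[OF fst_inj] AE_\<nu>[OF snd_inj] AE_\<nu>[OF pos] Vpos AE_space
    by eventually_elim (simp add: good_def)
qed

definition shift :: "(real \<times> 'z) set \<Rightarrow> (real \<times> 'z) set" where
  "shift \<omega> = (\<lambda>x. (V (x, \<omega>), snd x)) ` \<omega>"

lemma good_inj: "good \<omega> \<Longrightarrow> inj_on (\<lambda>x. (V (x, \<omega>), snd x)) \<omega>"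
  by (auto simp: good_def inj_on_def)

lemma good_bij: "good \<omega> \<Longrightarrow> bij_betw (\<lambda>x. (V (x, \<omega>), snd x)) \<omega> (shift \<omega>)"
  by (auto simp: bij_betw_def shift_def good_inj)

lemma shift_configurations:
  assumes "good \<omega>"
  shows "shift \<omega> \<in> configurations time_space"
proof (rule configurationsI)
  show "shift \<omega> \<subseteq> time_space" using assms by (auto simp: shift_def good_def)
  fix n :: nat
  have "shift \<omega> \<inter> cball 0 (real n) \<subseteq>
    (\<lambda>x. (V (x, \<omega>), snd x)) ` {x \<in> \<omega>. V (x, \<omega>) \<le> real n \<and> norm (snd x) \<le> real n}"
  proof
    fix y assume y: "y \<in> shift \<omega> \<inter> cball 0 (real n)"
    then obtain x where x: "x \<in> \<omega>" "y = (V (x, \<omega>), snd x)" by (auto simp: shift_def)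
    have "norm (V (x, \<omega>), snd x) \<le> real n" using y x by simp
    then have "V (x, \<omega>) \<le> real n" "norm (snd x) \<le> real n"
      using norm_fst_le[of "V (x, \<omega>)" "snd x"] norm_snd_le[of "snd x" "V (x, \<omega>)"] by auto
    then show "y \<in> (\<lambda>x. (V (x, \<omega>), snd x)) ` {x \<in> \<omega>. V (x, \<omega>) \<le> real n \<and> norm (snd x) \<le> real n}"
      using x by blast
  qed
  moreover have "finite {x \<in> \<omega>. V (x, \<omega>) \<le> real n \<and> norm (snd x) \<le> real n}"
    using assms by (simp add: good_def)
  ultimately show "finite (shift \<omega> \<inter> cball 0 (real n))" by (meson finite_imageI finite_subset)
qed

lemma nn_integral_shift:
  "good \<omega> \<Longrightarrow> (\<integral>\<^sup>+y. k y \<partial>count_space (shift \<omega>)) = (\<integral>\<^sup>+x. k (V (x, \<omega>), snd x) \<partial>count_space \<omega>)"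
  by (rule nn_integral_bij_count_space[OF good_bij, symmetric])

text \<open>The exceptional event is enclosed in a measurable null set, on which the empty
  configuration is substituted; this turns the transform into a measurable map.\<close>

lemma shift_modification:
  obtains \<tau> where "\<tau> \<in> measurable \<nu> (config_borel time_space)" "AE \<omega> in \<nu>. good \<omega> \<and> \<tau> \<omega> = shift \<omega>"
proof -
  obtain N where N: "{\<omega> \<in> space \<nu>. \<not> good \<omega>} \<subseteq> N" "emeasure \<nu> N = 0" "N \<in> sets \<nu>"
    using AE_E[OF AE_good] by metis
  define \<tau> where "\<tau> \<omega> = (if \<omega> \<in> N then {} else shift \<omega>)" for \<omega>
  have g: "good \<omega>" if "\<omega> \<in> space \<nu>" "\<omega> \<notin> N" for \<omega> using that N(1) by auto
  show thesis
  proof (rule that[of \<tau>])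
    show "\<tau> \<in> measurable \<nu> (config_borel time_space)"
    proof (rule measurable_config_borelI[OF closed_time_space])
      show "\<tau> \<omega> \<in> configurations time_space" if "\<omega> \<in> space \<nu>" for \<omega>
        using g[OF that] shift_configurations by (auto simp: \<tau>_def configurations_def)
      fix W :: "(real \<times> 'z) set" assume W: "open W" "bounded W"
      have "(\<lambda>p. indicator W (V p, snd (fst p)) :: ennreal) \<in> borel_measurable (\<pi> \<Otimes>\<^sub>M \<mu>)"
        using W by (intro measurable_compose[OF shift_measurable]) measurable
      from points_measurable[OF this]
      have [measurable]: "(\<lambda>\<omega>. \<integral>\<^sup>+x. indicator W (V (x, \<omega>), snd x) \<partial>count_space \<omega>) \<in> borel_measurable \<nu>"
        by (simp cong: measurable_cong_sets add: sets_\<nu>)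
      note [measurable] = N(3)
      have eq: "(\<integral>\<^sup>+x. indicator W x \<partial>count_space (\<tau> \<omega>)) =
        (if \<omega> \<in> N then 0 else \<integral>\<^sup>+x. indicator W (V (x, \<omega>), snd x) \<partial>count_space \<omega>)" if "\<omega> \<in> space \<nu>" for \<omega>
        using g[OF that] by (cases "\<omega> \<in> N") (simp_all add: \<tau>_def nn_integral_shift nn_integral_count_space_finite)
      show "(\<lambda>\<omega>. \<integral>\<^sup>+x. indicator W x \<partial>count_space (\<tau> \<omega>)) \<in> borel_measurable \<nu>"
        by (subst measurable_cong[OF eq]) measurable
    qed
    have "AE \<omega> in \<nu>. \<omega> \<notin> N" using N by (intro AE_not_in) auto
    then show "AE \<omega> in \<nu>. good \<omega> \<and> \<tau> \<omega> = shift \<omega>"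
      using AE_space by eventually_elim (simp add: g \<tau>_def)
  qed
qed

end

lemma exp_neg_sum: "finite S \<Longrightarrow> exp (- (\<Sum>x\<in>S. f x)) = (\<Prod>x\<in>S. exp (- f x :: real))"
  by (simp add: sum_negf[symmetric] exp_sum)

section \<open>The law of the transported configuration\<close>

context poisson_time_change
begin

text \<open>Pathwise, the exponential martingale \<open>exp (A\<^sub>t - N\<^sub>t)\<close> starts at 1, ends at
  \<open>exp (c - \<Sum> \<phi>)\<close>, and its jumps are compensated by its continuous growth.\<close>

lemma laplace_functional_shift:
  assumes f: "f \<in> Cc time_space" "\<And>x. 0 \<le> f x"
    and \<tau>: "\<tau> \<in> measurable \<nu> (config_borel time_space)" "AE \<omega> in \<nu>. good \<omega> \<and> \<tau> \<omega> = shift \<omega>"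
  shows "(\<integral>\<omega>. exp (- (\<integral>x. f x \<partial>config_measure (\<tau> \<omega>))) \<partial>\<nu>) = exp (- (\<integral>x. (1 - exp (- f x)) \<partial>\<pi>))"
proof -
  have fm[measurable]: "f \<in> borel_measurable borel" by (rule Cc_borel_measurable[OF closed_time_space f(1)])
  have [measurable]: "f \<in> borel_measurable \<pi>" by (rule borel_measurable_\<pi>[OF fm])
  define c where "c = (\<integral>x. (1 - exp (- f x)) \<partial>\<pi>)"
  have c: "ennreal c = (\<integral>\<^sup>+x. ennreal (1 - exp (- f x)) \<partial>\<pi>)" and c0: "0 \<le> c"
  proof -
    have "integrable \<pi> (\<lambda>x. 1 - exp (- f x))"
      by (rule Bochner_Integration.integrable_bound[OF Cc_integrable_\<pi>[OF f(1)]]) (use f(2) one_minus_exp_le in auto)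
    then show "ennreal c = (\<integral>\<^sup>+x. ennreal (1 - exp (- f x)) \<partial>\<pi>)"
      unfolding c_def using f(2) by (intro nn_integral_eq_integral[symmetric]) auto
    show "0 \<le> c" unfolding c_def using f(2) by (intro integral_nonneg_AE) auto
  qed
  define \<phi> where "\<phi> p = f (V p, snd (fst p))" for p
  have \<phi>m[measurable]: "\<phi> \<in> borel_measurable (\<pi> \<Otimes>\<^sub>M \<mu>)"
    unfolding \<phi>_def by (rule measurable_compose[OF shift_measurable fm])
  have \<phi>0: "0 \<le> \<phi> p" for p by (simp add: \<phi>_def f(2))
  have \<phi>na: "nonanticipating \<phi>"
    using V_nonanticipating by (simp add: \<phi>_def nonanticipating_def del: split_paired_All)
  define w where "w p = exp (- \<phi> p)" for p
  have w: "0 < w p" "w p \<le> 1" for p using \<phi>0 by (auto simp: w_def)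
  \<comment> \<open>Rate, at time \<open>fst q\<close> and under \<open>\<nu>\<close>, of the
    compensator of the sum of \<open>1 - w\<close> over the points, with the location integrated
    out.\<close>
  define a where "a q = (\<integral>\<^sup>+z. ennreal (1 - w ((fst q, z), snd q)) * ennreal (1 + U ((fst q, z), snd q)) \<partial>\<sigma>)" for q
  have am[measurable]: "a \<in> borel_measurable (halfline \<Otimes>\<^sub>M \<mu>)"
  proof -
    have "(\<lambda>(q, z). ennreal (1 - w ((fst q, z), snd q)) * ennreal (1 + U ((fst q, z), snd q)))
      \<in> borel_measurable ((halfline \<Otimes>\<^sub>M \<mu>) \<Otimes>\<^sub>M \<sigma>)"
      unfolding w_def by measurable
    then show ?thesis unfolding a_def by (rule \<pi>.M2.borel_measurable_nn_integral)
  qed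
  \<comment> \<open>\<open>enn2real\<close> sends an infinite rate to 0; on almost every path this
    happens only on a null set of times, since the total is the finite \<open>c\<close>.\<close>
  define g where "g s \<omega> = enn2real (a (max 0 s, \<omega>))" for s \<omega>
  define A where "A p = (LINT s:{0..fst (fst p)}|lborel. g s (snd p))" for p :: "(real \<times> 'z) \<times> (real \<times> 'z) set"
  have Am[measurable]: "A \<in> borel_measurable (\<pi> \<Otimes>\<^sub>M \<mu>)"
    unfolding A_def g_def by (rule set_integral_measurable) measurable
  have Ana: "nonanticipating A"
    unfolding nonanticipating_def
  proof (intro ballI allI impI)
    fix \<omega> :: "(real \<times> 'z) set" and x :: "real \<times> 'z" assume \<omega>: "\<omega> \<in> configurations time_space" and x: "0 < fst x"
    have "g s (before (fst x) \<omega>) = g s \<omega>" if "0 < s" "s \<le> fst x" for s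
    proof -
      have "U ((s, z), before (fst x) \<omega>) = U ((s, z), \<omega>)" "w ((s, z), before (fst x) \<omega>) = w ((s, z), \<omega>)" for z
        using nonanticipatingD[OF U_nonanticipating \<omega>, of "(s, z)"] nonanticipatingD[OF \<phi>na \<omega>, of "(s, z)"] that
        by (auto simp: w_def)
      then show ?thesis using that by (simp add: g_def a_def)
    qed
    then show "A (x, before (fst x) \<omega>) = A (x, \<omega>)" unfolding A_def fst_conv snd_conv by (intro set_integral_before)
  qed
  \<comment> \<open>Accumulated \<open>\<phi>\<close> strictly before the time of \<open>p\<close>.
    Strictness yields the left limit at a jump, and positive times are imposed because
    \<open>\<phi>\<close> is nonanticipating only there.\<close>
  define n where "n p = (\<integral>\<^sup>+y. (if 0 < fst y \<and> fst y < fst (fst p) then ennreal (\<phi> (y, snd p)) else 0) \<partial>count_space (snd p))"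
    for p :: "(real \<times> 'z) \<times> (real \<times> 'z) set"
  have nm[measurable]: "n \<in> borel_measurable (\<pi> \<Otimes>\<^sub>M \<mu>)"
  proof -
    have "(\<lambda>q. if 0 < fst (snd q) \<and> fst (snd q) < fst (fst (fst q)) then ennreal (\<phi> (snd q, snd (fst q))) else 0)
      \<in> borel_measurable ((\<pi> \<Otimes>\<^sub>M \<mu>) \<Otimes>\<^sub>M \<pi>)" by measurable
    from nn_integral_points_measurable[OF measurable_snd this] show ?thesis
      by (simp only: n_def[abs_def] fst_conv snd_conv)
  qed
  have nna: "nonanticipating n"
    unfolding nonanticipating_def
  proof (intro ballI allI impI)
    fix \<omega> :: "(real \<times> 'z) set" and x :: "real \<times> 'z" assume \<omega>: "\<omega> \<in> configurations time_space" and x: "0 < fst x"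
    have "n (x, before (fst x) \<omega>) =
      (\<integral>\<^sup>+y. (if 0 < fst y \<and> fst y < fst x then ennreal (\<phi> (y, \<omega>)) else 0) \<partial>count_space (before (fst x) \<omega>))"
      unfolding n_def fst_conv snd_conv
      using nonanticipatingD[OF \<phi>na \<omega>] by (intro nn_integral_cong) auto
    also have "\<dots> = n (x, \<omega>)"
      unfolding n_def fst_conv snd_conv
      by (subst (1 2) nn_integral_count_space_indicator, simp, simp)
        (auto intro!: nn_integral_cong simp: before_def split: split_indicator)
    finally show "n (x, before (fst x) \<omega>) = n (x, \<omega>)" .
  qed
  define Y where "Y p = exp (- enn2real (n p))" for p
  \<comment> \<open>Drop of the exponential martingale at a jump: its left limit
    \<open>exp (A p) * Y p\<close> times the relative drop \<open>1 - w p\<close>. Integrated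
    against the compensator, it is the continuous growth.\<close>
  define H where "H p = ennreal (exp (A p) * Y p * (1 - w p))" for p
  have Hm[measurable]: "H \<in> borel_measurable (\<pi> \<Otimes>\<^sub>M \<mu>)"
    unfolding H_def Y_def w_def by measurable
  have Hna: "nonanticipating H"
    using Ana nna \<phi>na by (simp add: H_def Y_def w_def nonanticipating_def del: split_paired_All)
  define Z where "Z \<omega> = exp c * exp (- (\<integral>x. f x \<partial>config_measure (\<tau> \<omega>)))" for \<omega>
  have Zm[measurable]: "Z \<in> borel_measurable \<nu>"
    unfolding Z_def using measurable_compose[OF \<tau>(1) integral_config_measurable[OF f(1)]] by measurable
  \<comment> \<open>The first conjunct is the jump balance, arranged without subtraction for
    \<open>ennreal\<close>. The second bounds the growth term uniformly in \<open>\<omega>\<close>,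
    so that its mean is finite and may be cancelled.\<close>
  have path: "AE \<omega> in \<nu>. ennreal (Z \<omega>) + (\<integral>\<^sup>+x. H (x, \<omega>) \<partial>count_space \<omega>) =
      1 + (\<integral>\<^sup>+x. H (x, \<omega>) * ennreal (1 + U (x, \<omega>)) \<partial>\<pi>) \<and>
      (\<integral>\<^sup>+x. H (x, \<omega>) * ennreal (1 + U (x, \<omega>)) \<partial>\<pi>) \<le> ennreal (exp c - 1)"
    using \<tau>(2) AE_\<nu>[OF AE_time_changed_integral] AE_space
  proof eventually_elim
    case (elim \<omega>)
    have \<omega>: "good \<omega>" "\<tau> \<omega> = shift \<omega>" "\<omega> \<in> configurations time_space" using elim by auto
    then have \<omega>\<mu>: "\<omega> \<in> space \<mu>" by simp
    have [measurable]: "(\<lambda>x. w (x, \<omega>)) \<in> borel_measurable \<pi>" "(\<lambda>x. U (x, \<omega>)) \<in> borel_measurable \<pi>"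
      "(\<lambda>x. H (x, \<omega>)) \<in> borel_measurable \<pi>" "(\<lambda>t. a (t, \<omega>)) \<in> borel_measurable halfline"
      using \<omega>\<mu> unfolding w_def by measurable
    have gm[measurable]: "(\<lambda>s. g s \<omega>) \<in> borel_measurable borel"
      unfolding g_def by measurable
    \<comment> \<open>The time change turns the total compensator into the integral of
      \<open>1 - exp (- f x)\<close> against the intensity, the same constant \<open>c\<close> for
      almost every path. This is why \<open>exp c\<close> can be a deterministic factor of the
      terminal value \<open>Z\<close>.\<close>
    have "(\<integral>\<^sup>+t. a (t, \<omega>) \<partial>halfline) = (\<integral>\<^sup>+x. ennreal (1 - w (x, \<omega>)) * ennreal (1 + U (x, \<omega>)) \<partial>\<pi>)"
      unfolding a_def fst_conv snd_conv by (rule \<pi>.M2.nn_integral_fst) measurable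
    also have "\<dots> = (\<integral>\<^sup>+x. ennreal (1 - exp (- f x)) \<partial>\<pi>)"
      using elim(2)[THEN bspec, of "\<lambda>x. ennreal (1 - exp (- f x))"] by (simp add: w_def \<phi>_def)
    finally have aint: "(\<integral>\<^sup>+t. a (t, \<omega>) \<partial>halfline) = ennreal c" by (simp add: c)
    have "AE t in halfline. a (t, \<omega>) \<noteq> \<infinity>"
      using aint by (intro nn_integral_PInf_AE) auto
    then have ga: "AE t in halfline. ennreal (g t \<omega>) = a (t, \<omega>)"
      using AE_space by eventually_elim (simp add: g_def max_def less_top)
    have nn: "(\<integral>\<^sup>+t. ennreal (indicator {0..} t *\<^sub>R g t \<omega>) \<partial>lborel) = ennreal c"
    proof -
      have "(\<integral>\<^sup>+t. ennreal (indicator {0..} t *\<^sub>R g t \<omega>) \<partial>lborel) = (\<integral>\<^sup>+t. ennreal (g t \<omega>) \<partial>halfline)"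
        unfolding nn_integral_halfline by (intro nn_integral_cong) (auto split: split_indicator)
      also have "\<dots> = (\<integral>\<^sup>+t. a (t, \<omega>) \<partial>halfline)" by (rule nn_integral_cong_AE[OF ga])
      finally show ?thesis using aint by simp
    qed
    have g0: "0 \<le> g t \<omega>" for t by (simp add: g_def)
    have gi: "set_integrable lborel {0..} (\<lambda>t. g t \<omega>)"
      unfolding set_integrable_def
      by (rule integrableI_nn_integral_finite[OF _ _ nn]) (use g0 in auto)
    have gc: "c = (LINT t:{0..}|lborel. g t \<omega>)"
      unfolding set_lebesgue_integral_def
      by (subst integral_eq_nn_integral) (use g0 nn c0 in auto)
    define B where "B t = (LINT s:{0..t}|lborel. g s \<omega>)" for t
    have AB: "A (x, \<omega>) = B (fst x)" for x by (simp add: A_def B_def)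
    \<comment> \<open>Derivative of \<open>exp B\<close>, extended by 0 to negative times; one plus
      its integral up to \<open>s\<close> is \<open>exp (B s)\<close>, the form required by
      \<open>jump_identity\<close>.\<close>
    define k where "k t = indicator {0..} t * (exp (B t) * g t \<omega>)" for t
    have k_int: "integrable lborel k" and k_tot: "(\<integral>t. k t \<partial>lborel) = exp c - 1"
      using exp_indefinite_integral[OF gi gm _ B_def gc] g0
      by (auto simp: set_integrable_def set_lebesgue_integral_def k_def[abs_def])
    have k_part: "(\<integral>t. indicator {..s} t * k t \<partial>lborel) = exp (B s) - 1" if "0 \<le> s" for s
    proof -
      have "(\<integral>t. indicator {..s} t * k t \<partial>lborel) = (LINT t:{0..s}|lborel. exp (B t) * g t \<omega>)"
        unfolding set_lebesgue_integral_def
        by (intro Bochner_Integration.integral_cong) (auto simp: k_def split: split_indicator)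
      also have "\<dots> = exp (B s) - 1"
        by (rule exp_indefinite_integral_partial[OF gi gm _ B_def that]) (use g0 in auto)
      finally show ?thesis .
    qed
    have k0: "0 \<le> k t" for t using g0 by (simp add: k_def)
    \<comment> \<open>Only points transported into the support of \<open>f\<close> cause a jump, and
      local finiteness in \<open>good\<close> makes them finitely many.\<close>
    define S where "S = {x \<in> \<omega>. \<phi> (x, \<omega>) \<noteq> 0}"
    have S\<omega>: "S \<subseteq> \<omega>" by (auto simp: S_def)
    have S: "finite S"
    proof -
      obtain r where r: "\<And>x. x \<notin> ball 0 r \<Longrightarrow> f x = 0" using Cc_bounded_support[OF f(1)] by metis
      obtain m where m: "r \<le> real m" using real_arch_simple by blast
      have "S \<subseteq> {x \<in> \<omega>. V (x, \<omega>) \<le> real m \<and> norm (snd x) \<le> real m}"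
      proof
        fix x assume x: "x \<in> S"
        then have "(V (x, \<omega>), snd x) \<in> ball 0 r" using r by (force simp: S_def \<phi>_def)
        then have "norm (V (x, \<omega>), snd x) \<le> real m" using m by simp
        then show "x \<in> {x \<in> \<omega>. V (x, \<omega>) \<le> real m \<and> norm (snd x) \<le> real m}"
          using norm_fst_le[of "V (x, \<omega>)" "snd x"] norm_snd_le[of "snd x" "V (x, \<omega>)"] x
          by (auto simp: S_def)
      qed
      then show ?thesis using \<omega>(1) by (rule_tac finite_subset) (auto simp: good_def)
    qed
    have inj: "inj_on fst S" using \<omega>(1) S\<omega> by (auto simp: good_def intro: inj_on_subset)
    have Spos: "0 < fst x" if "x \<in> S" for x using \<omega>(1) that S\<omega> by (auto simp: good_def)
    \<comment> \<open>At the time of a point its own factor is still absent, so that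
      \<open>Q\<close> there is the value just before the jump.\<close>
    define Q where "Q t = (\<Prod>j\<in>S. if fst j < t then w (j, \<omega>) else 1)" for t
    have Q01: "0 \<le> Q t" "Q t \<le> 1" for t
      unfolding Q_def using w by (auto intro!: prod_nonneg prod_le_1 simp: less_imp_le)
    have Qm[measurable]: "Q \<in> borel_measurable borel"
      unfolding Q_def by (intro borel_measurable_prod measurable_If) auto
    have YQ: "Y (x, \<omega>) = Q (fst x)" for x
    proof -
      have "n (x, \<omega>) = (\<Sum>y\<in>S. if 0 < fst y \<and> fst y < fst x then ennreal (\<phi> (y, \<omega>)) else 0)"
        unfolding n_def fst_conv snd_conv
        by (rule nn_integral_count_space'[OF S]) (auto simp: S_def)
      also have "\<dots> = (\<Sum>y\<in>S. ennreal (if fst y < fst x then \<phi> (y, \<omega>) else 0))"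
        using Spos by (intro sum.cong) auto
      also have "\<dots> = ennreal (\<Sum>y\<in>S. if fst y < fst x then \<phi> (y, \<omega>) else 0)"
        using \<phi>0 by (intro sum_ennreal) auto
      finally have "enn2real (n (x, \<omega>)) = (\<Sum>y\<in>S. if fst y < fst x then \<phi> (y, \<omega>) else 0)"
        using \<phi>0 by (simp add: sum_nonneg)
      then show ?thesis
        unfolding Y_def Q_def by (simp add: exp_neg_sum[OF S]) (intro prod.cong, auto simp: w_def)
    qed
    have Zeq: "Z \<omega> = exp c * (\<Prod>x\<in>S. w (x, \<omega>))"
    proof -
      have pos: "0 \<le> (\<integral>x. f x \<partial>config_measure (shift \<omega>))"
        by (rule ennreal_integral_config_measure(2)[OF closed_time_space f shift_configurations[OF \<omega>(1)]])
      have "ennreal (\<integral>x. f x \<partial>config_measure (shift \<omega>)) = (\<integral>\<^sup>+x. ennreal (f x) \<partial>count_space (shift \<omega>))"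
        by (rule ennreal_integral_config_measure(1)[OF closed_time_space f shift_configurations[OF \<omega>(1)]])
      also have "(\<integral>\<^sup>+x. ennreal (f x) \<partial>count_space (shift \<omega>)) = (\<integral>\<^sup>+x. ennreal (\<phi> (x, \<omega>)) \<partial>count_space \<omega>)"
        using nn_integral_shift[OF \<omega>(1), of "\<lambda>x. ennreal (f x)"] by (simp add: \<phi>_def)
      also have "\<dots> = (\<Sum>x\<in>S. ennreal (\<phi> (x, \<omega>)))"
        by (rule nn_integral_count_space'[OF S]) (auto simp: S_def)
      also have "\<dots> = ennreal (\<Sum>x\<in>S. \<phi> (x, \<omega>))" using \<phi>0 by (intro sum_ennreal) auto
      finally have "(\<integral>x. f x \<partial>config_measure (shift \<omega>)) = (\<Sum>x\<in>S. \<phi> (x, \<omega>))"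
        using pos \<phi>0 by (subst (asm) ennreal_inj) (auto intro: sum_nonneg)
      then show ?thesis unfolding Z_def \<omega>(2) w_def by (simp add: exp_neg_sum[OF S])
    qed
    have Hsum: "(\<integral>\<^sup>+x. H (x, \<omega>) \<partial>count_space \<omega>) = ennreal (\<Sum>x\<in>S. exp (B (fst x)) * Q (fst x) * (1 - w (x, \<omega>)))"
    proof -
      have "(\<integral>\<^sup>+x. H (x, \<omega>) \<partial>count_space \<omega>) = (\<Sum>x\<in>S. H (x, \<omega>))"
        by (rule nn_integral_count_space'[OF S]) (auto simp: S_def H_def w_def)
      also have "\<dots> = ennreal (\<Sum>x\<in>S. exp (B (fst x)) * Q (fst x) * (1 - w (x, \<omega>)))"
        unfolding H_def AB YQ using Q01 w by (intro sum_ennreal mult_nonneg_nonneg) auto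
      finally show ?thesis .
    qed
    have Qk_int: "integrable lborel (\<lambda>t. Q t * k t)"
    proof (rule Bochner_Integration.integrable_bound[OF k_int])
      show "AE t in lborel. norm (Q t * k t) \<le> norm (k t)"
        using Q01 k0 by (auto simp: abs_mult intro!: mult_left_le_one_le)
    qed (use borel_measurable_times[OF Qm borel_measurable_integrable[OF k_int, simplified]] in simp)
    have Hint: "(\<integral>\<^sup>+x. H (x, \<omega>) * ennreal (1 + U (x, \<omega>)) \<partial>\<pi>) = ennreal (\<integral>t. Q t * k t \<partial>lborel)"
    proof -
      have "(\<integral>\<^sup>+x. H (x, \<omega>) * ennreal (1 + U (x, \<omega>)) \<partial>\<pi>) =
        (\<integral>\<^sup>+t. \<integral>\<^sup>+z. H ((t, z), \<omega>) * ennreal (1 + U ((t, z), \<omega>)) \<partial>\<sigma> \<partial>halfline)"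
        by (rule \<pi>.M2.nn_integral_fst[symmetric]) measurable
      also have "\<dots> = (\<integral>\<^sup>+t. ennreal (exp (B t) * Q t) * a (t, \<omega>) \<partial>halfline)"
      proof (rule nn_integral_cong)
        fix t assume t: "t \<in> space halfline"
        have [measurable]: "(\<lambda>z. w ((t, z), \<omega>)) \<in> borel_measurable \<sigma>" "(\<lambda>z. U ((t, z), \<omega>)) \<in> borel_measurable \<sigma>"
          using t \<omega>\<mu> unfolding w_def by measurable
        have "H ((t, z), \<omega>) * ennreal (1 + U ((t, z), \<omega>)) =
          ennreal (exp (B t) * Q t) * (ennreal (1 - w ((t, z), \<omega>)) * ennreal (1 + U ((t, z), \<omega>)))" for z
          unfolding H_def AB YQ fst_conv using Q01 w by (simp add: ennreal_mult' mult.assoc)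
        then show "(\<integral>\<^sup>+z. H ((t, z), \<omega>) * ennreal (1 + U ((t, z), \<omega>)) \<partial>\<sigma>) = ennreal (exp (B t) * Q t) * a (t, \<omega>)"
          by (simp add: nn_integral_cmult a_def)
      qed
      also have "\<dots> = (\<integral>\<^sup>+t. ennreal (exp (B t) * Q t) * ennreal (g t \<omega>) \<partial>halfline)"
        using ga by (intro nn_integral_cong_AE) (auto elim: AE_mp)
      also have "\<dots> = (\<integral>\<^sup>+t. ennreal (Q t * k t) \<partial>lborel)"
        unfolding nn_integral_halfline using Q01 g0
        by (intro nn_integral_cong) (auto simp: k_def ennreal_mult[symmetric] ac_simps split: split_indicator)
      also have "\<dots> = ennreal (\<integral>t. Q t * k t \<partial>lborel)"
        using Qk_int Q01 k0 by (intro nn_integral_eq_integral) auto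
      finally show ?thesis .
    qed
    have "exp c * (\<Prod>x\<in>S. w (x, \<omega>)) + (\<Sum>x\<in>S. exp (B (fst x)) * Q (fst x) * (1 - w (x, \<omega>))) =
      1 + (\<integral>t. Q t * k t \<partial>lborel)"
    proof -
      have "(\<Sum>x\<in>S. exp (B (fst x)) * Q (fst x) * (1 - w (x, \<omega>))) =
        (\<Sum>x\<in>S. (1 + (\<integral>t. indicator {..fst x} t * k t \<partial>lborel)) *
          (\<Prod>j\<in>S. if fst j < fst x then w (j, \<omega>) else 1) * (1 - w (x, \<omega>)))"
        using Spos by (intro sum.cong refl) (simp add: k_part less_imp_le Q_def)
      then show ?thesis
        using jump_identity[OF k_int S inj, of "\<lambda>x. w (x, \<omega>)"] by (simp add: k_tot Q_def[abs_def])
    qed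
    moreover have "0 \<le> (\<Prod>x\<in>S. w (x, \<omega>))" using w by (intro prod_nonneg) (simp add: less_imp_le)
    moreover have "0 \<le> (\<Sum>x\<in>S. exp (B (fst x)) * Q (fst x) * (1 - w (x, \<omega>)))"
      using w Q01 by (intro sum_nonneg mult_nonneg_nonneg) auto
    moreover have "0 \<le> (\<integral>t. Q t * k t \<partial>lborel)" using Q01 k0 by (intro integral_nonneg_AE) auto
    ultimately have "ennreal (Z \<omega>) + (\<integral>\<^sup>+x. H (x, \<omega>) \<partial>count_space \<omega>) =
      1 + (\<integral>\<^sup>+x. H (x, \<omega>) * ennreal (1 + U (x, \<omega>)) \<partial>\<pi>)"
      unfolding Hsum Hint Zeq by (simp add: ennreal_plus[symmetric] ennreal_1[symmetric] del: ennreal_plus ennreal_1)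
    moreover have "(\<integral>t. Q t * k t \<partial>lborel) \<le> (\<integral>t. k t \<partial>lborel)"
      using Q01 k0 by (intro integral_mono Qk_int k_int) (auto intro: mult_left_le_one_le)
    ultimately show ?case unfolding Hint k_tot by (simp add: ennreal_leI)
  qed
  define I where "I = (\<integral>\<^sup>+\<omega>. \<integral>\<^sup>+x. H (x, \<omega>) * ennreal (1 + U (x, \<omega>)) \<partial>\<pi> \<partial>\<nu>)"
  have Im: "(\<lambda>\<omega>. \<integral>\<^sup>+x. H (x, \<omega>) * ennreal (1 + U (x, \<omega>)) \<partial>\<pi>) \<in> borel_measurable \<nu>"
    by measurable
  have Hpm: "(\<lambda>\<omega>. \<integral>\<^sup>+x. H (x, \<omega>) \<partial>count_space \<omega>) \<in> borel_measurable \<nu>"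
    using points_measurable[OF Hm] by (simp cong: measurable_cong_sets add: sets_\<nu>)
  have "I \<le> (\<integral>\<^sup>+\<omega>. ennreal (exp c - 1) \<partial>\<nu>)"
    unfolding I_def using path by (intro nn_integral_mono_AE) (auto elim: AE_mp)
  also have "\<dots> < \<infinity>" using \<nu>.emeasure_space_1 by simp
  finally have fin: "I < \<infinity>" .
  \<comment> \<open>Girsanov's formula equates the mean of the jump sum with \<open>I\<close>, so
    that the mean of the balance reads \<open>E Z + I = 1 + I\<close>.\<close>
  have "(\<integral>\<^sup>+\<omega>. ennreal (Z \<omega>) \<partial>\<nu>) + I = (\<integral>\<^sup>+\<omega>. ennreal (Z \<omega>) \<partial>\<nu>) + (\<integral>\<^sup>+\<omega>. \<integral>\<^sup>+x. H (x, \<omega>) \<partial>count_space \<omega> \<partial>\<nu>)"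
    unfolding I_def using girsanov[OF Hm Hna] by simp
  also have "\<dots> = (\<integral>\<^sup>+\<omega>. ennreal (Z \<omega>) + (\<integral>\<^sup>+x. H (x, \<omega>) \<partial>count_space \<omega>) \<partial>\<nu>)"
    by (rule nn_integral_add[symmetric]) (use Hpm in auto)
  also have "\<dots> = (\<integral>\<^sup>+\<omega>. 1 + (\<integral>\<^sup>+x. H (x, \<omega>) * ennreal (1 + U (x, \<omega>)) \<partial>\<pi>) \<partial>\<nu>)"
    using path by (intro nn_integral_cong_AE) (auto elim: AE_mp)
  also have "\<dots> = 1 + I"
    unfolding I_def using Im \<nu>.emeasure_space_1 by (subst nn_integral_add) auto
  finally have "(\<integral>\<^sup>+\<omega>. ennreal (Z \<omega>) \<partial>\<nu>) + I = 1 + I" .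
  then have "(\<integral>\<^sup>+\<omega>. ennreal (Z \<omega>) \<partial>\<nu>) + I - I = 1 + I - I" by (simp only:)
  then have "(\<integral>\<^sup>+\<omega>. ennreal (Z \<omega>) \<partial>\<nu>) = 1"
    using fin by (simp add: ennreal_add_diff_cancel_right)
  moreover have "(\<integral>\<omega>. Z \<omega> \<partial>\<nu>) = enn2real (\<integral>\<^sup>+\<omega>. ennreal (Z \<omega>) \<partial>\<nu>)"
    by (rule integral_eq_nn_integral[OF Zm]) (simp add: Z_def)
  ultimately have "(\<integral>\<omega>. Z \<omega> \<partial>\<nu>) = 1" by simp
  then have eq: "exp c * (\<integral>\<omega>. exp (- (\<integral>x. f x \<partial>config_measure (\<tau> \<omega>))) \<partial>\<nu>) = 1"
    by (simp add: Z_def)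
  have "(\<integral>\<omega>. exp (- (\<integral>x. f x \<partial>config_measure (\<tau> \<omega>))) \<partial>\<nu>) =
    exp (- c) * (exp c * (\<integral>\<omega>. exp (- (\<integral>x. f x \<partial>config_measure (\<tau> \<omega>))) \<partial>\<nu>))"
    by (simp add: mult.assoc[symmetric] exp_add[symmetric])
  then show ?thesis unfolding eq c_def[symmetric] by simp
qed

theorem distr_shift:
  assumes \<tau>: "\<tau> \<in> measurable \<nu> (config_borel time_space)" "AE \<omega> in \<nu>. good \<omega> \<and> \<tau> \<omega> = shift \<omega>"
  shows "distr \<nu> (config_borel time_space) \<tau> = \<mu>"
proof (rule laplace_functional_unique[OF closed_time_space])
  show "finite_measure (distr \<nu> (config_borel time_space) \<tau>)"
    using \<nu>.prob_space_distr[OF \<tau>(1)] by (simp add: prob_space_def)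
  show "sets \<mu> = sets (config_borel time_space)" by (rule sets_\<mu>)
  fix f :: "real \<times> 'z \<Rightarrow> real" assume f: "f \<in> Cc time_space" "\<And>x. 0 \<le> f x"
  note [measurable] = integral_config_measurable[OF f(1)] \<tau>(1)
  have "(\<integral>\<omega>. exp (- (\<integral>x. f x \<partial>config_measure \<omega>)) \<partial>distr \<nu> (config_borel time_space) \<tau>) =
    (\<integral>\<omega>. exp (- (\<integral>x. f x \<partial>config_measure (\<tau> \<omega>))) \<partial>\<nu>)"
    by (rule integral_distr) auto
  then show "(\<integral>\<omega>. exp (- (\<integral>x. f x \<partial>config_measure \<omega>)) \<partial>distr \<nu> (config_borel time_space) \<tau>) =
    (\<integral>\<omega>. exp (- (\<integral>x. f x \<partial>config_measure \<omega>)) \<partial>\<mu>)"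
    using laplace_functional_shift[OF f \<tau>] laplace_functional[OF f(1)] by simp
qed (use finite_measure_axioms in auto)

end

section \<open>The coupling\<close>

lemma ennreal_sqrt_power2[simp]: "(ennreal_sqrt x)\<^sup>2 = x"
proof (cases x)
  case (real r)
  then show ?thesis by (simp add: ennreal_sqrt_def ennreal_power)
qed (simp add: ennreal_sqrt_def power2_eq_square ennreal_top_mult)

lemma ennreal_sqrt_mono: "x \<le> y \<Longrightarrow> ennreal_sqrt x \<le> ennreal_sqrt y"
  by (cases x; cases y) (auto simp: ennreal_sqrt_def top_unique intro!: ennreal_leI)

lemma ennreal_sqrt_measurable[measurable]: "ennreal_sqrt \<in> borel_measurable borel"
  unfolding ennreal_sqrt_def[abs_def] by measurable

lemma sets_config_measure[simp]: "sets (config_measure \<omega>) = sets borel"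
  by (simp add: config_measure_def)

lemma distr_config_measure:
  assumes g: "g \<in> borel_measurable borel" and bij: "bij_betw g \<beta> \<eta>"
  shows "distr (config_measure \<beta>) borel g = config_measure \<eta>"
proof (rule measure_eqI)
  fix A assume "A \<in> sets (distr (config_measure \<beta>) borel g)"
  then have A: "A \<in> sets borel" by simp
  have g': "g \<in> measurable (config_measure \<beta>) borel" using g by (simp cong: measurable_cong_sets)
  have sp: "space (config_measure \<beta>) = UNIV" by (simp add: config_measure_def)
  have m: "g -` A \<in> sets borel" using measurable_sets[OF g A] by simp
  have "emeasure (distr (config_measure \<beta>) borel g) A = emeasure (config_measure \<beta>) (g -` A)"
    using emeasure_distr[OF g' A] by (simp add: sp)
  also have "\<dots> = (\<integral>\<^sup>+x. indicator A (g x) \<partial>count_space \<beta>)"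
    by (simp add: emeasure_config_measure[OF m] indicator_vimage[unfolded o_def] indicator_def)
  also have "\<dots> = (\<integral>\<^sup>+y. indicator A y \<partial>count_space \<eta>)" by (rule nn_integral_bij_count_space[OF bij])
  also have "\<dots> = emeasure (config_measure \<eta>) A" by (rule emeasure_config_measure[OF A, symmetric])
  finally show "emeasure (distr (config_measure \<beta>) borel g) A = emeasure (config_measure \<eta>) A" .
qed (simp add: config_measure_def)

context poisson_time_change
begin

text \<open>The set of pairs of transported and original point is an admissible coupling, and as
  locations are kept only the time displacement costs.\<close>

lemma wasserstein_shift_le:
  assumes \<omega>: "good \<omega>"
  shows "wasserstein (shift \<omega>) \<omega> \<le> ennreal_sqrt (\<integral>\<^sup>+x. ennreal (\<bar>V (x, \<omega>) - fst x\<bar>\<^sup>2) \<partial>count_space \<omega>)"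
proof -
  define h where "h x = ((V (x, \<omega>), snd x), x)" for x
  define \<beta> where "\<beta> = h ` \<omega>"
  have conf: "\<omega> \<in> configurations time_space" using \<omega> by (simp add: good_def)
  have h: "bij_betw h \<omega> \<beta>" by (auto simp: bij_betw_def \<beta>_def h_def inj_on_def)
  have fst_bij: "bij_betw fst \<beta> (shift \<omega>)"
    using good_inj[OF \<omega>] by (force simp: bij_betw_def \<beta>_def h_def shift_def inj_on_def image_image)
  have snd_bij: "bij_betw snd \<beta> \<omega>"
    by (auto simp: bij_betw_def \<beta>_def h_def inj_on_def image_image)
  \<comment> \<open>Local finiteness is inherited from \<open>\<omega>\<close> through the second
    coordinate: a compact set of pairs has a compact second projection.\<close>
  have "\<beta> \<in> configurations (time_space \<times> time_space)"
    unfolding configurations_def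
  proof (intro CollectI conjI allI impI)
    show "\<beta> \<subseteq> time_space \<times> time_space" using \<omega> by (auto simp: \<beta>_def h_def good_def less_imp_le)
    fix K :: "((real \<times> 'z) \<times> (real \<times> 'z)) set" assume K: "compact K \<and> K \<subseteq> time_space \<times> time_space"
    then have "compact (snd ` K)" by (intro compact_continuous_image continuous_intros) auto
    moreover have "snd ` K \<subseteq> time_space" using K by auto
    ultimately have "finite (\<omega> \<inter> snd ` K)" using conf by (simp add: configurations_def)
    moreover have "\<beta> \<inter> K \<subseteq> h ` (\<omega> \<inter> snd ` K)" by (force simp: \<beta>_def h_def)
    ultimately show "finite (\<beta> \<inter> K)" by (meson finite_imageI finite_subset)
  qed
  moreover have "distr (config_measure \<beta>) borel fst = config_measure (shift \<omega>)"
    by (intro distr_config_measure fst_bij borel_measurable_continuous_onI continuous_intros)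
  moreover have "distr (config_measure \<beta>) borel snd = config_measure \<omega>"
    by (intro distr_config_measure snd_bij borel_measurable_continuous_onI continuous_intros)
  ultimately have \<beta>: "\<beta> \<in> config_couplings time_space (shift \<omega>) \<omega>" by (simp add: config_couplings_def)
  define F :: "(real \<times> 'z) \<times> (real \<times> 'z) \<Rightarrow> real"
    where "F q = (dist (snd (fst q)) (snd (snd q)))\<^sup>2 + \<bar>fst (snd q) - fst (fst q)\<bar>\<^sup>2" for q
  have "F \<in> borel_measurable borel"
    unfolding F_def by (intro borel_measurable_continuous_onI continuous_intros)
  then have Fm: "(\<lambda>q. ennreal (F q)) \<in> borel_measurable borel" by measurable
  have "(INF \<beta> \<in> config_couplings time_space (shift \<omega>) \<omega>.
      \<integral>\<^sup>+((s, x), (t, y)). ennreal ((dist x y)\<^sup>2 + \<bar>t - s\<bar>\<^sup>2) \<partial>config_measure \<beta>) \<le>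
    (\<integral>\<^sup>+((s, x), (t, y)). ennreal ((dist x y)\<^sup>2 + \<bar>t - s\<bar>\<^sup>2) \<partial>config_measure \<beta>)"
    by (rule INF_lower[OF \<beta>])
  also have "\<dots> = (\<integral>\<^sup>+q. ennreal (F q) \<partial>config_measure \<beta>)" by (rule nn_integral_cong) (simp add: F_def split_beta)
  also have "\<dots> = (\<integral>\<^sup>+q. ennreal (F q) \<partial>count_space \<beta>)" by (rule nn_integral_config_measure[OF Fm])
  also have "\<dots> = (\<integral>\<^sup>+x. ennreal (F (h x)) \<partial>count_space \<omega>)" by (rule nn_integral_bij_count_space[OF h, symmetric])
  also have "\<dots> = (\<integral>\<^sup>+x. ennreal (\<bar>V (x, \<omega>) - fst x\<bar>\<^sup>2) \<partial>count_space \<omega>)"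
    by (simp add: F_def h_def power2_commute)
  finally show ?thesis unfolding wasserstein_def by (rule ennreal_sqrt_mono)
qed

text \<open>Girsanov's formula for the squared displacement; \<open>V (x, \<omega>) - fst x\<close>
  is the time integral of \<open>u\<close> and nonanticipating.\<close>

lemma mean_cost:
  "(\<integral>\<^sup>+\<omega>. \<integral>\<^sup>+x. ennreal (\<bar>V (x, \<omega>) - fst x\<bar>\<^sup>2) \<partial>count_space \<omega> \<partial>\<nu>) =
   (\<integral>\<^sup>+\<omega>. ennreal (L \<omega>) *
      (\<integral>\<^sup>+z. (\<integral>\<^sup>+t. ennreal (\<bar>time_integral u t z \<omega>\<bar>\<^sup>2 * (1 + u t z \<omega>)) \<partial>halfline) \<partial>\<sigma>) \<partial>\<mu>)"
proof -
  define H where "H p = ennreal (\<bar>V p - fst (fst p)\<bar>\<^sup>2)" for p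
  have Hm[measurable]: "H \<in> borel_measurable (\<pi> \<Otimes>\<^sub>M \<mu>)" unfolding H_def by measurable
  have "nonanticipating H"
    using V_nonanticipating by (simp add: H_def nonanticipating_def del: split_paired_All)
  then have "(\<integral>\<^sup>+\<omega>. \<integral>\<^sup>+x. H (x, \<omega>) \<partial>count_space \<omega> \<partial>\<nu>) = (\<integral>\<^sup>+\<omega>. \<integral>\<^sup>+x. H (x, \<omega>) * ennreal (1 + U (x, \<omega>)) \<partial>\<pi> \<partial>\<nu>)"
    by (rule girsanov[OF Hm])
  also have "\<dots> = (\<integral>\<^sup>+\<omega>. ennreal (L \<omega>) * (\<integral>\<^sup>+x. H (x, \<omega>) * ennreal (1 + U (x, \<omega>)) \<partial>\<pi>) \<partial>\<mu>)"
    unfolding \<nu>_eq by (rule nn_integral_density) measurable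
  also have "\<dots> = (\<integral>\<^sup>+\<omega>. ennreal (L \<omega>) *
      (\<integral>\<^sup>+z. (\<integral>\<^sup>+t. ennreal (\<bar>time_integral u t z \<omega>\<bar>\<^sup>2 * (1 + u t z \<omega>)) \<partial>halfline) \<partial>\<sigma>) \<partial>\<mu>)"
  proof (rule nn_integral_cong)
    fix \<omega> assume \<omega>: "\<omega> \<in> space \<mu>"
    have [measurable]: "(\<lambda>x. H (x, \<omega>)) \<in> borel_measurable \<pi>" "(\<lambda>x. U (x, \<omega>)) \<in> borel_measurable \<pi>"
      using \<omega> by measurable
    have "(\<integral>\<^sup>+x. H (x, \<omega>) * ennreal (1 + U (x, \<omega>)) \<partial>\<pi>) =
      (\<integral>\<^sup>+z. \<integral>\<^sup>+t. H ((t, z), \<omega>) * ennreal (1 + U ((t, z), \<omega>)) \<partial>halfline \<partial>\<sigma>)"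
      by (rule \<pi>.nn_integral_snd[symmetric]) measurable
    also have "\<dots> = (\<integral>\<^sup>+z. (\<integral>\<^sup>+t. ennreal (\<bar>time_integral u t z \<omega>\<bar>\<^sup>2 * (1 + u t z \<omega>)) \<partial>halfline) \<partial>\<sigma>)"
      by (simp add: H_def V_def U_def time_change_def ennreal_mult')
    finally show "ennreal (L \<omega>) * (\<integral>\<^sup>+x. H (x, \<omega>) * ennreal (1 + U (x, \<omega>)) \<partial>\<pi>) = ennreal (L \<omega>) *
      (\<integral>\<^sup>+z. (\<integral>\<^sup>+t. ennreal (\<bar>time_integral u t z \<omega>\<bar>\<^sup>2 * (1 + u t z \<omega>)) \<partial>halfline) \<partial>\<sigma>)" by simp
  qed
  finally show ?thesis by (simp add: H_def)
qed

text \<open>The joint law of \<open>(\<tau> \<omega>, \<omega>)\<close> under \<open>\<nu>\<close>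
  couples \<open>\<mu>\<close> and \<open>\<nu>\<close>. Its cost is bounded configuration by
  configuration; since the Rubinstein distance averages the unsquared Wasserstein distance,
  \<open>nn_integral_power2_le\<close> moves the square inside the mean.\<close>

theorem rubinstein_power2_le:
  "(rubinstein wasserstein \<mu> \<nu>)\<^sup>2 \<le> (\<integral>\<^sup>+\<omega>. ennreal (L \<omega>) *
      (\<integral>\<^sup>+z. (\<integral>\<^sup>+t. ennreal (\<bar>time_integral u t z \<omega>\<bar>\<^sup>2 * (1 + u t z \<omega>)) \<partial>halfline) \<partial>\<sigma>) \<partial>\<mu>)"
proof -
  obtain \<tau> where \<tau>: "\<tau> \<in> measurable \<nu> (config_borel time_space)" "AE \<omega> in \<nu>. good \<omega> \<and> \<tau> \<omega> = shift \<omega>"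
    by (rule shift_modification)
  have [measurable]: "\<tau> \<in> measurable \<nu> \<mu>" using \<tau>(1) by (simp cong: measurable_cong_sets add: sets_\<mu>)
  define \<gamma> where "\<gamma> = distr \<nu> (\<mu> \<Otimes>\<^sub>M \<nu>) (\<lambda>\<omega>. (\<tau> \<omega>, \<omega>))"
  define C where "C \<omega> = (\<integral>\<^sup>+x. ennreal (\<bar>V (x, \<omega>) - fst x\<bar>\<^sup>2) \<partial>count_space \<omega>)" for \<omega>
  have [measurable]: "C \<in> borel_measurable \<nu>"
    unfolding C_def using points_measurable[of "\<lambda>p. ennreal (\<bar>V p - fst (fst p)\<bar>\<^sup>2)"]
    by (simp cong: measurable_cong_sets add: sets_\<nu>)
  have "\<gamma> \<in> prob_couplings \<mu> \<nu>"
    unfolding prob_couplings_def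
  proof (intro CollectI conjI)
    show "prob_space \<gamma>" unfolding \<gamma>_def by (rule \<nu>.prob_space_distr) measurable
    show "sets \<gamma> = sets (\<mu> \<Otimes>\<^sub>M \<nu>)" by (simp add: \<gamma>_def)
    have "distr \<gamma> \<mu> fst = distr \<nu> \<mu> \<tau>" unfolding \<gamma>_def by (subst distr_distr) (auto simp: comp_def)
    also have "\<dots> = distr \<nu> (config_borel time_space) \<tau>" by (rule distr_cong) (auto simp: sets_\<mu>)
    finally show "distr \<gamma> \<mu> fst = \<mu>" using distr_shift[OF \<tau>] by simp
    show "distr \<gamma> \<nu> snd = \<nu>" unfolding \<gamma>_def by (subst distr_distr) (auto simp: comp_def)
  qed
  then have "rubinstein wasserstein \<mu> \<nu> \<le> (\<integral>\<^sup>+p. (case p of (\<omega>, \<eta>) \<Rightarrow> wasserstein \<omega> \<eta>) \<partial>\<gamma>)"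
    unfolding rubinstein_def by (rule INF_lower)
  \<comment> \<open>An upper bound for the integral against the image measure is enough here, so
    \<open>wasserstein\<close> enters without a measurability proof.\<close>
  also have "\<dots> \<le> (\<integral>\<^sup>+\<omega>. wasserstein (\<tau> \<omega>) \<omega> \<partial>\<nu>)"
    unfolding \<gamma>_def using nn_integral_distr_le[of "\<lambda>\<omega>. (\<tau> \<omega>, \<omega>)" \<nu> "\<mu> \<Otimes>\<^sub>M \<nu>" "\<lambda>(\<omega>, \<eta>). wasserstein \<omega> \<eta>"]
    by simp
  also have "\<dots> \<le> (\<integral>\<^sup>+\<omega>. ennreal_sqrt (C \<omega>) \<partial>\<nu>)"
  proof (rule nn_integral_mono_AE)
    show "AE \<omega> in \<nu>. wasserstein (\<tau> \<omega>) \<omega> \<le> ennreal_sqrt (C \<omega>)"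
      using \<tau>(2) by eventually_elim (use wasserstein_shift_le in \<open>simp add: C_def\<close>)
  qed
  finally have "(rubinstein wasserstein \<mu> \<nu>)\<^sup>2 \<le> (\<integral>\<^sup>+\<omega>. ennreal_sqrt (C \<omega>) \<partial>\<nu>)\<^sup>2"
    by (rule power_mono) simp
  also have "\<dots> \<le> (\<integral>\<^sup>+\<omega>. (ennreal_sqrt (C \<omega>))\<^sup>2 \<partial>\<nu>)"
    by (rule \<nu>.nn_integral_power2_le) measurable
  also have "\<dots> = (\<integral>\<^sup>+\<omega>. C \<omega> \<partial>\<nu>)" by simp
  finally show ?thesis unfolding C_def mean_cost .
qed

end

theorem theorem3p4:
  fixes \<sigma> :: "(real ^ 'k) measure"
    and \<mu> \<nu> :: "(real \<times> (real ^ 'k)) set measure"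
    and L :: "(real \<times> (real ^ 'k)) set \<Rightarrow> real"
    and u :: "real \<Rightarrow> real ^ 'k \<Rightarrow> (real \<times> (real ^ 'k)) set \<Rightarrow> real"
  assumes sigma: "diffuse_radon_measure \<sigma>"
    and poisson: "poisson_measure time_space (halfline \<Otimes>\<^sub>M \<sigma>) \<mu>"
    and L_meas: "L \<in> borel_measurable \<mu>"
    and L_pos: "AE \<omega> in \<mu>. 0 < L \<omega>"
    and nu: "prob_space \<nu>" "\<nu> = density \<mu> (\<lambda>\<omega>. ennreal (L \<omega>))"
    and u_pred: "predictable u"
    and u_eq: "AE (t, z) in halfline \<Otimes>\<^sub>M \<sigma>. AE \<omega> in \<mu>.
        u t z \<omega> = real_cond_exp \<mu> (filt_left t) (grad t z L) \<omega> /
                   real_cond_exp \<mu> (filt_left t) L \<omega>"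
    and grad_welldef: "AE (t, z) in halfline \<Otimes>\<^sub>M \<sigma>. integrable \<mu> (grad t z L)"
    and integral_welldef: "AE \<omega> in \<mu>. AE z in \<sigma>. \<forall>t\<ge>0. set_integrable lborel {0..t} (\<lambda>s. u s z \<omega>)"
    and inverse_welldef: "AE \<omega> in \<mu>. AE z in \<sigma>. bij_betw (\<lambda>t. time_change u t z \<omega>) {0..} {0..}"
  shows "(AE (t, z) in halfline \<Otimes>\<^sub>M \<sigma>. AE \<omega> in \<mu>. u t z \<omega> > -1) \<and>
    (rubinstein wasserstein \<mu> \<nu>)\<^sup>2 \<le>
      (\<integral>\<^sup>+\<omega>. ennreal (L \<omega>) *
        (\<integral>\<^sup>+z. (\<integral>\<^sup>+t. ennreal (\<bar>time_integral u t z \<omega>\<bar>\<^sup>2 * (1 + u t z \<omega>)) \<partial>halfline) \<partial>\<sigma>) \<partial>\<mu>) \<and>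
    (\<integral>\<^sup>+\<omega>. ennreal (L \<omega>) *
        (\<integral>\<^sup>+z. (\<integral>\<^sup>+t. ennreal (\<bar>time_integral u t z \<omega>\<bar>\<^sup>2 * (1 + u t z \<omega>)) \<partial>halfline) \<partial>\<sigma>) \<partial>\<mu>) =
      (\<integral>\<^sup>+\<omega>. ennreal (L \<omega>) *
        (\<integral>\<^sup>+z. (\<integral>\<^sup>+r. ennreal (\<bar>r - time_change_inv u r z \<omega>\<bar>\<^sup>2) \<partial>halfline) \<partial>\<sigma>) \<partial>\<mu>)"
proof -
  interpret poisson_time_change \<sigma> \<mu> \<nu> L u
    by (intro poisson_time_change.intro poisson_density.intro poisson_time_change_axioms.intro) (fact assms)+
  \<comment> \<open>Positivity of \<open>1 + u\<close> is a by-product of the conditional density,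
    as a ratio of positive conditional expectations.\<close>
  have "AE (t, z) in halfline \<Otimes>\<^sub>M \<sigma>. AE \<omega> in \<mu>. u t z \<omega> > -1"
    using conditional_density by eventually_elim (auto simp: U_def)
  then show ?thesis using rubinstein_power2_le cost_eq_inverse_cost by blast
qed

end
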